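(* Assume $K_h^\star\neq\emptyset$. Then there exists a tuple $(\mathbf u_h^{rt},\overline p_h^{rt},\lambda_h^a,\lambda_h^b)\in\mathcal{RT}^0(\mathcal T_h)\times\mathcal L^0(\mathcal T_h)\times(\mathcal L^0(\mathcal S_h^C))^2$ such that for every $(\mathbf v_h,\overline q_h)\in\mathcal{RT}^0(\mathcal T_h)\times\mathcal L^0(\mathcal T_h)$: $$(\mathbf K_h^{-1}\Pi_h\mathbf u_h^{rt},\Pi_h\mathbf v_h)_\Omega-(\overline p_h^{rt},\mathrm{div}\,\mathbf v_h)_\Omega+\langle\lambda_h^a-\lambda_h^b,\mathbf v_h\cdot\mathbf n\rangle_{\Gamma_C}=-\langle p_D^h,\mathbf v_h\cdot\mathbf n\rangle_{\Gamma_D},$$ $$(\mathrm{div}\,\mathbf u_h^{rt},\overline q_h)_\Omega=(f_h,\overline q_h)_\Omega,$$ $$\alpha_h\le\mathbf u_h^{rt}\cdot\mathbf n\le\beta_h,\qquad\lambda_h^a,\lambda_h^b\le0\qquad\text{on }\mathcal S_h^C,$$ $$\lambda_h^a(\mathbf u_h^{rt}\cdot\mathbf n-\alpha_h)=\lambda_h^b(\beta_h-\mathbf u_h^{rt}\cdot\mathbf n)=0\qquad\text{on }\mathcal S_h^C.$$ Moreover, $\mathbf u_h^{rt}$ is the unique solution of the discrete dual problem: $\mathbf u_h^{rt}\in K_h^\star$ and $D_h^{rt}(\mathbf u_h^{rt})=\sup_{\mathbf v_h\in K_h^\star}D_h^{rt}(\mathbf v_h)$.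
   Context: Setting. $\Omega\subset\mathbb R^d$, $d\in\{2,3\}$, is an open, bounded, polyhedral Lipschitz domain with outward unit normal $\mathbf n$; $\partial\Omega=\overline{\Gamma_D}\cup\overline{\Gamma_C}$ with $\Gamma_D,\Gamma_C$ relatively open and disjoint. Data: $f\in L^2(\Omega)$; $p_D\in H^{1/2}(\Gamma_D)$ (restrictions to $\Gamma_D$ of traces of $H^1(\Omega)$ functions); $\mathbf K:\Omega\to\mathbb R^{d\times d}$ measurable, symmetric, with $k_0|\xi|^2\le\xi^T\mathbf K(x)\xi\le k_1|\xi|^2$ for all $x,\xi$ and some $0<k_0<k_1$; $\alpha,\beta\in L^2(\Gamma_C)$ with $\alpha\le\beta$ a.e.; if $\Gamma_D=\emptyset$, then $\int_{\Gamma_C}\alpha\,ds\le\int_\Omega f\,dx\le\int_{\Gamma_C}\beta\,ds$. $(\cdot,\cdot)_\Omega$ and $\langle\cdot,\cdot\rangle_\omega$ denote $L^2$ inner products. Mesh. $\mathcal T_h$ is a conforming simplicial triangulation of $\Omega$ with facets $\mathcal S_h$; every boundary facet is contained in exactly one of $\overline{\Gamma_D},\overline{\Gamma_C}$, and $\mathcal S_h^D,\mathcal S_h^C$ are the corresponding sets of boundary facets. $x_S$ is the barycenter of $S$. $\mathcal L^0(\mathcal T_h)$, $\mathcal L^0(\mathcal S_h^C)$ are the elementwise/facetwise constant functions; $\Pi_h$ and $\pi_h$ are the elementwise and facetwise $L^2$-projections onto constants (componentwise for vectors and matrices). Spaces. $\mathcal{RT}^0(\mathcal T_h)=\{\mathbf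 v_h\in H(\mathrm{div};\Omega):\mathbf v_h|_T\in\mathbb P^0(T)^d\oplus\mathbf x\,\mathbb P^0(T)\ \forall T\in\mathcal T_h\}$ (lowest-order Raviart–Thomas). The Crouzeix–Raviart space $\mathcal S^{1,cr}(\mathcal T_h)$ consists of elementwise affine functions continuous at barycenters of interior facets, with basis $\varphi_S$, $\varphi_S(x_{S'})=\delta_{S,S'}$; $\Pi_h^{cr}q=\sum_{S\in\mathcal S_h}\big(\tfrac1{|S|}\int_Sq\,ds\big)\varphi_S$ for $q\in H^1(\Omega)$. Discrete data. $\mathbf K_h=\Pi_h\mathbf K$, $f_h=\Pi_hf$, $\alpha_h=\pi_h\alpha$, $\beta_h=\pi_h\beta$, $p_D^h=\Pi_h^{cr}\widehat p_D$ with $\widehat p_D\in H^1(\Omega)$ any fixed function whose trace on $\Gamma_D$ is $p_D$. Discrete dual problem. $$K_h^\star=\{\mathbf v_h\in\mathcal{RT}^0(\mathcal T_h):\mathrm{div}\,\mathbf v_h=f_h\text{ in }\Omega,\ \alpha_h\le\mathbf v_h\cdot\mathbf n\le\beta_h\text{ on every }S\in\mathcal S_h^C\},$$ $$D_h^{rt}(\mathbf v_h)=-\tfrac12\|\mathbf K_h^{-1/2}\Pi_h\mathbf v_h\|_{L^2(\Omega)}^2-\langle p_D^h,\mathbf v_h\cdot\mathbf n\rangle_{\Gamma_D},\qquad\mathbf v_h\in K_h^\star.$$ *)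

theory Defs
  imports "HOL-Analysis.Analysis"
begin

section \<open>Domains\<close>

text \<open>The boundary is locally the graph of a Lipschitz function over the hyperplane
  orthogonal to \<open>e\<close>, with the set lying on one side of the graph.\<close>

definition lipschitz_domain :: "'a::euclidean_space set \<Rightarrow> bool" where
  "lipschitz_domain \<Omega> \<longleftrightarrow>
     open \<Omega> \<and> connected \<Omega> \<and> \<Omega> \<noteq> {} \<and>
     (\<forall>x\<in>frontier \<Omega>. \<exists>r>0. \<exists>e \<gamma> L. norm e = 1 \<and> L-lipschitz_on {y. y \<bullet> e = 0} \<gamma> \<and>
        (\<forall>y\<in>ball x r. y \<in> \<Omega> \<longleftrightarrow> \<gamma> (y - (y \<bullet> e) *\<^sub>R e) < y \<bullet> e))"

definition polyhedral_lipschitz_domain :: "'a::euclidean_space set \<Rightarrow> bool" where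
  "polyhedral_lipschitz_domain \<Omega> \<longleftrightarrow>
     lipschitz_domain \<Omega> \<and> bounded \<Omega> \<and>
     (\<exists>\<P>. finite \<P> \<and> (\<forall>P\<in>\<P>. polytope P) \<and> closure \<Omega> = \<Union>\<P>)"

text \<open>The outward unit normal of a polyhedral domain exists at the boundary points near which
  the domain is a half-space, that is, at almost every boundary point.\<close>

definition outer_normal :: "'a::euclidean_space set \<Rightarrow> 'a \<Rightarrow> 'a" where
  "outer_normal \<Omega> x =
     (THE n. norm n = 1 \<and> (\<exists>r>0. \<Omega> \<inter> ball x r = {y \<in> ball x r. (y - x) \<bullet> n < 0}))"

section \<open>Meshes\<close>

text \<open>Elements and facets are closed simplices. Conformity is contained in \<^const>\<open>triangulation\<close>:
  the intersection of two elements is a face of both.\<close>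

definition simplicial_mesh :: "'a::euclidean_space set \<Rightarrow> 'a set set \<Rightarrow> bool" where
  "simplicial_mesh \<Omega> \<T> \<longleftrightarrow>
     triangulation \<T> \<and> (\<forall>T\<in>\<T>. int DIM('a) simplex T) \<and> \<Union>\<T> = closure \<Omega>"

definition facets :: "'a::euclidean_space set set \<Rightarrow> 'a set set" where
  "facets \<T> = {S. \<exists>T\<in>\<T>. S facet_of T}"

definition boundary_facets :: "'a::euclidean_space set \<Rightarrow> 'a set set \<Rightarrow> 'a set set" where
  "boundary_facets \<Omega> \<T> = {S \<in> facets \<T>. S \<subseteq> frontier \<Omega>}"

definition facets_on :: "'a::euclidean_space set \<Rightarrow> 'a set set \<Rightarrow> 'a set \<Rightarrow> 'a set set" where
  "facets_on \<Omega> \<T> \<Gamma> = {S \<in> boundary_facets \<Omega> \<T>. S \<subseteq> closure \<Gamma>}"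

definition mesh_interior :: "'a::euclidean_space set set \<Rightarrow> 'a set" where
  "mesh_interior \<T> = (\<Union>T\<in>\<T>. interior T)"

definition barycenter :: "'a::euclidean_space set \<Rightarrow> 'a" where
  "barycenter S = (\<Sum>x | x extreme_point_of S. x) /\<^sub>R real (card {x. x extreme_point_of S})"

section \<open>Square-integrable functions and surface integrals\<close>

definition square_integrable :: "'a measure \<Rightarrow> ('a \<Rightarrow> 'b::euclidean_space) \<Rightarrow> bool" where
  "square_integrable M g \<longleftrightarrow> g \<in> borel_measurable M \<and> integrable M (\<lambda>x. (norm (g x))\<^sup>2)"

definition L2_inner :: "'a::euclidean_space set \<Rightarrow> ('a \<Rightarrow> 'b::euclidean_space) \<Rightarrow> ('a \<Rightarrow> 'b) \<Rightarrow> real" where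
  "L2_inner \<Omega> g h = (LINT x|lebesgue_on \<Omega>. g x \<bullet> h x)"

text \<open>For a set \<open>S\<close> spanning a hyperplane with unit normal \<open>\<nu>\<close>, Lebesgue measure is the product of
  the (codimension one) surface measure of the hyperplane and the length along \<open>\<nu>\<close>. The surface
  measure of \<open>S\<close> is therefore the image of Lebesgue measure on the prism over \<open>S\<close> of height one
  under the orthogonal projection onto the hyperplane. Neither the sign of \<open>\<nu>\<close> nor the base point
  \<open>p\<close> matters.\<close>

definition hyperplane_normal :: "'a::euclidean_space set \<Rightarrow> 'a" where
  "hyperplane_normal S = (SOME \<nu>. norm \<nu> = 1 \<and> (\<forall>x\<in>S. \<forall>y\<in>S. (x - y) \<bullet> \<nu> = 0))"

definition facet_measure :: "'a::euclidean_space set \<Rightarrow> 'a measure" where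
  "facet_measure S =
     (let \<nu> = hyperplane_normal S; p = (SOME p. p \<in> S) in
       completion
         (distr (restrict_space lborel {x + t *\<^sub>R \<nu> | x t. x \<in> S \<and> 0 \<le> t \<and> t \<le> 1}) borel
            (\<lambda>y. y - ((y - p) \<bullet> \<nu>) *\<^sub>R \<nu>)))"

text \<open>A polyhedral boundary is the union of its boundary facets, which overlap in surface null sets
  only. Surface notions on a part \<open>\<Gamma>\<close> of it are therefore facet by facet: below, \<open>\<S>\<close> is the set
  of all boundary facets.\<close>

definition surface_integral :: "'a::euclidean_space set set \<Rightarrow> 'a set \<Rightarrow> ('a \<Rightarrow> real) \<Rightarrow> real" where
  "surface_integral \<S> \<Gamma> g = (\<Sum>S\<in>\<S>. LINT x|restrict_space (facet_measure S) \<Gamma>. g x)"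

definition surface_inner :: "'a::euclidean_space set set \<Rightarrow> 'a set \<Rightarrow> ('a \<Rightarrow> real) \<Rightarrow> ('a \<Rightarrow> real) \<Rightarrow> real" where
  "surface_inner \<S> \<Gamma> g h = surface_integral \<S> \<Gamma> (\<lambda>x. g x * h x)"

definition surface_L2 :: "'a::euclidean_space set set \<Rightarrow> 'a set \<Rightarrow> ('a \<Rightarrow> real) \<Rightarrow> bool" where
  "surface_L2 \<S> \<Gamma> g \<longleftrightarrow> (\<forall>S\<in>\<S>. square_integrable (restrict_space (facet_measure S) \<Gamma>) g)"

definition surface_AE :: "'a::euclidean_space set set \<Rightarrow> 'a set \<Rightarrow> ('a \<Rightarrow> bool) \<Rightarrow> bool" where
  "surface_AE \<S> \<Gamma> P \<longleftrightarrow> (\<forall>S\<in>\<S>. AE x in restrict_space (facet_measure S) \<Gamma>. P x)"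

section \<open>Weak derivatives, \<open>H\<^sup>1\<close>, \<open>H(div)\<close> and traces\<close>

definition C1_with_gradient :: "('a::euclidean_space \<Rightarrow> real) \<Rightarrow> ('a \<Rightarrow> 'a) \<Rightarrow> bool" where
  "C1_with_gradient \<phi> D \<longleftrightarrow> (\<forall>x. GDERIV \<phi> x :> D x) \<and> continuous_on UNIV D"

text \<open>Test functions are \<open>C\<^sup>1\<close> with compact support in \<open>\<Omega>\<close>; by mollification they give the same
  weak derivatives as smooth ones.\<close>

definition test_function :: "'a::euclidean_space set \<Rightarrow> ('a \<Rightarrow> real) \<Rightarrow> ('a \<Rightarrow> 'a) \<Rightarrow> bool" where
  "test_function \<Omega> \<phi> D \<longleftrightarrow>
     C1_with_gradient \<phi> D \<and> compact (closure {x. \<phi> x \<noteq> 0}) \<and> closure {x. \<phi> x \<noteq> 0} \<subseteq> \<Omega>"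

definition has_weak_gradient ::
    "'a::euclidean_space set \<Rightarrow> ('a \<Rightarrow> real) \<Rightarrow> ('a \<Rightarrow> 'a) \<Rightarrow> bool" where
  "has_weak_gradient \<Omega> q G \<longleftrightarrow>
     square_integrable (lebesgue_on \<Omega>) G \<and>
     (\<forall>\<phi> D. test_function \<Omega> \<phi> D \<longrightarrow>
        (LINT x|lebesgue_on \<Omega>. q x *\<^sub>R D x) = - (LINT x|lebesgue_on \<Omega>. \<phi> x *\<^sub>R G x))"

definition has_weak_div ::
    "'a::euclidean_space set \<Rightarrow> ('a \<Rightarrow> 'a) \<Rightarrow> ('a \<Rightarrow> real) \<Rightarrow> bool" where
  "has_weak_div \<Omega> v g \<longleftrightarrow>
     square_integrable (lebesgue_on \<Omega>) g \<and>
     (\<forall>\<phi> D. test_function \<Omega> \<phi> D \<longrightarrow>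
        (LINT x|lebesgue_on \<Omega>. v x \<bullet> D x) = - (LINT x|lebesgue_on \<Omega>. g x * \<phi> x))"

definition H1 :: "'a::euclidean_space set \<Rightarrow> ('a \<Rightarrow> real) set" where
  "H1 \<Omega> = {q. square_integrable (lebesgue_on \<Omega>) q \<and> (\<exists>G. has_weak_gradient \<Omega> q G)}"

definition Hdiv :: "'a::euclidean_space set \<Rightarrow> ('a \<Rightarrow> 'a) set" where
  "Hdiv \<Omega> = {v. square_integrable (lebesgue_on \<Omega>) v \<and> (\<exists>g. has_weak_div \<Omega> v g)}"

text \<open>Determined up to a null set.\<close>

definition weak_div :: "'a::euclidean_space set \<Rightarrow> ('a \<Rightarrow> 'a) \<Rightarrow> 'a \<Rightarrow> real" where
  "weak_div \<Omega> v = (SOME g. has_weak_div \<Omega> v g)"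

text \<open>The trace operator is the continuous extension from \<open>H\<^sup>1(\<Omega>)\<close> to \<open>L\<^sup>2(M)\<close> of the restriction
  of functions that are \<open>C\<^sup>1\<close> up to the boundary; \<open>M\<close> is the surface measure of a piece of a
  hyperplane.\<close>

definition has_trace ::
    "'a::euclidean_space set \<Rightarrow> 'a measure \<Rightarrow> ('a \<Rightarrow> real) \<Rightarrow> ('a \<Rightarrow> real) \<Rightarrow> bool" where
  "has_trace \<Omega> M q g \<longleftrightarrow>
     square_integrable M g \<and>
     (\<exists>G \<phi> D. has_weak_gradient \<Omega> q G \<and> (\<forall>k::nat. C1_with_gradient (\<phi> k) (D k)) \<and>
        (\<lambda>k. LINT x|lebesgue_on \<Omega>. (\<phi> k x - q x)\<^sup>2) \<longlonglongrightarrow> 0 \<and>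
        (\<lambda>k. LINT x|lebesgue_on \<Omega>. (norm (D k x - G x))\<^sup>2) \<longlonglongrightarrow> 0 \<and>
        (\<lambda>k. LINT x|M. (\<phi> k x - g x)\<^sup>2) \<longlonglongrightarrow> 0)"

definition has_surface_trace ::
    "'a::euclidean_space set \<Rightarrow> 'a set set \<Rightarrow> 'a set \<Rightarrow> ('a \<Rightarrow> real) \<Rightarrow> ('a \<Rightarrow> real) \<Rightarrow> bool" where
  "has_surface_trace \<Omega> \<S> \<Gamma> q g \<longleftrightarrow>
     (\<forall>S\<in>\<S>. has_trace \<Omega> (restrict_space (facet_measure S) \<Gamma>) q g)"

definition H_half :: "'a::euclidean_space set \<Rightarrow> 'a set set \<Rightarrow> 'a set \<Rightarrow> ('a \<Rightarrow> real) set" where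
  "H_half \<Omega> \<S> \<Gamma> = {g. \<exists>q\<in>H1 \<Omega>. has_surface_trace \<Omega> \<S> \<Gamma> q g}"

text \<open>Determined up to a surface null set.\<close>

definition facet_trace ::
    "'a::euclidean_space set \<Rightarrow> 'a set \<Rightarrow> ('a \<Rightarrow> real) \<Rightarrow> 'a \<Rightarrow> real" where
  "facet_trace \<Omega> S q = (SOME g. has_trace \<Omega> (facet_measure S) q g)"

text \<open>Elementwise polynomials have one-sided limits at the relative interior points of boundary
  facets; these are the boundary values of discrete functions.\<close>

definition boundary_value ::
    "'a::euclidean_space set \<Rightarrow> ('a \<Rightarrow> 'b::euclidean_space) \<Rightarrow> 'a \<Rightarrow> 'b" where
  "boundary_value \<Omega> g x = Lim (at x within \<Omega>) g"

definition normal_trace :: "'a::euclidean_space set \<Rightarrow> ('a \<Rightarrow> 'a) \<Rightarrow> 'a \<Rightarrow> real" where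
  "normal_trace \<Omega> v x = boundary_value \<Omega> v x \<bullet> outer_normal \<Omega> x"

section \<open>Discrete spaces\<close>

text \<open>Discrete functions are represented by functions on the whole space of which only the values in
  the interiors of the elements (relative interiors of the facets) are relevant.\<close>

definition L0_elements :: "'a::euclidean_space set set \<Rightarrow> ('a \<Rightarrow> real) set" where
  "L0_elements \<T> = {q. \<forall>T\<in>\<T>. \<exists>c. \<forall>x\<in>interior T. q x = c}"

definition L0_facets :: "'a::euclidean_space set set \<Rightarrow> ('a \<Rightarrow> real) set" where
  "L0_facets \<S> = {q. \<forall>S\<in>\<S>. \<exists>c. \<forall>x\<in>rel_interior S. q x = c}"

definition RT0 :: "'a::euclidean_space set \<Rightarrow> 'a set set \<Rightarrow> ('a \<Rightarrow> 'a) set" where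
  "RT0 \<Omega> \<T> = {v \<in> Hdiv \<Omega>. \<forall>T\<in>\<T>. \<exists>a c. \<forall>x\<in>interior T. v x = a + c *\<^sub>R x}"

text \<open>Continuity at a barycenter means that the limits from the two adjacent elements agree.\<close>

definition CR1 :: "'a::euclidean_space set \<Rightarrow> 'a set set \<Rightarrow> ('a \<Rightarrow> real) set" where
  "CR1 \<Omega> \<T> =
     {q. (\<forall>T\<in>\<T>. \<exists>a c. \<forall>x\<in>interior T. q x = a \<bullet> x + c) \<and>
         (\<forall>S \<in> facets \<T> - boundary_facets \<Omega> \<T>.
            \<exists>l. (q \<longlongrightarrow> l) (at (barycenter S) within mesh_interior \<T>))}"

definition CR_basis :: "'a::euclidean_space set \<Rightarrow> 'a set set \<Rightarrow> 'a set \<Rightarrow> 'a \<Rightarrow> real" where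
  "CR_basis \<Omega> \<T> S =
     (SOME \<phi>. \<phi> \<in> CR1 \<Omega> \<T> \<and>
        (\<forall>S'\<in>facets \<T>. (\<phi> \<longlongrightarrow> (if S = S' then 1 else 0))
                           (at (barycenter S') within mesh_interior \<T>)))"

definition CR_interpolant ::
    "'a::euclidean_space set \<Rightarrow> 'a set set \<Rightarrow> ('a \<Rightarrow> real) \<Rightarrow> 'a \<Rightarrow> real" where
  "CR_interpolant \<Omega> \<T> q x =
     (\<Sum>S\<in>facets \<T>. (LINT y|facet_measure S. facet_trace \<Omega> S q y) / measure (facet_measure S) UNIV
                      * CR_basis \<Omega> \<T> S x)"

text \<open>The \<open>L\<^sup>2(M)\<close>-orthogonal projection onto the constants, for a finite measure \<open>M\<close>. Vectors and
  matrices carry the Euclidean (Frobenius) inner product, so that it acts componentwise.\<close>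

definition L2_proj_const :: "'a measure \<Rightarrow> ('a \<Rightarrow> 'b::euclidean_space) \<Rightarrow> 'b" where
  "L2_proj_const M g = (THE c. \<forall>a. (LINT x|M. (g x - c) \<bullet> a) = 0)"

definition elem_proj ::
    "'a::euclidean_space set set \<Rightarrow> ('a \<Rightarrow> 'b::euclidean_space) \<Rightarrow> 'a \<Rightarrow> 'b" where
  "elem_proj \<T> g x = L2_proj_const (lebesgue_on (THE T. T \<in> \<T> \<and> x \<in> interior T)) g"

text \<open>The data \<open>g\<close> are given on \<open>\<Gamma>\<close> only, hence the restriction; for a facet in the closure of \<open>\<Gamma>\<close>
  this removes nothing but the interface between the two boundary parts.\<close>

definition facet_proj ::
    "'a::euclidean_space set set \<Rightarrow> 'a set \<Rightarrow> ('a \<Rightarrow> real) \<Rightarrow> 'a \<Rightarrow> real" where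
  "facet_proj \<S> \<Gamma> g x =
     L2_proj_const (restrict_space (facet_measure (THE S. S \<in> \<S> \<and> x \<in> rel_interior S)) \<Gamma>) g"

text \<open>The positive semidefinite square root, unique for symmetric positive semidefinite \<open>A\<close>;
  \<open>K\<^sup>-\<^sup>1\<^sup>/\<^sup>2\<close> is the square root of \<open>K\<^sup>-\<^sup>1\<close>.\<close>

definition matrix_sqrt :: "real^'n^'n \<Rightarrow> real^'n^'n" where
  "matrix_sqrt A = (SOME B. transpose B = B \<and> (\<forall>\<xi>. 0 \<le> \<xi> \<bullet> (B *v \<xi>)) \<and> B ** B = A)"

section \<open>The discrete dual problem\<close>

definition dual_feasible ::
    "'a::euclidean_space set \<Rightarrow> 'a set set \<Rightarrow> 'a set \<Rightarrow> ('a \<Rightarrow> real) \<Rightarrow> ('a \<Rightarrow> real) \<Rightarrow> ('a \<Rightarrow> real)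
      \<Rightarrow> ('a \<Rightarrow> 'a) set" where
  "dual_feasible \<Omega> \<T> \<Gamma>\<^sub>C f\<^sub>h \<alpha>\<^sub>h \<beta>\<^sub>h =
     {v \<in> RT0 \<Omega> \<T>. (AE x in lebesgue_on \<Omega>. weak_div \<Omega> v x = f\<^sub>h x) \<and>
        (\<forall>S\<in>facets_on \<Omega> \<T> \<Gamma>\<^sub>C. \<forall>x\<in>rel_interior S.
           \<alpha>\<^sub>h x \<le> normal_trace \<Omega> v x \<and> normal_trace \<Omega> v x \<le> \<beta>\<^sub>h x)}"

definition dual_energy ::
    "(real^'n) set \<Rightarrow> (real^'n) set set \<Rightarrow> (real^'n) set \<Rightarrow> (real^'n \<Rightarrow> real^'n^'n) \<Rightarrow> (real^'n \<Rightarrow> real)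
      \<Rightarrow> (real^'n \<Rightarrow> real^'n) \<Rightarrow> real" where
  "dual_energy \<Omega> \<T> \<Gamma>\<^sub>D K\<^sub>h p\<^sub>h v =
     - (1/2) * (LINT x|lebesgue_on \<Omega>. (norm (matrix_sqrt (matrix_inv (K\<^sub>h x)) *v elem_proj \<T> v x))\<^sup>2)
     - surface_inner (boundary_facets \<Omega> \<T>) \<Gamma>\<^sub>D (boundary_value \<Omega> p\<^sub>h) (normal_trace \<Omega> v)"

end

theory Submission
  imports Defs
begin

text \<open>
  The theorem is finite-dimensional convex quadratic programming: since all constraints are affine,
  a minimiser has multipliers as soon as the problem is feasible. Up to null sets, a
  function \<open>v\<close> of the Raviart--Thomas space is determined by finitely many linear
  functionals: its mean and its divergence on each element. The dual energy, the divergence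
  constraints and the bounds on the normal flux are expressed by such functionals, so that the
  problem reads: minimise \<open>a(v, v) / 2 - l(v)\<close> over a subspace subject to finitely many affine
  equations and inequalities. The quadratic part of the dual energy alone controls only the means.
  Adding the squared \<open>L\<^sup>2\<close> norm of the divergence makes \<open>a\<close> definite; it changes the energy of every
  feasible function by the same constant, because the divergence of a feasible function is
  prescribed, and it changes the stationarity equation by a term that is absorbed in the pressure.

  The optimisation part is purely algebraic. The Riesz representation in finitely many coordinates
  (\<open>riesz_representation_finite\<close>) solves the unconstrained problem, and \<open>kkt_inequalities\<close> adds one
  constraint at a time: if the solution without the new constraint violates it, the constraint is
  imposed as an equation, which restricts the problem to a hyperplane, and comparison of the two
  solutions shows that the new multiplier has the right sign. The multipliers of the equations form
  the pressure and those of the inequalities the two facet multipliers; \<open>kkt_sufficient\<close> turns the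
  stationarity conditions back into optimality, with a quadratic gain that gives uniqueness.

  The rest identifies the functionals. The weak divergence of \<open>a + c x\<close> on an element is the
  constant \<open>d c\<close> in dimension \<open>d\<close>, by integration by parts against test functions and the fundamental lemma of the
  calculus of variations (\<open>weak_div_RT0\<close>). Near an interior point of a boundary facet the domain is a
  half ball inside a single element (\<open>boundary_chart_exists\<close>). Hence the outer normal is constant along
  the facet, and since \<open>a + c x\<close> has constant normal component on a hyperplane, so is the normal trace
  (\<open>normal_trace_eq_flux\<close>). Surface integrals then become sums over facets. The part of \<open>\<Gamma>\<^sub>C\<close> in a
  facet of its closure has positive surface measure (\<open>measure_facet_part_pos\<close>), so that a multiplier
  of the algebraic problem can be distributed as a constant density over the facet. The elementwise
  means of the coefficient are symmetric and positive definite (\<open>mean_matrix_elliptic\<close>), hence so are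
  their inverses, which therefore have square roots.
\<close>

section \<open>Quadratic programming on spaces of functions\<close>

text \<open>Closure under two-term combinations covers sums, multiples and the zero function at once;
  subspaces of functions and linear forms on them are described through it.\<close>

definition lin_comb :: "real \<Rightarrow> ('x \<Rightarrow> 'b::real_vector) \<Rightarrow> real \<Rightarrow> ('x \<Rightarrow> 'b) \<Rightarrow> 'x \<Rightarrow> 'b" where
  "lin_comb s u t v = (\<lambda>x. s *\<^sub>R u x + t *\<^sub>R v x)"

definition fun_subspace :: "('x \<Rightarrow> 'b::real_vector) set \<Rightarrow> bool" where
  "fun_subspace V \<longleftrightarrow> V \<noteq> {} \<and> (\<forall>u\<in>V. \<forall>v\<in>V. \<forall>s t. lin_comb s u t v \<in> V)"

definition linear_form :: "('x \<Rightarrow> 'b::real_vector) set \<Rightarrow> (('x \<Rightarrow> 'b) \<Rightarrow> real) \<Rightarrow> bool" where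
  "linear_form V l \<longleftrightarrow> (\<forall>u\<in>V. \<forall>v\<in>V. \<forall>s t. l (lin_comb s u t v) = s * l u + t * l v)"

definition semi_inner_product ::
    "('x \<Rightarrow> 'b::real_vector) set \<Rightarrow> (('x \<Rightarrow> 'b) \<Rightarrow> ('x \<Rightarrow> 'b) \<Rightarrow> real) \<Rightarrow> bool" where
  "semi_inner_product V a \<longleftrightarrow>
     (\<forall>w\<in>V. linear_form V (a w)) \<and> (\<forall>u\<in>V. \<forall>v\<in>V. a u v = a v u) \<and> (\<forall>v\<in>V. 0 \<le> a v v)"

lemma fun_subspaceD: "fun_subspace V \<Longrightarrow> u \<in> V \<Longrightarrow> v \<in> V \<Longrightarrow> lin_comb s u t v \<in> V"
  by (simp add: fun_subspace_def)

lemma linear_formD: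
  "linear_form V l \<Longrightarrow> u \<in> V \<Longrightarrow> v \<in> V \<Longrightarrow> l (lin_comb s u t v) = s * l u + t * l v"
  by (simp add: linear_form_def)

lemma linear_form_subset: "linear_form V l \<Longrightarrow> W \<subseteq> V \<Longrightarrow> linear_form W l"
  by (auto simp: linear_form_def)

lemma semi_inner_product_subset: "semi_inner_product V a \<Longrightarrow> W \<subseteq> V \<Longrightarrow> semi_inner_product W a"
  unfolding semi_inner_product_def by (blast intro: linear_form_subset)

lemma semi_inner_productD:
  assumes "semi_inner_product V a" "u \<in> V" "v \<in> V" "w \<in> V"
  shows "a w (lin_comb s u t v) = s * a w u + t * a w v" "a u v = a v u" "0 \<le> a v v"
  using assms by (auto simp: semi_inner_product_def linear_form_def)

lemma semi_inner_product_left: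
  assumes "fun_subspace V" "semi_inner_product V a" "u \<in> V" "v \<in> V" "w \<in> V"
  shows "a (lin_comb s u t v) w = s * a u w + t * a v w"
  using semi_inner_productD(1)[OF assms(2,3,4,5), of s t] semi_inner_productD(2)[OF assms(2)]
    fun_subspaceD[OF assms(1,3,4)] assms(3-5) by simp

lemma fun_subspace_kernel:
  assumes V: "fun_subspace V" and l: "linear_form V l"
  shows "fun_subspace {v \<in> V. l v = 0}"
proof -
  obtain u where u: "u \<in> V" using V by (auto simp: fun_subspace_def)
  then have "lin_comb 0 u 0 u \<in> {v \<in> V. l v = 0}"
    using fun_subspaceD[OF V u u] linear_formD[OF l u u] by simp
  moreover have "lin_comb s v t w \<in> {v \<in> V. l v = 0}"
    if "v \<in> {v \<in> V. l v = 0}" "w \<in> {v \<in> V. l v = 0}" for v w s t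
    using that fun_subspaceD[OF V] linear_formD[OF l] by simp
  ultimately show ?thesis unfolding fun_subspace_def by blast
qed

text \<open>Cauchy--Schwarz in its degenerate case: otherwise \<open>a w w + 2 t a(v, w)\<close>, which is the value of
  the form at \<open>w + t v\<close>, would become negative for suitable \<open>t\<close>.\<close>

lemma semi_inner_product_null:
  assumes V: "fun_subspace V" and a: "semi_inner_product V a"
    and v: "v \<in> V" "a v v = 0" and w: "w \<in> V"
  shows "a v w = 0"
proof -
  have *: "0 \<le> a w w + 2 * t * a v w" for t
  proof -
    have m: "lin_comb 1 w t v \<in> V" by (rule fun_subspaceD[OF V w v(1)])
    have "0 \<le> a (lin_comb 1 w t v) (lin_comb 1 w t v)"
      by (rule semi_inner_productD(3)[OF a m m m])
    also have "\<dots> = a w w + 2 * t * a v w"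
      using v(2) semi_inner_productD(2)[OF a v(1) w w]
      by (simp add: semi_inner_productD(1)[OF a w v(1) m] semi_inner_product_left[OF V a w v(1)]
          w v(1) algebra_simps)
    finally show ?thesis .
  qed
  show ?thesis
  proof (rule ccontr)
    assume n: "a v w \<noteq> 0"
    have "0 \<le> a w w + 2 * (- (a w w + 1) / (2 * a v w)) * a v w" by (rule *)
    then show False using n by (simp add: field_simps)
  qed
qed

text \<open>Finite-dimensionality is encoded by finitely many coordinates \<open>c j\<close> whose vanishing forces
  \<open>a v v = 0\<close>. The induction removes one coordinate \<open>c j\<close>. Its kernel has codimension at most one, and
  by the induction hypothesis a vector off the kernel can be made orthogonal to it; the functional is
  then represented on the kernel and on that vector separately.\<close>

lemma riesz_representation_finite:
  assumes "finite J" and "fun_subspace V" and "semi_inner_product V a"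
    and "\<And>j. j \<in> J \<Longrightarrow> linear_form V (c j)"
    and "\<And>v. v \<in> V \<Longrightarrow> (\<And>j. j \<in> J \<Longrightarrow> c j v = 0) \<Longrightarrow> a v v = 0"
    and "linear_form V l"
    and "\<And>v. v \<in> V \<Longrightarrow> a v v = 0 \<Longrightarrow> l v = 0"
  shows "\<exists>u\<in>V. \<forall>v\<in>V. a u v = l v"
  using assms
proof (induction J arbitrary: V l rule: finite_induct)
  case empty
  obtain u where u: "u \<in> V" using empty.prems(1) by (auto simp: fun_subspace_def)
  have "a u v = l v" if "v \<in> V" for v
    using semi_inner_product_null[OF empty.prems(1,2) u _ that] empty.prems(4,6) u that by auto
  then show ?case using u by blast
next
  case (insert j J)
  note V = insert.prems(1) and a = insert.prems(2) and c = insert.prems(3) and l = insert.prems(5)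
  define V0 where "V0 = {v \<in> V. c j v = 0}"
  have V0: "fun_subspace V0" unfolding V0_def by (rule fun_subspace_kernel[OF V c]) simp
  have V0V: "V0 \<subseteq> V" by (auto simp: V0_def)
  have IH: "\<exists>u\<in>V0. \<forall>v\<in>V0. a u v = l' v"
    if "linear_form V0 l'" "\<And>v. v \<in> V0 \<Longrightarrow> a v v = 0 \<Longrightarrow> l' v = 0" for l'
  proof (rule insert.IH[OF V0 semi_inner_product_subset[OF a V0V]])
    show "a v v = 0" if "v \<in> V0" "\<And>i. i \<in> J \<Longrightarrow> c i v = 0" for v
      using that insert.prems(4)[of v] by (auto simp: V0_def)
  qed (use that c V0V in \<open>auto intro: linear_form_subset\<close>)
  show ?case
  proof (cases "V0 = V")
    case True
    then show ?thesis using IH[of l] insert.prems(5,6) by auto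
  next
    case False
    then obtain y where y: "y \<in> V" "c j y \<noteq> 0" using V0V by (auto simp: V0_def)
    have lin_a: "linear_form V0 (a y)"
      using a y(1) V0V by (auto simp: semi_inner_product_def intro: linear_form_subset)
    obtain y0 where y0: "y0 \<in> V0" "\<And>v. v \<in> V0 \<Longrightarrow> a y0 v = a y v"
      using IH[OF lin_a] semi_inner_product_null[OF V a _ _ y(1)] semi_inner_productD(2)[OF a] y(1) V0V
      by (metis subsetD)
    define w where "w = lin_comb 1 y (-1) y0"
    have y0V: "y0 \<in> V" using y0(1) V0V by blast
    have w: "w \<in> V" unfolding w_def by (rule fun_subspaceD[OF V y(1) y0V])
    have cw: "c j w = c j y"
      using y0(1) linear_formD[OF c y(1) y0V] by (simp add: w_def V0_def)
    have orth: "a w v = 0" if "v \<in> V0" for v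
      using semi_inner_product_left[OF V a y(1) y0V] that V0V y0(2)[OF that] by (auto simp: w_def)
    obtain z where z: "z \<in> V0" "\<And>v. v \<in> V0 \<Longrightarrow> a z v = l v"
      using IH[of l] linear_form_subset[OF l V0V] insert.prems(6) V0V by blast
    have zV: "z \<in> V" using z(1) V0V by blast
    define t where "t = l w / a w w"
    have tw: "t * a w w = l w" using insert.prems(6)[OF w] by (auto simp: t_def)
    have "a (lin_comb 1 z t w) v = l v" if v: "v \<in> V" for v
    proof -
      define s where "s = c j v / c j w"
      define v0 where "v0 = lin_comb 1 v (- s) w"
      have v0: "v0 \<in> V0"
        using fun_subspaceD[OF V v w] linear_formD[OF c v w] y(2) cw
        by (simp add: v0_def V0_def s_def)
      have "a z w = 0" using orth[OF z(1)] semi_inner_productD(2)[OF a w zV w] by simp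
      have "a z v0 = a z v"
        using semi_inner_productD(1)[OF a v w zV] \<open>a z w = 0\<close> by (simp add: v0_def)
      moreover have "l v0 = l v - s * l w"
        using linear_formD[OF l v w] by (simp add: v0_def)
      moreover have "a w v = s * a w w"
        using orth[OF v0] semi_inner_productD(1)[OF a v w w] by (simp add: v0_def)
      ultimately have "a z v + t * a w v = l v"
        using z(2)[OF v0] tw by (simp add: algebra_simps)
      then show ?thesis using semi_inner_product_left[OF V a zV w v] by simp
    qed
    then show ?thesis using fun_subspaceD[OF V zV w] by blast
  qed
qed

text \<open>This is where the multiplier of an equality constraint comes from.\<close>

lemma linear_form_vanishing_on_kernel:
  assumes V: "fun_subspace V" and g: "linear_form V g" and r: "linear_form V r"
    and 0: "\<And>v. v \<in> V \<Longrightarrow> g v = 0 \<Longrightarrow> r v = 0"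
  shows "\<exists>\<nu>. \<forall>v\<in>V. r v = \<nu> * g v"
proof (cases "\<exists>y\<in>V. g y \<noteq> 0")
  case True
  then obtain y where y: "y \<in> V" "g y \<noteq> 0" by blast
  have "r v = r y / g y * g v" if v: "v \<in> V" for v
    using 0[OF fun_subspaceD[OF V v y(1)], of 1 "- (g v / g y)"] y(2)
      linear_formD[OF g v y(1)] linear_formD[OF r v y(1)] by (simp add: field_simps)
  then show ?thesis by blast
qed (use 0 in auto)

lemma linear_form_sum:
  assumes "\<And>i. i \<in> I \<Longrightarrow> linear_form V (n i)"
  shows "linear_form V (\<lambda>v. \<Sum>i\<in>I. \<mu> i * n i v)"
  using assms by (simp add: linear_form_def sum.distrib sum_distrib_left algebra_simps)

text \<open>Induction on the constraints. Let \<open>u'\<close> solve the problem without constraint \<open>m\<close>. If \<open>u'\<close>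
  satisfies constraint \<open>m\<close>, its multiplier is zero. Otherwise a point \<open>z\<close> of the segment from \<open>u'\<close> to
  a feasible point satisfies it with equality, and the problem shifted by \<open>z\<close> is solved on the
  kernel of \<open>n m\<close>. The gradient at the solution \<open>u\<close> vanishes on that kernel up to the other
  multipliers, hence constraint \<open>m\<close> has a multiplier \<open>\<nu>\<close>, a priori of either sign. Testing both
  stationarity equations with \<open>u - u'\<close> gives \<open>\<nu> * n m (u - u') \<ge> a (u - u') (u - u') \<ge> 0\<close> because
  the remaining constraints contribute with the opposite sign, and \<open>n m (u - u') > 0\<close>.\<close>

lemma kkt_inequalities:
  assumes "finite I" and "finite J" and "fun_subspace V" and "semi_inner_product V a"
    and "\<And>j. j \<in> J \<Longrightarrow> linear_form V (c j)"
    and "\<And>v. v \<in> V \<Longrightarrow> (\<And>j. j \<in> J \<Longrightarrow> c j v = 0) \<Longrightarrow> a v v = 0"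
    and "linear_form V l"
    and "\<And>v. v \<in> V \<Longrightarrow> a v v = 0 \<Longrightarrow> l v = 0"
    and "\<And>i. i \<in> I \<Longrightarrow> linear_form V (n i)"
    and "\<exists>v\<in>V. \<forall>i\<in>I. b i \<le> n i v"
  shows "\<exists>u\<in>V. \<exists>\<mu>. (\<forall>v\<in>V. a u v - l v = (\<Sum>i\<in>I. \<mu> i * n i v)) \<and>
           (\<forall>i\<in>I. b i \<le> n i u \<and> 0 \<le> \<mu> i \<and> \<mu> i * (n i u - b i) = (0::real))"
  using assms
proof (induction I arbitrary: V l b rule: finite_induct)
  case empty
  obtain u where "u \<in> V" "\<And>v. v \<in> V \<Longrightarrow> a u v = l v"
    using riesz_representation_finite[where J = J and V = V and a = a and c = c and l = l] empty.prems(1-7)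
    by blast
  then show ?case by auto
next
  case (insert m I)
  note J = insert.prems(1) and V = insert.prems(2) and a = insert.prems(3) and c = insert.prems(4)
    and fin = insert.prems(5) and l = insert.prems(6) and null = insert.prems(7)
    and n = insert.prems(8)
  obtain y where y: "y \<in> V" "\<And>i. i \<in> insert m I \<Longrightarrow> b i \<le> n i y" using insert.prems(9) by blast
  obtain u' \<mu>' where u': "u' \<in> V" "\<And>v. v \<in> V \<Longrightarrow> a u' v - l v = (\<Sum>i\<in>I. \<mu>' i * n i v)"
      "\<And>i. i \<in> I \<Longrightarrow> b i \<le> n i u'" "\<And>i. i \<in> I \<Longrightarrow> 0 \<le> \<mu>' i"
      "\<And>i. i \<in> I \<Longrightarrow> \<mu>' i * (n i u' - b i) = 0"
    using insert.IH[OF J V a c fin l null n, of b] y by blast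
  show ?case
  proof (cases "b m \<le> n m u'")
    case True
    have eq: "(\<Sum>i\<in>insert m I. (\<mu>'(m := 0)) i * n i v) = (\<Sum>i\<in>I. \<mu>' i * n i v)" for v
    proof -
      have "(\<Sum>i\<in>I. (\<mu>'(m := 0)) i * n i v) = (\<Sum>i\<in>I. \<mu>' i * n i v)"
        using insert.hyps(2) by (intro sum.cong) auto
      then show ?thesis using insert.hyps by simp
    qed
    show ?thesis
    proof (intro bexI[of _ u'] exI[of _ "\<mu>'(m := 0)"] conjI ballI u'(1))
      show "a u' v - l v = (\<Sum>i\<in>insert m I. (\<mu>'(m := 0)) i * n i v)" if "v \<in> V" for v
        unfolding eq by (rule u'(2)[OF that])
    qed (use u' True in auto)
  next
    case False
    \<comment> \<open>the parameter at which the segment from \<open>u'\<close> to \<open>y\<close> meets the hyperplane \<open>n m = b m\<close>\<close>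
    define t where "t = (b m - n m u') / (n m y - n m u')"
    have t: "0 \<le> t" "t \<le> 1" "t * (n m y - n m u') = b m - n m u'"
      using False y(2)[of m] by (auto simp: t_def field_simps)
    define z where "z = lin_comb (1 - t) u' t y"
    have z: "z \<in> V" unfolding z_def by (rule fun_subspaceD[OF V u'(1) y(1)])
    have nz: "n i z = (1 - t) * n i u' + t * n i y" if "i \<in> insert m I" for i
      unfolding z_def by (rule linear_formD[OF n[OF that] u'(1) y(1)])
    have zm: "n m z = b m" using nz[of m] t(3) by (simp add: algebra_simps)
    have zi: "b i \<le> n i z" if i: "i \<in> I" for i
    proof -
      have "(1 - t) * b i + t * b i \<le> (1 - t) * n i u' + t * n i y"
        using t u'(3)[OF i] y(2)[of i] i by (intro add_mono mult_left_mono) auto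
      then show ?thesis using nz[of i] i by (simp add: algebra_simps)
    qed
    define V0 where "V0 = {v \<in> V. n m v = 0}"
    have V0: "fun_subspace V0" unfolding V0_def by (rule fun_subspace_kernel[OF V n]) simp
    have V0V: "V0 \<subseteq> V" by (auto simp: V0_def)
    have lin0: "linear_form V (\<lambda>v. l v - a z v)"
      using l semi_inner_productD(1)[OF a _ _ z] by (auto simp: linear_form_def algebra_simps)
    have null0: "l v - a z v = 0" if v: "v \<in> V" "a v v = 0" for v
      using null[OF v] semi_inner_product_null[OF V a v z] semi_inner_productD(2)[OF a v(1) z z] by simp
    have zero: "lin_comb 0 u' 0 u' \<in> V0"
      using fun_subspaceD[OF V u'(1) u'(1)] linear_formD[OF n u'(1) u'(1)] by (simp add: V0_def)
    have n0: "n i (lin_comb 0 u' 0 u') = 0" if "i \<in> insert m I" for i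
      using linear_formD[OF n[OF that] u'(1) u'(1)] by simp
    obtain v0 \<mu> where v0: "v0 \<in> V0"
        "\<And>v. v \<in> V0 \<Longrightarrow> a v0 v - (l v - a z v) = (\<Sum>i\<in>I. \<mu> i * n i v)"
        "\<And>i. i \<in> I \<Longrightarrow> b i - n i z \<le> n i v0" "\<And>i. i \<in> I \<Longrightarrow> 0 \<le> \<mu> i"
        "\<And>i. i \<in> I \<Longrightarrow> \<mu> i * (n i v0 - (b i - n i z)) = 0"
    proof -
      have "\<exists>u\<in>V0. \<exists>\<mu>. (\<forall>v\<in>V0. a u v - (l v - a z v) = (\<Sum>i\<in>I. \<mu> i * n i v)) \<and>
           (\<forall>i\<in>I. b i - n i z \<le> n i u \<and> 0 \<le> \<mu> i \<and> \<mu> i * (n i u - (b i - n i z)) = 0)"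
      proof (rule insert.IH[OF J V0 semi_inner_product_subset[OF a V0V]])
        show "\<exists>v\<in>V0. \<forall>i\<in>I. b i - n i z \<le> n i v"
          using zero n0 zi by (intro bexI[of _ "lin_comb 0 u' 0 u'"]) auto
      qed (use c fin n V0V lin0 null0 in \<open>auto intro: linear_form_subset\<close>)
      then show ?thesis using that by blast
    qed
    have v0V: "v0 \<in> V" using v0(1) V0V by blast
    define u where "u = lin_comb 1 z 1 v0"
    have u: "u \<in> V" unfolding u_def by (rule fun_subspaceD[OF V z v0V])
    have nu: "n i u = n i z + n i v0" if "i \<in> insert m I" for i
      using linear_formD[OF n[OF that] z v0V, of 1 1] by (simp add: u_def)
    have au: "a u v = a z v + a v0 v" if "v \<in> V" for v
      using semi_inner_product_left[OF V a z v0V that, of 1 1] by (simp add: u_def)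
    have um: "n m u = b m" using nu[of m] v0(1) zm by (simp add: V0_def)
    have lin_r: "linear_form V (\<lambda>v. a u v - l v - (\<Sum>i\<in>I. \<mu> i * n i v))"
      using linear_form_sum[of I V n \<mu>] n l semi_inner_productD(1)[OF a _ _ u]
      by (auto simp: linear_form_def algebra_simps)
    obtain \<nu> where \<nu>: "\<And>v. v \<in> V \<Longrightarrow> a u v - l v - (\<Sum>i\<in>I. \<mu> i * n i v) = \<nu> * n m v"
    proof -
      have "a u v - l v - (\<Sum>i\<in>I. \<mu> i * n i v) = 0" if "v \<in> V" "n m v = 0" for v
        using v0(2)[of v] au[of v] that by (simp add: V0_def)
      then show ?thesis
        using linear_form_vanishing_on_kernel[OF V n[of m] lin_r] that by blast
    qed
    define d where "d = lin_comb 1 u (-1) u'"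
    have d: "d \<in> V" unfolding d_def by (rule fun_subspaceD[OF V u u'(1)])
    have nd: "n i d = n i u - n i u'" if "i \<in> insert m I" for i
      using linear_formD[OF n[OF that] u u'(1), of 1 "-1"] by (simp add: d_def)
    have "a d d = a u d - a u' d"
      using semi_inner_product_left[OF V a u u'(1) d, of 1 "-1"] by (simp add: d_def)
    also have "\<dots> = \<nu> * n m d + (\<Sum>i\<in>I. (\<mu> i - \<mu>' i) * n i d)"
      using \<nu>[OF d] u'(2)[OF d] by (simp add: sum_subtractf algebra_simps)
    finally have add: "a d d = \<nu> * n m d + (\<Sum>i\<in>I. (\<mu> i - \<mu>' i) * n i d)" .
    have "(\<Sum>i\<in>I. (\<mu> i - \<mu>' i) * n i d) \<le> 0"
    proof (rule sum_nonpos)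
      fix i assume i: "i \<in> I"
      have s: "\<mu> i * (n i u - b i) = 0" using v0(5)[OF i] nu[of i] i by (simp add: algebra_simps)
      have "(\<mu> i - \<mu>' i) * n i d = \<mu> i * (n i u - b i) + \<mu>' i * (n i u' - b i)
              - \<mu> i * (n i u' - b i) - \<mu>' i * (n i u - b i)"
        unfolding nd[OF insertI2[OF i]] by (simp add: algebra_simps)
      also have "\<dots> \<le> 0"
        using s u'(3,4,5)[OF i] v0(3,4)[OF i] nu[of i] i by auto
      finally show "(\<mu> i - \<mu>' i) * n i d \<le> 0" .
    qed
    then have "0 \<le> \<nu> * n m d" using add semi_inner_productD(3)[OF a d d d] by simp
    moreover have "0 < n m d" using nd[of m] um False by simp
    ultimately have \<nu>0: "0 \<le> \<nu>" by (simp add: zero_le_mult_iff)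
    have eq: "(\<Sum>i\<in>insert m I. (\<mu>(m := \<nu>)) i * n i v) = \<nu> * n m v + (\<Sum>i\<in>I. \<mu> i * n i v)" for v
    proof -
      have "(\<Sum>i\<in>I. (\<mu>(m := \<nu>)) i * n i v) = (\<Sum>i\<in>I. \<mu> i * n i v)"
        using insert.hyps(2) by (intro sum.cong) auto
      then show ?thesis using insert.hyps by simp
    qed
    show ?thesis
    proof (intro bexI[of _ u] exI[of _ "\<mu>(m := \<nu>)"] conjI ballI u)
      show "a u v - l v = (\<Sum>i\<in>insert m I. (\<mu>(m := \<nu>)) i * n i v)" if "v \<in> V" for v
        unfolding eq using \<nu>[OF that] by simp
      fix i assume i: "i \<in> insert m I"
      show "b i \<le> n i u" using i um v0(3)[of i] nu[of i] by auto
      show "0 \<le> (\<mu>(m := \<nu>)) i" using i v0(4) \<nu>0 by auto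
      show "(\<mu>(m := \<nu>)) i * (n i u - b i) = 0"
      proof (cases "i = m")
        case False
        then show ?thesis using i v0(5)[of i] nu[of i] by (simp add: algebra_simps)
      qed (simp add: um)
    qed
  qed
qed

text \<open>An equation is a pair of opposite inequalities, and its multiplier is the difference of
  theirs, whereas the two sides of a bound keep separate multipliers. The index \<open>(s, k)\<close> below stands for the
  constraint \<open>k\<close> taken with sign \<open>s\<close>.\<close>

lemma kkt_mixed:
  fixes V :: "('x \<Rightarrow> 'b::real_vector) set"
    and e :: "'i \<Rightarrow> ('x \<Rightarrow> 'b) \<Rightarrow> real" and n :: "'k \<Rightarrow> ('x \<Rightarrow> 'b) \<Rightarrow> real"
  assumes E: "finite E" and I: "finite I" and J: "finite J"
    and V: "fun_subspace V" and a: "semi_inner_product V a"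
    and c: "\<And>j. j \<in> J \<Longrightarrow> linear_form V (c j)"
    and fin: "\<And>v. v \<in> V \<Longrightarrow> (\<And>j. j \<in> J \<Longrightarrow> c j v = 0) \<Longrightarrow> a v v = 0"
    and l: "linear_form V l" and null: "\<And>v. v \<in> V \<Longrightarrow> a v v = 0 \<Longrightarrow> l v = 0"
    and e: "\<And>i. i \<in> E \<Longrightarrow> linear_form V (e i)"
    and n: "\<And>i. i \<in> I \<Longrightarrow> linear_form V (n i)"
    and y: "y \<in> V" "\<And>i. i \<in> E \<Longrightarrow> e i y = g i" "\<And>i. i \<in> I \<Longrightarrow> lo i \<le> n i y \<and> n i y \<le> hi i"
  obtains u p \<mu> \<nu> where "u \<in> V"
    "\<forall>v\<in>V. a u v - l v = (\<Sum>i\<in>E. p i * e i v) + (\<Sum>i\<in>I. (\<mu> i - \<nu> i) * n i v)"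
    "\<forall>i\<in>E. e i u = g i"
    "\<forall>i\<in>I. lo i \<le> n i u \<and> n i u \<le> hi i"
    "\<forall>i\<in>I. 0 \<le> \<mu> i \<and> \<mu> i * (n i u - lo i) = 0"
    "\<forall>i\<in>I. 0 \<le> \<nu> i \<and> \<nu> i * (hi i - n i u) = (0::real)"
proof -
  define N :: "bool \<times> ('i + 'k) \<Rightarrow> ('x \<Rightarrow> 'b) \<Rightarrow> real" where
    "N = (\<lambda>(s, k) v. (if s then 1 else -1) * (case k of Inl i \<Rightarrow> e i v | Inr i \<Rightarrow> n i v))"
  define b :: "bool \<times> ('i + 'k) \<Rightarrow> real" where
    "b = (\<lambda>(s, k). case k of Inl i \<Rightarrow> (if s then g i else - g i) | Inr i \<Rightarrow> (if s then lo i else - hi i))"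
  define Q where "Q = (UNIV :: bool set) \<times> (E <+> I)"
  have "\<exists>u\<in>V. \<exists>\<mu>. (\<forall>v\<in>V. a u v - l v = (\<Sum>i\<in>Q. \<mu> i * N i v)) \<and>
           (\<forall>i\<in>Q. b i \<le> N i u \<and> 0 \<le> \<mu> i \<and> \<mu> i * (N i u - b i) = (0::real))"
  proof (rule kkt_inequalities[OF _ J V a c fin l null])
    show "finite Q" using E I by (simp add: Q_def)
    show "linear_form V (N i)" if "i \<in> Q" for i
      using that e n by (auto simp: Q_def N_def linear_form_def algebra_simps)
    show "\<exists>v\<in>V. \<forall>i\<in>Q. b i \<le> N i v"
      using y by (intro bexI[of _ y]) (auto simp: Q_def N_def b_def)
  qed auto
  then obtain u \<mu> where u: "u \<in> V" "\<And>v. v \<in> V \<Longrightarrow> a u v - l v = (\<Sum>i\<in>Q. \<mu> i * N i v)"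
     "\<And>i. i \<in> Q \<Longrightarrow> b i \<le> N i u" "\<And>i. i \<in> Q \<Longrightarrow> 0 \<le> \<mu> i" "\<And>i. i \<in> Q \<Longrightarrow> \<mu> i * (N i u - b i) = 0"
    by blast
  have split: "(\<Sum>i\<in>Q. \<mu> i * N i v) =
      (\<Sum>i\<in>E. (\<mu> (True, Inl i) - \<mu> (False, Inl i)) * e i v)
      + (\<Sum>i\<in>I. (\<mu> (True, Inr i) - \<mu> (False, Inr i)) * n i v)" for v
  proof -
    have "(\<Sum>i\<in>Q. \<mu> i * N i v) = (\<Sum>s\<in>UNIV. \<Sum>k\<in>E <+> I. \<mu> (s, k) * N (s, k) v)"
      unfolding Q_def by (simp add: sum.cartesian_product)
    then show ?thesis
      using E I by (simp add: UNIV_bool sum.Plus N_def sum_subtractf algebra_simps sum.distrib sum_negf)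
  qed
  show ?thesis
  proof (rule that[of u "\<lambda>i. \<mu> (True, Inl i) - \<mu> (False, Inl i)" "\<lambda>i. \<mu> (True, Inr i)" "\<lambda>i. \<mu> (False, Inr i)"];
      (intro ballI)?)
    show "a u v - l v = (\<Sum>i\<in>E. (\<mu> (True, Inl i) - \<mu> (False, Inl i)) * e i v)
      + (\<Sum>i\<in>I. (\<mu> (True, Inr i) - \<mu> (False, Inr i)) * n i v)" if "v \<in> V" for v
      using u(2)[OF that] split by simp
    show "e i u = g i" if "i \<in> E" for i
      using u(3)[of "(True, Inl i)"] u(3)[of "(False, Inl i)"] that by (simp add: Q_def N_def b_def InlI InrI)
    show "lo i \<le> n i u \<and> n i u \<le> hi i" if "i \<in> I" for i
      using u(3)[of "(True, Inr i)"] u(3)[of "(False, Inr i)"] that by (simp add: Q_def N_def b_def InlI InrI)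
    show "0 \<le> \<mu> (True, Inr i) \<and> \<mu> (True, Inr i) * (n i u - lo i) = 0" if "i \<in> I" for i
      using u(4,5)[of "(True, Inr i)"] that by (simp add: Q_def N_def b_def InlI InrI)
    show "0 \<le> \<mu> (False, Inr i) \<and> \<mu> (False, Inr i) * (hi i - n i u) = 0" if "i \<in> I" for i
      using u(4,5)[of "(False, Inr i)"] that by (simp add: Q_def N_def b_def InlI InrI algebra_simps)
  qed (rule u(1))
qed

text \<open>The energy difference of \<open>w\<close> and \<open>u\<close> is \<open>a d d / 2\<close> plus the gradient at \<open>u\<close> tested with
  \<open>d = w - u\<close>. Both points satisfy the equations, so the equality multipliers drop out, and by
  complementarity the others contribute a nonnegative amount.\<close>

lemma kkt_sufficient:
  assumes V: "fun_subspace V" and a: "semi_inner_product V a" and l: "linear_form V l"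
    and e: "\<And>i. i \<in> E \<Longrightarrow> linear_form V (e i)" and n: "\<And>i. i \<in> I \<Longrightarrow> linear_form V (n i)"
    and u: "u \<in> V" "\<And>i. i \<in> E \<Longrightarrow> e i u = g i"
    and grad: "\<And>v. v \<in> V \<Longrightarrow> a u v - l v = (\<Sum>i\<in>E. p i * e i v) + (\<Sum>i\<in>I. (\<mu> i - \<nu> i) * n i v)"
    and \<mu>: "\<And>i. i \<in> I \<Longrightarrow> 0 \<le> \<mu> i \<and> \<mu> i * (n i u - lo i) = 0"
    and \<nu>: "\<And>i. i \<in> I \<Longrightarrow> 0 \<le> \<nu> i \<and> \<nu> i * (hi i - n i u) = (0::real)"
    and w: "w \<in> V" "\<And>i. i \<in> E \<Longrightarrow> e i w = g i" "\<And>i. i \<in> I \<Longrightarrow> lo i \<le> n i w \<and> n i w \<le> hi i"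
  shows "a u u / 2 - l u + a (lin_comb 1 w (-1) u) (lin_comb 1 w (-1) u) / 2 \<le> a w w / 2 - l w"
proof -
  define d where "d = lin_comb 1 w (-1) u"
  have d: "d \<in> V" unfolding d_def by (rule fun_subspaceD[OF V w(1) u(1)])
  have lin_d: "m d = m w - m u" if "linear_form V m" for m
    using linear_formD[OF that w(1) u(1), of 1 "-1"] by (simp add: d_def)
  have au: "linear_form V (a x)" if "x \<in> V" for x using a that by (simp add: semi_inner_product_def)
  have "a d d = a d w - a d u" by (rule lin_d[OF au[OF d]])
  also have "\<dots> = (a w w - a w u) - (a u w - a u u)"
    using lin_d[OF au[OF w(1)]] lin_d[OF au[OF u(1)]] semi_inner_productD(2)[OF a d w(1) d]
      semi_inner_productD(2)[OF a d u(1) d] by simp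
  finally have add: "a d d = a w w - 2 * a u w + a u u"
    using semi_inner_productD(2)[OF a w(1) u(1) d] by simp
  have "0 \<le> (\<mu> i - \<nu> i) * n i d" if i: "i \<in> I" for i
  proof -
    have "(\<mu> i - \<nu> i) * n i d = \<mu> i * (n i w - lo i) - \<mu> i * (n i u - lo i)
        + \<nu> i * (hi i - n i w) - \<nu> i * (hi i - n i u)"
      unfolding lin_d[OF n[OF i]] by (simp add: algebra_simps)
    then show ?thesis using \<mu>[OF i] \<nu>[OF i] w(3)[OF i] by simp
  qed
  then have "0 \<le> (\<Sum>i\<in>I. (\<mu> i - \<nu> i) * n i d)" by (rule sum_nonneg)
  moreover have "(\<Sum>i\<in>E. p i * e i d) = 0"
    using lin_d[OF e] u(2) w(2) by (intro sum.neutral) auto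
  ultimately have "0 \<le> a u d - l d" using grad[OF d] by simp
  then have "0 \<le> (a u w - a u u) - (l w - l u)" unfolding lin_d[OF au[OF u(1)]] lin_d[OF l] .
  then show ?thesis using add unfolding d_def[symmetric] by linarith
qed

section \<open>Symmetric positive definite matrices\<close>

lemma symmetric_matrix_inner:
  fixes A :: "real^'n^'n"
  assumes "transpose A = A"
  shows "x \<bullet> (A *v y) = (A *v x) \<bullet> y"
  using assms dot_lmul_matrix[of x A y] transpose_matrix_vector[of A x] by simp

lemma symmetric_matrixI:
  fixes A :: "real^'n^'n"
  assumes "\<And>x y. x \<bullet> (A *v y) = (A *v x) \<bullet> y"
  shows "transpose A = A"
proof -
  have "transpose A *v x = A *v x" for x
  proof -
    have "(transpose A *v x) \<bullet> y = (A *v x) \<bullet> y" for y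
      using assms[of x y] dot_lmul_matrix[of x A y] transpose_matrix_vector[of A x] by simp
    then show ?thesis using vector_eq_rdot[of "transpose A *v x" "A *v x"] by blast
  qed
  then show ?thesis by (simp add: matrix_eq)
qed

lemma positive_definite_imp_invertible:
  fixes A :: "real^'n^'n"
  assumes m: "0 < m" and A: "\<And>\<xi>. m * (norm \<xi>)\<^sup>2 \<le> \<xi> \<bullet> (A *v \<xi>)"
  shows "A ** matrix_inv A = mat 1" "matrix_inv A ** A = mat 1"
proof -
  have "\<xi> = 0" if "A *v \<xi> = 0" for \<xi>
    using A[of \<xi>] that m by (simp add: mult_le_0_iff)
  then have "\<exists>B. B ** A = mat 1" using matrix_left_invertible_ker by blast
  then have "invertible A" using invertible_left_inverse by blast
  then have "A ** matrix_inv A = mat 1 \<and> matrix_inv A ** A = mat 1"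
    unfolding invertible_def matrix_inv_def by (rule someI_ex)
  then show "A ** matrix_inv A = mat 1" "matrix_inv A ** A = mat 1" by auto
qed

text \<open>With \<open>\<eta> = A\<^sup>-\<^sup>1 \<xi>\<close> the quadratic form of the inverse at \<open>\<xi>\<close> is that of \<open>A\<close> at \<open>\<eta>\<close>, and
  \<open>|\<xi>| \<le> \<parallel>A\<parallel> |\<eta>|\<close>.\<close>

lemma inverse_symmetric_positive_definite:
  fixes A :: "real^'n^'n"
  assumes m: "0 < m" and A: "\<And>\<xi>. m * (norm \<xi>)\<^sup>2 \<le> \<xi> \<bullet> (A *v \<xi>)" and sym: "transpose A = A"
  shows "transpose (matrix_inv A) = matrix_inv A"
    and "\<exists>m'>0. \<forall>\<xi>. m' * (norm \<xi>)\<^sup>2 \<le> \<xi> \<bullet> (matrix_inv A *v \<xi>)"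
proof -
  note inv = positive_definite_imp_invertible[OF m A]
  have Ainv: "A *v (matrix_inv A *v x) = x" for x
    by (simp add: matrix_vector_mul_assoc inv)
  show "transpose (matrix_inv A) = matrix_inv A"
  proof (rule symmetric_matrixI)
    fix x y
    show "x \<bullet> (matrix_inv A *v y) = (matrix_inv A *v x) \<bullet> y"
      using symmetric_matrix_inner[OF sym, of "matrix_inv A *v x" "matrix_inv A *v y"]
      by (simp add: Ainv)
  qed
  obtain k where k: "\<And>x. norm (A *v x) \<le> norm x * k" "0 < k"
    using bounded_linear.pos_bounded[OF matrix_vector_mul_bounded_linear[of A]] by blast
  have "m / k\<^sup>2 * (norm \<xi>)\<^sup>2 \<le> \<xi> \<bullet> (matrix_inv A *v \<xi>)" for \<xi>
  proof -
    define \<eta> where "\<eta> = matrix_inv A *v \<xi>"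
    have "norm \<xi> \<le> norm \<eta> * k" using k(1)[of \<eta>] by (simp add: \<eta>_def Ainv)
    then have "(norm \<xi>)\<^sup>2 \<le> (norm \<eta> * k)\<^sup>2" by (intro power_mono) auto
    then have "m / k\<^sup>2 * (norm \<xi>)\<^sup>2 \<le> m / k\<^sup>2 * (norm \<eta> * k)\<^sup>2"
      using m by (intro mult_left_mono) auto
    also have "\<dots> = m * (norm \<eta>)\<^sup>2" using k(2) by (simp add: power_mult_distrib)
    also have "\<dots> \<le> \<eta> \<bullet> (A *v \<eta>)" by (rule A)
    also have "\<dots> = \<xi> \<bullet> \<eta>" by (simp add: \<eta>_def Ainv inner_commute)
    finally show ?thesis by (simp add: \<eta>_def)
  qed
  then show "\<exists>m'>0. \<forall>\<xi>. m' * (norm \<xi>)\<^sup>2 \<le> \<xi> \<bullet> (matrix_inv A *v \<xi>)"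
    using m k(2) by (intro exI[of _ "m / k\<^sup>2"]) auto
qed

text \<open>Polarisation between \<open>x\<close> and the multiple \<open>y\<close> of \<open>f x\<close> that is as long as \<open>x\<close>: dropping the
  nonnegative term at \<open>x - y\<close> leaves a bound for \<open>x \<bullet> f y = |f x| |x|\<close>.\<close>

lemma psd_bounded_operator_norm:
  fixes f :: "'a::real_inner \<Rightarrow> 'a"
  assumes f: "bounded_linear f" and sym: "\<And>x y. x \<bullet> f y = f x \<bullet> y"
    and psd: "\<And>x. 0 \<le> x \<bullet> f x" and q: "\<And>x. x \<bullet> f x \<le> q * (norm x)\<^sup>2" "0 \<le> q"
  shows "norm (f x) \<le> q * norm x"
proof (cases "f x = 0")
  case False
  then have x: "x \<noteq> 0" using linear_0[OF bounded_linear.linear[OF f]] by auto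
  define t where "t = norm (f x) / norm x"
  have t: "0 < t" using x False by (simp add: t_def)
  define y where "y = (1 / t) *\<^sub>R f x"
  have ny: "norm y = norm x" using x False by (simp add: y_def t_def)
  have lin: "f (x + y) = f x + f y" "f (x - y) = f x - f y"
    by (simp_all add: linear_add linear_diff bounded_linear.linear[OF f])
  have "4 * (x \<bullet> f y) = (x + y) \<bullet> f (x + y) - (x - y) \<bullet> f (x - y)"
    unfolding lin using sym[of x y] by (simp add: inner_add_left inner_add_right inner_diff_left inner_diff_right inner_commute)
  also have "\<dots> \<le> q * (norm (x + y))\<^sup>2" using psd[of "x - y"] q(1)[of "x + y"] by linarith
  also have "\<dots> \<le> q * (norm x + norm y)\<^sup>2"
    using q(2) by (intro mult_left_mono power_mono norm_triangle_ineq) auto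
  finally have "x \<bullet> f y \<le> q * (norm x)\<^sup>2" unfolding ny by (simp add: power2_eq_square)
  moreover have "x \<bullet> f y = norm (f x) * norm x"
    using x False sym[of x y] by (simp add: y_def t_def dot_square_norm power2_eq_square)
  ultimately show ?thesis using x by (simp add: power2_eq_square)
qed (use q in auto)

text \<open>Scaling turns \<open>A\<close> into \<open>s (1 - E)\<close> with \<open>\<parallel>E\<parallel> \<le> q < 1\<close>. The map
  \<open>Y \<mapsto> (E + Y\<^sup>2) / 2\<close> is a contraction of the symmetric operators of norm at most \<open>q\<close>, and a fixed
  point \<open>Y\<close> satisfies \<open>(1 - Y)\<^sup>2 = 1 - E\<close>. The norm bound makes \<open>1 - Y\<close> positive.\<close>

lemma positive_definite_sqrt_exists:
  fixes A :: "real^'n^'n"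
  assumes m: "0 < m" and A: "\<And>\<xi>. m * (norm \<xi>)\<^sup>2 \<le> \<xi> \<bullet> (A *v \<xi>)" and sym: "transpose A = A"
  shows "\<exists>B. transpose B = B \<and> (\<forall>\<xi>. 0 \<le> \<xi> \<bullet> (B *v \<xi>)) \<and> B ** B = A"
proof -
  obtain k where k: "\<And>x. norm (A *v x) \<le> norm x * k" "0 < k"
    using bounded_linear.pos_bounded[OF matrix_vector_mul_bounded_linear[of A]] by blast
  \<comment> \<open>any scale above the norm of \<open>A\<close> works; adding \<open>m\<close> keeps \<open>q\<close> nonnegative\<close>
  define s where "s = k + m"
  have s: "0 < s" "m < s" "k < s" using k(2) m by (auto simp: s_def)
  define q where "q = 1 - m / s"
  have q: "0 \<le> q" "q < 1" using s m by (auto simp: q_def field_simps)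
  define e where "e = (\<lambda>x. x - (1 / s) *\<^sub>R (A *v x))"
  have e_bl: "bounded_linear e" unfolding e_def
    by (intro bounded_linear_sub bounded_linear_ident
        bounded_linear_compose[OF bounded_linear_scaleR_right] matrix_vector_mul_bounded_linear)
  have e_sym: "x \<bullet> e y = e x \<bullet> y" for x y
    using symmetric_matrix_inner[OF sym, of x y]
    by (simp add: e_def inner_diff_left inner_diff_right)
  have e_norm: "norm (e x) \<le> q * norm x" for x
  proof (rule psd_bounded_operator_norm[OF e_bl e_sym _ _ q(1)])
    fix x :: "real^'n"
    have "x \<bullet> (A *v x) \<le> norm x * norm (A *v x)" by (rule norm_cauchy_schwarz)
    also have "\<dots> \<le> norm x * (norm x * s)"
      using k(1)[of x] mult_left_mono[OF less_imp_le[OF s(3)] norm_ge_zero[of x]]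
      by (intro mult_left_mono[OF _ norm_ge_zero]) linarith
    finally show "0 \<le> x \<bullet> e x"
      using s by (simp add: e_def inner_diff_right field_simps power2_norm_eq_inner[symmetric] power2_eq_square)
    show "x \<bullet> e x \<le> q * (norm x)\<^sup>2"
      using A[of x] s by (simp add: e_def q_def inner_diff_right field_simps power2_norm_eq_inner)
  qed
  define E where "E = Blinfun e"
  have E: "blinfun_apply E = e" by (simp add: E_def bounded_linear_Blinfun_apply[OF e_bl])
  have nE: "norm E \<le> q" by (rule norm_blinfun_bound) (use q e_norm E in auto)
  define G where "G = (\<lambda>Y. (1/2) *\<^sub>R (E + (Y o\<^sub>L Y)))"
  define C where "C = {Y :: (real^'n) \<Rightarrow>\<^sub>L (real^'n). norm Y \<le> q \<and> (\<forall>x y. x \<bullet> blinfun_apply Y y = blinfun_apply Y x \<bullet> y)}"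
  have "\<exists>!Y\<in>C. G Y = Y"
  proof (rule Banach_fix)
    have "C = cball 0 q \<inter> (\<Inter>x. \<Inter>y. {Y. x \<bullet> blinfun_apply Y y = blinfun_apply Y x \<bullet> y})" by (auto simp: C_def dist_norm)
    moreover have "closed {Y :: (real^'n) \<Rightarrow>\<^sub>L (real^'n). x \<bullet> blinfun_apply Y y = blinfun_apply Y x \<bullet> y}" for x y
      by (intro closed_Collect_eq continuous_intros)
    ultimately show "complete C" by (auto simp: complete_eq_closed intro!: closed_Int closed_INT)
    have "0 \<in> C" using q by (simp add: C_def)
    then show "C \<noteq> {}" by blast
    show "0 \<le> q" "q < 1" by fact+
    show "G ` C \<subseteq> C"
    proof
      fix Z assume "Z \<in> G ` C"
      then obtain Y where Y: "Z = G Y" "Y \<in> C" by blast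
      have "norm (Y o\<^sub>L Y) \<le> norm Y * norm Y" by (rule norm_blinfun_compose)
      also have "\<dots> \<le> q * 1" using Y(2) q by (intro mult_mono) (auto simp: C_def)
      finally have "norm (E + (Y o\<^sub>L Y)) \<le> q + q" using nE norm_triangle_ineq[of E "Y o\<^sub>L Y"] by linarith
      then have "norm Z \<le> q" by (simp add: Y(1) G_def)
      moreover have "x \<bullet> blinfun_apply Z y = blinfun_apply Z x \<bullet> y" for x y
      proof -
        have sY: "x \<bullet> blinfun_apply Y y = blinfun_apply Y x \<bullet> y" for x y using Y(2) by (simp add: C_def)
        have "x \<bullet> blinfun_apply Y (blinfun_apply Y y) = blinfun_apply Y (blinfun_apply Y x) \<bullet> y" by (simp only: sY)
        then show ?thesis
          using e_sym[of x y] by (simp add: Y(1) G_def blinfun.add_left blinfun.scaleR_left E inner_add_left inner_add_right)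
      qed
      ultimately show "Z \<in> C" by (simp add: C_def)
    qed
    fix Y Z assume YZ: "Y \<in> C" "Z \<in> C"
    have "G Y - G Z = (1/2) *\<^sub>R ((Y o\<^sub>L (Y - Z)) + ((Y - Z) o\<^sub>L Z))"
      by (rule blinfun_eqI)
        (simp add: G_def blinfun.add_left blinfun.diff_left blinfun.diff_right blinfun.scaleR_left algebra_simps)
    then have "norm (G Y - G Z) \<le> (1/2) * (norm (Y o\<^sub>L (Y - Z)) + norm ((Y - Z) o\<^sub>L Z))"
      by (simp add: norm_triangle_ineq)
    also have "\<dots> \<le> (1/2) * (norm Y * norm (Y - Z) + norm (Y - Z) * norm Z)"
      by (intro mult_left_mono add_mono norm_blinfun_compose) auto
    also have "\<dots> \<le> (1/2) * (q * norm (Y - Z) + norm (Y - Z) * q)"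
      using YZ by (intro mult_left_mono add_mono mult_right_mono) (auto simp: C_def)
    finally show "dist (G Y) (G Z) \<le> q * dist Y Z" by (simp add: dist_norm)
  qed
  then obtain Y where Y: "Y \<in> C" "G Y = Y" by blast
  have YY: "blinfun_apply Y (blinfun_apply Y x) = 2 *\<^sub>R blinfun_apply Y x - x + (1 / s) *\<^sub>R (A *v x)" for x
  proof -
    have "2 *\<^sub>R blinfun_apply Y x = 2 *\<^sub>R blinfun_apply (G Y) x" by (simp add: Y(2))
    also have "\<dots> = e x + blinfun_apply Y (blinfun_apply Y x)" by (simp add: G_def blinfun.add_left blinfun.scaleR_left E)
    finally show ?thesis by (simp add: e_def algebra_simps)
  qed
  define B where "B = matrix (\<lambda>x. sqrt s *\<^sub>R (x - blinfun_apply Y x))"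
  have lin: "linear (\<lambda>x. sqrt s *\<^sub>R (x - blinfun_apply Y x))"
    by (auto intro!: linearI simp: blinfun.add_right blinfun.scaleR_right algebra_simps)
  have B: "B *v x = sqrt s *\<^sub>R (x - blinfun_apply Y x)" for x unfolding B_def
    by (rule matrix_works) (simp add: linear_matrix_vector_mul_eq lin)
  have "transpose B = B"
    by (rule symmetric_matrixI)
      (use Y(1) in \<open>simp add: B C_def inner_diff_left inner_diff_right\<close>)
  moreover have "0 \<le> \<xi> \<bullet> (B *v \<xi>)" for \<xi>
  proof -
    have "\<xi> \<bullet> blinfun_apply Y \<xi> \<le> norm \<xi> * norm (blinfun_apply Y \<xi>)" by (rule norm_cauchy_schwarz)
    also have "\<dots> \<le> norm \<xi> * (norm Y * norm \<xi>)" by (intro mult_left_mono norm_blinfun) auto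
    also have "\<dots> \<le> norm \<xi> * (1 * norm \<xi>)"
      using Y(1) q by (intro mult_left_mono mult_right_mono) (auto simp: C_def)
    finally show ?thesis
      using s by (simp add: B inner_diff_right power2_norm_eq_inner[symmetric] power2_eq_square)
  qed
  moreover have "B ** B = A"
  proof -
    have "(B ** B) *v x = A *v x" for x
    proof -
      have "(B ** B) *v x = (sqrt s * sqrt s) *\<^sub>R ((x - blinfun_apply Y x)
          - (blinfun_apply Y x - blinfun_apply Y (blinfun_apply Y x)))"
        unfolding matrix_vector_mul_assoc[symmetric] B blinfun.scaleR_right blinfun.diff_right
        by (simp only: scaleR_scaleR scaleR_diff_right)
      also have "\<dots> = s *\<^sub>R ((1 / s) *\<^sub>R (A *v x))"
        using s unfolding YY by (simp add: scaleR_2)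
      finally show ?thesis using s by simp
    qed
    then show ?thesis by (simp add: matrix_eq)
  qed
  ultimately show ?thesis by blast
qed

lemma norm_matrix_sqrt:
  fixes A :: "real^'n^'n"
  assumes "0 < m" and "\<And>\<xi>. m * (norm \<xi>)\<^sup>2 \<le> \<xi> \<bullet> (A *v \<xi>)" and "transpose A = A"
  shows "(norm (matrix_sqrt A *v x))\<^sup>2 = x \<bullet> (A *v x)"
proof -
  have *: "transpose (matrix_sqrt A) = matrix_sqrt A \<and> (\<forall>\<xi>. 0 \<le> \<xi> \<bullet> (matrix_sqrt A *v \<xi>))
      \<and> matrix_sqrt A ** matrix_sqrt A = A"
    unfolding matrix_sqrt_def by (rule someI_ex[OF positive_definite_sqrt_exists[OF assms]])
  have "(norm (matrix_sqrt A *v x))\<^sup>2 = x \<bullet> (matrix_sqrt A *v (matrix_sqrt A *v x))"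
    unfolding power2_norm_eq_inner
    by (rule symmetric_matrix_inner[symmetric]) (use * in blast)
  also have "\<dots> = x \<bullet> (A *v x)"
    using * by (simp add: matrix_vector_mul_assoc)
  finally show ?thesis .
qed

section \<open>Integration by parts and the fundamental lemma\<close>

lemma integrable_continuous_bounded_support:
  fixes g :: "'a::euclidean_space \<Rightarrow> 'b::{banach, second_countable_topology}"
  assumes "continuous_on UNIV g" "\<And>x. R < norm x \<Longrightarrow> g x = 0"
  shows "integrable lborel g"
proof -
  have "integrable lborel (\<lambda>x. indicator (cball 0 R) x *\<^sub>R g x)"
    by (intro borel_integrable_compact compact_cball continuous_on_subset[OF assms(1)]) simp
  also have "(\<lambda>x. indicator (cball 0 R) x *\<^sub>R g x) = g"
    using assms(2) by (force simp: indicator_def)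
  finally show ?thesis .
qed

lemma gradient_vanishes:
  assumes "GDERIV \<phi> x :> d" and "open U" "x \<in> U" "\<And>y. y \<in> U \<Longrightarrow> \<phi> y = 0"
  shows "d = 0"
proof -
  have "(\<phi> has_derivative (\<lambda>h. 0)) (at x)"
    by (rule has_derivative_transform_within_open[where f = "\<lambda>_. 0" and s = U])
      (use assms in auto)
  moreover have "(\<phi> has_derivative (\<lambda>h. h \<bullet> d)) (at x)" using assms(1) by (simp add: gderiv_def)
  ultimately have "(\<lambda>h. h \<bullet> d) = (\<lambda>h. 0)" using has_derivative_unique by blast
  then have "d \<bullet> d = 0" by meson
  then show ?thesis by simp
qed

lemma C1_with_gradientD:
  assumes "C1_with_gradient \<phi> D"
  shows "GDERIV \<phi> x :> D x" "(\<phi> has_derivative (\<lambda>h. h \<bullet> D x)) (at x)" "continuous_on UNIV D"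
    "continuous_on UNIV \<phi>"
proof -
  show *: "(\<phi> has_derivative (\<lambda>h. h \<bullet> D x)) (at x)" for x
    using assms by (simp add: C1_with_gradient_def gderiv_def)
  then show "continuous_on UNIV \<phi>"
    by (auto simp: continuous_on_eq_continuous_at intro: has_derivative_continuous)
qed (use assms in \<open>auto simp: C1_with_gradient_def\<close>)

text \<open>The integral of \<open>\<phi>\<close> is invariant under translation, so the difference quotients of \<open>\<phi>\<close> in
  direction \<open>e\<close> integrate to zero; they converge to \<open>D x \<bullet> e\<close> boundedly and with uniformly bounded
  support.\<close>

lemma integral_gradient_eq_0:
  fixes \<phi> :: "'a::euclidean_space \<Rightarrow> real"
  assumes C1: "C1_with_gradient \<phi> D" and supp: "\<And>x. R < norm x \<Longrightarrow> \<phi> x = 0"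
  shows "(LINT x|lborel. D x \<bullet> e) = 0"
proof -
  note D = C1_with_gradientD[OF C1]
  have D0: "D x = 0" if "R < norm x" for x
  proof (rule gradient_vanishes[OF D(1)])
    show "open {x. R < norm x}" by (intro open_Collect_less continuous_intros)
  qed (use supp that in auto)
  have "bounded (D ` cball 0 R)"
    using D(3) by (intro compact_imp_bounded compact_continuous_image) (auto intro: continuous_on_subset)
  then obtain B where "B > 0" and B: "\<And>x. x \<in> cball 0 R \<Longrightarrow> norm (D x) \<le> B"
    unfolding bounded_pos by blast
  have B: "norm (D x) \<le> B" for x using B[of x] D0[of x] \<open>B > 0\<close> by (cases "R < norm x") auto
  have lip: "\<bar>\<phi> y - \<phi> x\<bar> \<le> B * norm (y - x)" for x y
  proof -
    have "norm (\<phi> y - \<phi> x) \<le> B * norm (y - x)"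
    proof (rule differentiable_bound[of UNIV])
      fix z :: 'a
      show "(\<phi> has_derivative (\<lambda>h. h \<bullet> D z)) (at z)" by (rule D(2))
      show "onorm (\<lambda>h. h \<bullet> D z) \<le> B"
      proof (rule onorm_le)
        fix h :: 'a
        have "norm (h \<bullet> D z) \<le> norm h * norm (D z)" by (simp add: Cauchy_Schwarz_ineq2)
        also have "\<dots> \<le> norm h * B" by (intro mult_left_mono B) auto
        finally show "norm (h \<bullet> D z) \<le> B * norm h" by (simp add: mult.commute)
      qed
    qed auto
    then show ?thesis by simp
  qed
  define t where "t = (\<lambda>n. inverse (real (Suc n)))"
  have t: "0 < t n" "t n \<le> 1" for n by (auto simp: t_def field_simps)
  define q where "q = (\<lambda>n x. (\<phi> (x + t n *\<^sub>R e) - \<phi> x) / t n)"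
  have int: "integrable lborel \<phi>" by (rule integrable_continuous_bounded_support[OF D(4) supp])
  have q0: "(LINT x|lborel. q n x) = 0" for n
  proof -
    have shift: "integrable lborel (\<lambda>x. \<phi> (x + c))" "(LINT x|lborel. \<phi> (x + c)) = (LINT x|lborel. \<phi> x)" for c
    proof -
      have m: "\<phi> \<in> borel_measurable borel" using int by auto
      show "integrable lborel (\<lambda>x. \<phi> (x + c))"
        using integrable_distr_eq[of "(+) c" lborel borel \<phi>] m int
        unfolding lborel_distr_plus by (simp add: add.commute)
      show "(LINT x|lborel. \<phi> (x + c)) = (LINT x|lborel. \<phi> x)"
        using integral_distr[of "(+) c" lborel borel \<phi>] m
        unfolding lborel_distr_plus by (simp add: add.commute)
    qed
    show ?thesis using shift int by (simp add: q_def)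
  qed
  have "(\<lambda>n. LINT x|lborel. q n x) \<longlonglongrightarrow> (LINT x|lborel. D x \<bullet> e)"
  proof (rule integral_dominated_convergence)
    show "integrable lborel (\<lambda>x. indicator (cball 0 (R + norm e)) x *\<^sub>R (B * norm e) :: real)"
      by (intro borel_integrable_compact) auto
    have bm: "\<phi> \<in> borel_measurable borel" "D \<in> borel_measurable borel"
      using D(3,4) borel_measurable_continuous_onI by blast+
    show "(\<lambda>x. D x \<bullet> e) \<in> borel_measurable lborel" using bm by simp
    show "q n \<in> borel_measurable lborel" for n unfolding q_def using bm by simp
    show "AE x in lborel. (\<lambda>n. q n x) \<longlonglongrightarrow> D x \<bullet> e"
    proof (rule AE_I2)
      fix x
      have *: "((\<lambda>s. \<phi> (x + s *\<^sub>R e)) has_derivative (\<lambda>h. (h *\<^sub>R e) \<bullet> D x)) (at 0)"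
        by (rule has_derivative_compose[of "\<lambda>s. x + s *\<^sub>R e" "\<lambda>h. h *\<^sub>R e"])
          (auto intro!: derivative_eq_intros simp: D(2))
      have "((\<lambda>s. \<phi> (x + s *\<^sub>R e)) has_field_derivative (e \<bullet> D x)) (at 0)"
      proof -
        have "(\<lambda>h. (h *\<^sub>R e) \<bullet> D x) = (*) (e \<bullet> D x)" by (simp add: fun_eq_iff)
        then show ?thesis using * by (simp add: has_field_derivative_def)
      qed
      then have "((\<lambda>s. (\<phi> (x + s *\<^sub>R e) - \<phi> x) / s) \<longlongrightarrow> e \<bullet> D x) (at 0)"
        by (simp add: has_field_derivative_iff)
      moreover have "filterlim t (at 0) sequentially"
        unfolding filterlim_at using t LIMSEQ_inverse_real_of_nat by (auto simp: t_def)
      ultimately have "(\<lambda>n. (\<phi> (x + t n *\<^sub>R e) - \<phi> x) / t n) \<longlonglongrightarrow> e \<bullet> D x"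
        by (rule filterlim_compose)
      then show "(\<lambda>n. q n x) \<longlonglongrightarrow> D x \<bullet> e" by (simp add: q_def inner_commute)
    qed
    show "AE x in lborel. norm (q n x) \<le> indicator (cball 0 (R + norm e)) x *\<^sub>R (B * norm e)" for n
    proof (rule AE_I2)
      fix x
      show "norm (q n x) \<le> indicator (cball 0 (R + norm e)) x *\<^sub>R (B * norm e)"
      proof (cases "x \<in> cball 0 (R + norm e)")
        case True
        then show ?thesis
          using lip[of "x + t n *\<^sub>R e" x] t[of n] by (simp add: q_def divide_le_eq mult_ac)
      next
        case False
        have "norm x \<le> norm (x + t n *\<^sub>R e) + norm (t n *\<^sub>R e)"
          using norm_triangle_ineq4[of "x + t n *\<^sub>R e" "t n *\<^sub>R e"] by simp
        moreover have "norm (t n *\<^sub>R e) \<le> norm e"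
          using t[of n] by (simp add: mult_left_le_one_le)
        ultimately have "R < norm (x + t n *\<^sub>R e)" using False by simp
        moreover have "R < norm x" using False norm_ge_zero[of e] by (simp del: norm_ge_zero)
        ultimately show ?thesis using False supp by (simp add: q_def)
      qed
    qed
  qed
  then show ?thesis unfolding q0 using LIMSEQ_unique tendsto_const by blast
qed

text \<open>The divergence theorem for an affine field with scalar linear part: apply
  \<open>integral_gradient_eq_0\<close> to \<open>\<phi>\<close> and to the products of \<open>\<phi>\<close> with the coordinates.\<close>

lemma integral_affine_field_dot_gradient:
  fixes \<phi> :: "'a::euclidean_space \<Rightarrow> real"
  assumes C1: "C1_with_gradient \<phi> D" and supp: "\<And>x. R < norm x \<Longrightarrow> \<phi> x = 0"
  shows "(LINT x|lborel. (a + c *\<^sub>R x) \<bullet> D x) = - (real DIM('a) * c) * (LINT x|lborel. \<phi> x)"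
proof -
  note D = C1_with_gradientD[OF C1]
  have D0: "D x = 0" if "R < norm x" for x
  proof (rule gradient_vanishes[OF D(1)])
    show "open {x. R < norm x}" by (intro open_Collect_less continuous_intros)
  qed (use supp that in auto)
  have int\<phi>: "integrable lborel \<phi>" by (rule integrable_continuous_bounded_support[OF D(4) supp])
  have intD: "integrable lborel D" by (rule integrable_continuous_bounded_support[OF D(3) D0])
  have intxD: "integrable lborel (\<lambda>x. (x \<bullet> i) * (D x \<bullet> i))" for i
    by (rule integrable_continuous_bounded_support[where R = R])
      (use D(3) D0 in \<open>auto intro!: continuous_intros\<close>)
  have part: "(LINT x|lborel. (x \<bullet> i) * (D x \<bullet> i)) = - (LINT x|lborel. \<phi> x)" if i: "i \<in> Basis" for i
  proof -
    have g: "GDERIV (\<lambda>x. x \<bullet> i) x :> i" for x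
      unfolding gderiv_def by (auto intro!: derivative_eq_intros)
    have "C1_with_gradient (\<lambda>x. (x \<bullet> i) * \<phi> x) (\<lambda>x. (x \<bullet> i) *\<^sub>R D x + \<phi> x *\<^sub>R i)"
      unfolding C1_with_gradient_def
      using GDERIV_mult[OF g D(1)] D(3,4) by (auto intro!: continuous_intros)
    then have "(LINT x|lborel. ((x \<bullet> i) *\<^sub>R D x + \<phi> x *\<^sub>R i) \<bullet> i) = 0"
      by (rule integral_gradient_eq_0[where R = R]) (use supp in auto)
    then have "(LINT x|lborel. (x \<bullet> i) * (D x \<bullet> i) + \<phi> x) = 0"
      using i by (simp add: inner_add_left inner_same_Basis)
    then show ?thesis using int\<phi> intxD by simp
  qed
  have "(LINT x|lborel. (a + c *\<^sub>R x) \<bullet> D x)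
      = (LINT x|lborel. D x \<bullet> a + c * (\<Sum>i\<in>Basis. (x \<bullet> i) * (D x \<bullet> i)))"
  proof (rule Bochner_Integration.integral_cong)
    show "(a + c *\<^sub>R x) \<bullet> D x = D x \<bullet> a + c * (\<Sum>i\<in>Basis. (x \<bullet> i) * (D x \<bullet> i))" for x
      unfolding euclidean_inner[of x "D x", symmetric]
      by (simp add: inner_add_left inner_commute[of a])
  qed simp
  also have "\<dots> = (LINT x|lborel. D x \<bullet> a) + c * (\<Sum>i\<in>Basis. LINT x|lborel. (x \<bullet> i) * (D x \<bullet> i))"
    using intxD integrable_inner_left[OF intD] by simp
  also have "\<dots> = - (real DIM('a) * c) * (LINT x|lborel. \<phi> x)"
    using integral_gradient_eq_0[OF C1 supp, where e = a] part by simp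
  finally show ?thesis .
qed

text \<open>The square of the positive part makes the function continuously differentiable across the
  sphere, while it stays positive exactly in the ball with centre \<open>fst B\<close> and radius \<open>snd B\<close>.\<close>

definition bump :: "'a::euclidean_space \<times> real \<Rightarrow> 'a \<Rightarrow> real" where
  "bump B x = (max 0 ((snd B)\<^sup>2 - (norm (x - fst B))\<^sup>2))\<^sup>2"

definition bump_gradient :: "'a::euclidean_space \<times> real \<Rightarrow> 'a \<Rightarrow> 'a" where
  "bump_gradient B x = (- 4 * max 0 ((snd B)\<^sup>2 - (norm (x - fst B))\<^sup>2)) *\<^sub>R (x - fst B)"

lemma DERIV_max_0_squared: "DERIV (\<lambda>s::real. (max 0 s)\<^sup>2) s :> 2 * max 0 s"
proof (cases s "0::real" rule: linorder_cases)
  case less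
  have "DERIV (\<lambda>s::real. 0) s :> 0" by simp
  then have "DERIV (\<lambda>s::real. (max 0 s)\<^sup>2) s :> 0"
    by (rule has_field_derivative_transform_within_open[of _ _ _ "{..<0}"]) (use less in auto)
  then show ?thesis using less by simp
next
  case greater
  have "DERIV (\<lambda>s::real. s\<^sup>2) s :> 2 * s" by (auto intro!: derivative_eq_intros)
  then have "DERIV (\<lambda>s::real. (max 0 s)\<^sup>2) s :> 2 * s"
    by (rule has_field_derivative_transform_within_open[of _ _ _ "{0<..}"]) (use greater in auto)
  then show ?thesis using greater by simp
next
  case equal
  have "((\<lambda>h::real. (max 0 h)\<^sup>2 / h) \<longlongrightarrow> 0) (at 0)"
  proof (rule Lim_null_comparison)
    show "eventually (\<lambda>h. norm ((max 0 h)\<^sup>2 / h) \<le> \<bar>h\<bar>) (at (0::real))"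
      by (rule always_eventually) (auto simp: max_def power2_eq_square)
    show "((\<lambda>h::real. \<bar>h\<bar>) \<longlongrightarrow> 0) (at 0)" by (auto intro!: tendsto_eq_intros)
  qed
  then show ?thesis using equal by (simp add: has_field_derivative_iff)
qed

lemma C1_bump: "C1_with_gradient (bump B) (bump_gradient B)"
  unfolding C1_with_gradient_def
proof (intro conjI allI)
  fix x
  have "(\<lambda>x. (snd B)\<^sup>2 - (norm (x - fst B))\<^sup>2) = (\<lambda>x. (snd B)\<^sup>2 - (x - fst B) \<bullet> (x - fst B))"
    by (simp add: power2_norm_eq_inner)
  then have "GDERIV (\<lambda>x. (snd B)\<^sup>2 - (norm (x - fst B))\<^sup>2) x :> (- 2) *\<^sub>R (x - fst B)"
    unfolding gderiv_def by (auto intro!: derivative_eq_intros simp: inner_commute)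
  from GDERIV_DERIV_compose[OF this DERIV_max_0_squared]
  show "GDERIV (bump B) x :> bump_gradient B x"
    by (simp add: bump_def[abs_def] bump_gradient_def mult.commute)
  show "continuous_on UNIV (bump_gradient B)"
    unfolding bump_gradient_def[abs_def] by (intro continuous_intros)
qed

lemma bump_nonneg: "0 \<le> bump B x" by (simp add: bump_def)

lemma bump_pos_iff: "0 < snd B \<Longrightarrow> 0 < bump B x \<longleftrightarrow> x \<in> ball (fst B) (snd B)"
proof -
  assume B: "0 < snd B"
  have "0 < bump B x \<longleftrightarrow> (norm (x - fst B))\<^sup>2 < (snd B)\<^sup>2"
    by (auto simp: bump_def max_def zero_less_power2)
  also have "\<dots> \<longleftrightarrow> norm (x - fst B) < snd B"
    using B by (metis norm_ge_zero power_strict_mono power2_less_imp_less less_imp_le zero_less_numeral)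
  finally show ?thesis by (simp add: dist_norm norm_minus_commute)
qed

lemma C1_sum:
  assumes "\<And>i. i \<in> I \<Longrightarrow> C1_with_gradient (\<phi> i) (D i)"
  shows "C1_with_gradient (\<lambda>x. \<Sum>i\<in>I. \<phi> i x) (\<lambda>x. \<Sum>i\<in>I. D i x)"
  unfolding C1_with_gradient_def gderiv_def
proof (intro conjI allI)
  show "((\<lambda>x. \<Sum>i\<in>I. \<phi> i x) has_derivative (\<lambda>h. h \<bullet> (\<Sum>i\<in>I. D i x))) (at x)" for x
    unfolding inner_sum_right
    using assms by (intro has_derivative_sum) (auto intro: C1_with_gradientD)
  show "continuous_on UNIV (\<lambda>x. \<Sum>i\<in>I. D i x)"
    using assms by (intro continuous_on_sum) (auto intro: C1_with_gradientD)
qed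

text \<open>As \<open>k\<close> grows, these functions increase to the indicator of the set where \<open>\<Psi>\<close> is positive.\<close>

lemma C1_saturate:
  assumes C1: "C1_with_gradient \<Psi> D" and nonneg: "\<And>x. 0 \<le> \<Psi> x" and k: "0 \<le> k"
  shows "C1_with_gradient (\<lambda>x. k * \<Psi> x / (1 + k * \<Psi> x)) (\<lambda>x. (k / (1 + k * \<Psi> x)\<^sup>2) *\<^sub>R D x)"
  unfolding C1_with_gradient_def
proof (intro conjI allI)
  note D = C1_with_gradientD[OF C1]
  have pos: "0 < 1 + k * \<Psi> x" for x using nonneg[of x] k by (simp add: add_pos_nonneg)
  show "GDERIV (\<lambda>x. k * \<Psi> x / (1 + k * \<Psi> x)) x :> (k / (1 + k * \<Psi> x)\<^sup>2) *\<^sub>R D x" for x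
  proof -
    have "DERIV (\<lambda>s. k * s / (1 + k * s)) (\<Psi> x) :> k / (1 + k * \<Psi> x)\<^sup>2"
      using pos[of x] by (auto intro!: derivative_eq_intros simp: power2_eq_square field_simps)
    from GDERIV_DERIV_compose[OF D(1) this] show ?thesis .
  qed
  show "continuous_on UNIV (\<lambda>x. (k / (1 + k * \<Psi> x)\<^sup>2) *\<^sub>R D x)"
    using D(3,4) pos by (intro continuous_intros) (auto simp: less_imp_neq[symmetric])
qed

text \<open>The indicator of \<open>V\<close> is a bounded pointwise limit of test functions: cover \<open>V\<close> by countably
  many balls whose closures lie in \<open>V\<close>, and saturate the sums of the first \<open>n\<close> bumps.\<close>

lemma integral_open_eq_0:
  fixes h :: "'a::euclidean_space \<Rightarrow> real"
  assumes h: "integrable lborel h"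
    and 0: "\<And>\<phi> D. test_function V \<phi> D \<Longrightarrow> (LINT x|lborel. \<phi> x * h x) = 0"
    and V: "open V"
  shows "(LINT x|lborel. indicator V x * h x) = 0"
proof (cases "V = {}")
  case False
  define P where "P = {B :: 'a \<times> real. 0 < snd B \<and> cball (fst B) (snd B) \<subseteq> V}"
  define b where "b = (\<lambda>B :: 'a \<times> real. ball (fst B) (snd B))"
  have "\<Union>(b ` P) = V"
  proof
    show "\<Union>(b ` P) \<subseteq> V" using ball_subset_cball by (fastforce simp: P_def b_def)
    show "V \<subseteq> \<Union>(b ` P)"
    proof
      fix x assume "x \<in> V"
      then obtain r where "r > 0" "cball x r \<subseteq> V" using V open_contains_cball by blast
      then show "x \<in> \<Union>(b ` P)" by (intro UN_I[of "(x, r)"]) (auto simp: P_def b_def)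
    qed
  qed
  moreover obtain F where F: "F \<subseteq> b ` P" "countable F" "\<Union>F = \<Union>(b ` P)"
    by (rule Lindelof[of "b ` P"]) (auto simp: b_def)
  moreover obtain C where C: "countable C" "C \<subseteq> P" "F = b ` C"
    using F(1,2) countable_subset_image by metis
  ultimately have UC: "(\<Union>B\<in>C. b B) = V" by simp
  then have "C \<noteq> {}" using False by auto
  define B where "B = from_nat_into C"
  have rB: "range B = C" unfolding B_def by (rule range_from_nat_into[OF \<open>C \<noteq> {}\<close> C(1)])
  have B: "0 < snd (B i)" "cball (fst (B i)) (snd (B i)) \<subseteq> V" for i
    using rB C(2) by (auto simp: P_def)
  have VB: "V = (\<Union>i. ball (fst (B i)) (snd (B i)))" using UC rB by (auto simp: b_def)
  define \<Psi> where "\<Psi> = (\<lambda>n x. \<Sum>i<n. bump (B i) x)"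
  have \<Psi>0: "0 \<le> \<Psi> n x" for n x by (simp add: \<Psi>_def sum_nonneg bump_nonneg)
  define \<phi> where "\<phi> = (\<lambda>n x. real n * \<Psi> n x / (1 + real n * \<Psi> n x))"
  have \<phi>01: "0 \<le> \<phi> n x" "\<phi> n x \<le> 1" for n x
  proof -
    have "0 \<le> real n * \<Psi> n x" using \<Psi>0[of n x] by simp
    then show "0 \<le> \<phi> n x" "\<phi> n x \<le> 1" by (simp_all add: \<phi>_def divide_le_eq)
  qed
  have zero: "\<Psi> n x = 0" if "\<And>i. i < n \<Longrightarrow> x \<notin> ball (fst (B i)) (snd (B i))" for n x
    unfolding \<Psi>_def
  proof (intro sum.neutral ballI)
    fix i assume "i \<in> {..<n}"
    then have "\<not> 0 < bump (B i) x" using that[of i] bump_pos_iff[OF B(1)[of i], of x] by simp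
    then show "bump (B i) x = 0" using bump_nonneg[of "B i" x] by simp
  qed
  have test: "\<exists>D. test_function V (\<phi> n) D" for n
  proof -
    define G where "G = (\<lambda>x. (real n / (1 + real n * \<Psi> n x)\<^sup>2) *\<^sub>R (\<Sum>i<n. bump_gradient (B i) x))"
    have "C1_with_gradient (\<phi> n) G"
      unfolding \<phi>_def G_def
      by (rule C1_saturate[OF _ \<Psi>0]) (auto simp: \<Psi>_def intro!: C1_sum C1_bump)
    moreover define K where "K = (\<Union>i<n. cball (fst (B i)) (snd (B i)))"
    have K: "compact K" "K \<subseteq> V" using B(2) by (auto simp: K_def)
    have "{x. \<phi> n x \<noteq> 0} \<subseteq> K"
    proof
      fix x assume "x \<in> {x. \<phi> n x \<noteq> 0}"
      then have "\<Psi> n x \<noteq> 0" by (auto simp: \<phi>_def)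
      then obtain i where "i < n" "x \<in> ball (fst (B i)) (snd (B i))" using zero by blast
      then show "x \<in> K" using ball_subset_cball unfolding K_def by blast
    qed
    then have "closure {x. \<phi> n x \<noteq> 0} \<subseteq> K" using K(1) by (simp add: closure_minimal compact_imp_closed)
    then have "compact (closure {x. \<phi> n x \<noteq> 0})" "closure {x. \<phi> n x \<noteq> 0} \<subseteq> V"
      using K(2) compact_Int_closed[OF K(1) closed_closure, of "{x. \<phi> n x \<noteq> 0}"]
      by (auto simp: Int_absorb1)
    ultimately show ?thesis unfolding test_function_def by blast
  qed
  have "(\<lambda>n. LINT x|lborel. \<phi> n x * h x) \<longlonglongrightarrow> (LINT x|lborel. indicator V x * h x)"
  proof (rule integral_dominated_convergence[where w = "\<lambda>x. \<bar>h x\<bar>"])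
    have hm: "h \<in> borel_measurable borel" using h by auto
    show "(\<lambda>x. indicator V x * h x) \<in> borel_measurable lborel"
      using hm V by (auto intro!: borel_measurable_times borel_measurable_indicator)
    show "(\<lambda>x. \<phi> n x * h x) \<in> borel_measurable lborel" for n
    proof -
      obtain D where "C1_with_gradient (\<phi> n) D" using test[of n] by (auto simp: test_function_def)
      then have "\<phi> n \<in> borel_measurable borel" using C1_with_gradientD(4) borel_measurable_continuous_onI by blast
      then show ?thesis using hm by simp
    qed
    show "integrable lborel (\<lambda>x. \<bar>h x\<bar>)" using h by simp
    show "AE x in lborel. norm (\<phi> n x * h x) \<le> \<bar>h x\<bar>" for n
      using \<phi>01[of n] by (auto simp: abs_mult intro!: AE_I2 mult_left_le_one_le)
    show "AE x in lborel. (\<lambda>n. \<phi> n x * h x) \<longlonglongrightarrow> indicator V x * h x"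
    proof (intro AE_I2 tendsto_mult_right)
      fix x
      show "(\<lambda>n. \<phi> n x) \<longlonglongrightarrow> indicator V x"
      proof (cases "x \<in> V")
        case False
        then have "\<phi> n x = 0" for n using zero[of n x] VB by (auto simp: \<phi>_def)
        then show ?thesis using False by simp
      next
        case True
        then obtain i where i: "x \<in> ball (fst (B i)) (snd (B i))" using VB by blast
        define \<delta> where "\<delta> = bump (B i) x"
        have \<delta>: "0 < \<delta>" using i bump_pos_iff[OF B(1)] by (simp add: \<delta>_def)
        have ge: "\<delta> \<le> \<Psi> n x" if "i < n" for n
          unfolding \<Psi>_def \<delta>_def using that by (intro member_le_sum) (auto simp: bump_nonneg)
        have lim: "(\<lambda>n. 1 - 1 / (real n * \<delta>)) \<longlonglongrightarrow> 1"
        proof -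
          have "(\<lambda>n. 1 - (1 / real n) * (1 / \<delta>)) \<longlonglongrightarrow> 1 - 0 * (1 / \<delta>)"
            by (intro tendsto_intros lim_1_over_n)
          then show ?thesis by simp
        qed
        show ?thesis
        proof (rule tendsto_sandwich[OF _ _ _ tendsto_const])
          show "eventually (\<lambda>n. 1 - 1 / (real n * \<delta>) \<le> \<phi> n x) sequentially"
            using eventually_gt_at_top[of i]
          proof eventually_elim
            case (elim n)
            have n: "0 < real n * \<delta>" using elim \<delta> by simp
            have le: "real n * \<delta> \<le> 1 + real n * \<Psi> n x"
              using ge[OF elim] by (simp add: mult_left_mono add_increasing)
            have "\<phi> n x = 1 - 1 / (1 + real n * \<Psi> n x)"
              using n le by (simp add: \<phi>_def field_simps)
            also have "\<dots> \<ge> 1 - 1 / (real n * \<delta>)"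
              using n le by (simp add: frac_le)
            finally show ?case .
          qed
          show "eventually (\<lambda>n. \<phi> n x \<le> indicator V x) sequentially" using \<phi>01 True by simp
          show "(\<lambda>n. 1 - 1 / (real n * \<delta>)) \<longlonglongrightarrow> indicator V x" using lim True by simp
        qed
      qed
    qed
  qed
  moreover have "(LINT x|lborel. \<phi> n x * h x) = 0" for n using test[of n] 0 by blast
  ultimately show ?thesis by (simp add: LIMSEQ_const_iff)
qed simp

text \<open>Open sets are stable under intersection and generate the Borel sets, and the sets over which
  \<open>h\<close> integrates to zero are closed under complements and countable disjoint unions.\<close>

lemma AE_eq_0_if_open_integrals_eq_0:
  fixes h :: "'a::euclidean_space \<Rightarrow> real"
  assumes h: "integrable lborel h"
    and 0: "\<And>V. open V \<Longrightarrow> (LINT x|lborel. indicator V x * h x) = 0"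
  shows "AE x in lborel. h x = 0"
proof -
  have "(LINT x|lborel. indicator A x * h x) = 0" if "A \<in> sets borel" for A
  proof -
    have int: "integrable lborel (\<lambda>x. indicator A x * h x)" if "A \<in> sets borel" for A
      using integrable_mult_indicator[OF _ h, of A] that by simp
    have "Int_stable {S :: 'a set. open S}" "{S :: 'a set. open S} \<subseteq> Pow UNIV"
      by (auto simp: Int_stable_def)
    moreover have "A \<in> sigma_sets UNIV {S. open S}" using that by (simp add: borel_def)
    ultimately show ?thesis
    proof (induction rule: sigma_sets_induct_disjoint)
      case (basic A)
      then show ?case using 0 by simp
    next
      case (compl A)
      have A: "A \<in> sets borel" using compl(1) by (simp add: borel_def)
      have "(LINT x|lborel. indicator (UNIV - A) x * h x)
          = (LINT x|lborel. indicator UNIV x * h x - indicator A x * h x)"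
        by (intro Bochner_Integration.integral_cong) (auto simp: indicator_def)
      also have "\<dots> = 0"
        using 0[OF open_UNIV] compl(2) int[OF A] int[of UNIV] by simp
      finally show ?case .
    next
      case (union A)
      have A: "A i \<in> sets borel" for i using union(2) by (auto simp: borel_def)
      have "set_lebesgue_integral lborel (\<Union>i. A i) h = (\<Sum>i. set_lebesgue_integral lborel (A i) h)"
      proof (rule lebesgue_integral_countable_add)
        show "\<And>i j. i \<noteq> j \<Longrightarrow> A i \<inter> A j = {}" using union(1) by (auto simp: disjoint_family_on_def)
        show "set_integrable lborel (\<Union>i. A i) h"
          using int[of "\<Union>i. A i"] A by (simp add: set_integrable_def sets.countable_UN)
      qed (use A in simp)
      also have "\<dots> = 0" using union(3) by (simp add: set_lebesgue_integral_def)
      finally show ?case by (simp add: set_lebesgue_integral_def)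
    qed simp
  qed
  then show ?thesis
    using density_unique_real[OF h, of "\<lambda>_. 0"] by (simp add: set_lebesgue_integral_def)
qed

text \<open>The function \<open>h\<close> is only Lebesgue measurable. It is replaced by a Borel version \<open>g\<close>, whose
  integrals over open sets vanish.\<close>

lemma fundamental_lemma_calculus_of_variations:
  fixes h :: "'a::euclidean_space \<Rightarrow> real"
  assumes U: "open U" and h: "integrable (lebesgue_on U) h"
    and 0: "\<And>\<phi> D. test_function U \<phi> D \<Longrightarrow> (LINT x|lebesgue_on U. \<phi> x * h x) = 0"
  shows "AE x in lebesgue_on U. h x = 0"
proof -
  have Um: "U \<in> sets lebesgue" "U \<inter> space lebesgue \<in> sets lebesgue" using U by auto
  define h0 where "h0 = (\<lambda>x. indicator U x * h x)"
  have h0: "integrable lebesgue h0" using h Um by (simp add: integrable_restrict_space h0_def)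
  then have "h0 \<in> borel_measurable lebesgue" by auto
  then obtain g where g: "g \<in> borel_measurable lborel" and eq: "AE x in lborel. h0 x = g x"
    using completion_ex_borel_measurable_real by blast
  have eq': "AE x in lebesgue. h0 x = g x" using eq AE_completion by blast
  have "integrable lebesgue g"
    using h0 eq' g by (subst integrable_cong_AE[of _ _ h0]) (auto simp: measurable_completion)
  then have gi: "integrable lborel g" using g integrable_completion by blast
  have test0: "(LINT x|lborel. \<phi> x * g x) = 0" if t: "test_function U \<phi> D" for \<phi> D
  proof -
    have \<phi>m: "\<phi> \<in> borel_measurable borel"
      using t borel_measurable_continuous_onI C1_with_gradientD(4) by (auto simp: test_function_def)
    have "(LINT x|lborel. \<phi> x * g x) = (LINT x|lebesgue. \<phi> x * g x)"
      using \<phi>m g by (intro integral_completion[symmetric]) simp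
    also have "\<dots> = (LINT x|lebesgue. \<phi> x * h0 x)"
    proof (rule integral_cong_AE)
      show "AE x in lebesgue. \<phi> x * g x = \<phi> x * h0 x" using eq' by eventually_elim simp
      have "\<phi> \<in> borel_measurable lebesgue" using \<phi>m by (simp add: measurable_completion)
      then show "(\<lambda>x. \<phi> x * g x) \<in> borel_measurable lebesgue" "(\<lambda>x. \<phi> x * h0 x) \<in> borel_measurable lebesgue"
        using h0 g measurable_completion[OF g] by (auto intro!: borel_measurable_times)
    qed
    also have "\<dots> = (LINT x|lebesgue. indicator U x *\<^sub>R (\<phi> x * h x))"
      by (intro Bochner_Integration.integral_cong) (auto simp: h0_def)
    also have "\<dots> = (LINT x|lebesgue_on U. \<phi> x * h x)"
      using Um by (simp add: integral_restrict_space)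
    finally show ?thesis using 0[OF t] by simp
  qed
  have gU: "AE x in lborel. g x = indicator U x * g x"
    using eq by eventually_elim (auto simp: h0_def indicator_def)
  have "AE x in lborel. g x = 0"
  proof (rule AE_eq_0_if_open_integrals_eq_0[OF gi])
    fix V :: "'a set" assume V: "open V"
    have gm: "g \<in> borel_measurable borel" using g by simp
    have "(LINT x|lborel. indicator V x * g x) = (LINT x|lborel. indicator (V \<inter> U) x * g x)"
    proof (rule integral_cong_AE)
      show "AE x in lborel. indicator V x * g x = indicator (V \<inter> U) x * g x"
        using gU by eventually_elim (auto simp: indicator_def split: if_splits)
    qed (use V U gm in \<open>auto intro!: borel_measurable_times borel_measurable_indicator\<close>)
    also have "\<dots> = 0"
    proof (rule integral_open_eq_0[OF gi])
      show "open (V \<inter> U)" using V U by blast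
      show "(LINT x|lborel. \<phi> x * g x) = 0" if "test_function (V \<inter> U) \<phi> D" for \<phi> D
        using test0[of \<phi> D] that by (auto simp: test_function_def)
    qed
    finally show "(LINT x|lborel. indicator V x * g x) = 0" .
  qed
  with eq have "AE x in lborel. h0 x = 0" by eventually_elim simp
  then have "AE x in lebesgue. h0 x = 0" by (rule AE_completion)
  then have "AE x in lebesgue. x \<in> U \<longrightarrow> h x = 0" by eventually_elim (auto simp: h0_def)
  then show ?thesis using Um by (simp add: AE_restrict_space_iff)
qed

section \<open>Geometry of the mesh near the boundary\<close>

text \<open>The local form of a lowest-order Raviart--Thomas function.\<close>

definition affine_on :: "'a::euclidean_space set \<Rightarrow> ('a \<Rightarrow> 'a) \<Rightarrow> 'a \<Rightarrow> real \<Rightarrow> bool" where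
  "affine_on U v a c \<longleftrightarrow> (\<forall>x\<in>U. v x = a + c *\<^sub>R x)"

text \<open>The domain lies on one side of its boundary: below a boundary point of the local graph there
  is an open set that misses \<open>\<Omega>\<close>, so no ball around the point is contained in the closure.\<close>

lemma interior_closure_lipschitz_domain:
  assumes "lipschitz_domain \<Omega>"
  shows "interior (closure \<Omega>) = \<Omega>"
proof
  have op: "open \<Omega>" using assms by (simp add: lipschitz_domain_def)
  then show "\<Omega> \<subseteq> interior (closure \<Omega>)" by (simp add: closure_subset interior_maximal)
  show "interior (closure \<Omega>) \<subseteq> \<Omega>"
  proof
    fix x assume x: "x \<in> interior (closure \<Omega>)"
    show "x \<in> \<Omega>"
    proof (rule ccontr)
      assume nx: "x \<notin> \<Omega>"
      then have "x \<in> frontier \<Omega>"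
        using x interior_subset op by (auto simp: frontier_def interior_open)
      then obtain r e \<gamma> L where r: "r > 0" and e: "norm e = 1"
        and L: "L-lipschitz_on {y. y \<bullet> e = 0} \<gamma>"
        and loc: "\<And>y. y \<in> ball x r \<Longrightarrow> y \<in> \<Omega> \<longleftrightarrow> \<gamma> (y - (y \<bullet> e) *\<^sub>R e) < y \<bullet> e"
        using assms unfolding lipschitz_domain_def by blast
      obtain s where s: "s > 0" "ball x s \<subseteq> closure \<Omega>"
        using x by (auto simp: mem_interior)
      define t where "t = min r s / 2"
      have t: "0 < t" "t < r" "t < s" using r s by (auto simp: t_def)
      define y where "y = x - t *\<^sub>R e"
      have ee: "e \<bullet> e = 1" using e by (simp add: dot_square_norm)
      have y: "y \<in> ball x r" "y \<in> closure \<Omega>"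
        using t e s by (auto simp: y_def dist_norm)
      \<comment> \<open>the open region strictly below the graph, which is disjoint from the domain near \<open>x\<close>\<close>
      define P where "P = {z. z \<bullet> e < \<gamma> (z - (z \<bullet> e) *\<^sub>R e)}"
      have "continuous_on UNIV (\<lambda>z. \<gamma> (z - (z \<bullet> e) *\<^sub>R e))"
        by (rule continuous_on_compose2[OF lipschitz_on_continuous_on[OF L]])
          (auto intro!: continuous_intros simp: inner_diff_left ee)
      then have "open P" unfolding P_def
        by (intro open_Collect_less continuous_intros)
      moreover have "y \<in> P"
      proof -
        have "x \<bullet> e \<le> \<gamma> (x - (x \<bullet> e) *\<^sub>R e)" using loc[of x] nx r by auto
        moreover have "y - (y \<bullet> e) *\<^sub>R e = x - (x \<bullet> e) *\<^sub>R e"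
          by (simp add: y_def inner_diff_left ee algebra_simps)
        ultimately show ?thesis using t by (simp add: P_def) (simp add: y_def inner_diff_left ee)
      qed
      ultimately have "open (P \<inter> ball x r)" "y \<in> P \<inter> ball x r" using y by auto
      then have "P \<inter> ball x r \<inter> \<Omega> \<noteq> {}"
        using y(2) by (metis closure_iff_nhds_not_empty Int_commute order_refl)
      then show False using loc by (force simp: P_def)
    qed
  qed
qed

text \<open>Near \<open>x\<close>, a point \<open>y\<close> on the side of \<open>z\<close> lies on the segment from \<open>z\<close> to a point \<open>s y\<close> of the
  hyperplane. The map \<open>s\<close> is continuous and fixes \<open>x\<close>, so \<open>s y\<close> lies in \<open>S\<close> for \<open>y\<close> close to \<open>x\<close>.\<close>

lemma half_ball_subset_convex:
  fixes a :: "'a::euclidean_space"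
  assumes C: "convex C" "S \<subseteq> C" and S: "affine hull S = {y. a \<bullet> y = b}"
    and x: "x \<in> rel_interior S" and z: "z \<in> C" "a \<bullet> z < b"
  shows "\<exists>r>0. \<forall>y\<in>ball x r. a \<bullet> y \<le> b \<longrightarrow> y \<in> C"
proof -
  obtain e where e: "e > 0" "ball x e \<inter> {y. a \<bullet> y = b} \<subseteq> S" and xS: "x \<in> S"
    using x S by (auto simp: mem_rel_interior_ball)
  have ax: "a \<bullet> x = b" using hull_inc[OF xS, of affine] S by blast
  define t where "t = (\<lambda>y. (b - a \<bullet> y) / (b - a \<bullet> z))"
  define s where "s = (\<lambda>y. (1 / (1 - t y)) *\<^sub>R (y - t y *\<^sub>R z))"
  have tx: "t x = 0" by (simp add: t_def ax)
  have ct: "isCont t x" using z by (auto simp: t_def intro!: continuous_intros)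
  have cs: "isCont s x" unfolding s_def using ct tx by (auto intro!: continuous_intros)
  have "s x = x" by (simp add: s_def tx)
  then have "eventually (\<lambda>y. s y \<in> ball x e) (at x)"
    using cs e(1) topological_tendstoD[of s "s x" "at x" "ball x e"] by (simp add: isCont_def)
  moreover have "eventually (\<lambda>y. t y < 1) (at x)"
    using ct tx by (auto simp: isCont_def intro: order_tendstoD(2))
  ultimately have "eventually (\<lambda>y. s y \<in> ball x e \<and> t y < 1) (at x)" by eventually_elim simp
  then obtain r where r: "r > 0" "\<And>y. y \<noteq> x \<Longrightarrow> dist y x < r \<Longrightarrow> s y \<in> ball x e \<and> t y < 1"
    by (auto simp: eventually_at)
  have "y \<in> C" if y: "y \<in> ball x r" "a \<bullet> y \<le> b" for y
  proof (cases "y = x")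
    case False
    then have *: "s y \<in> ball x e" "t y < 1" using r(2)[of y] y(1) by (auto simp: dist_commute)
    have t0: "0 \<le> t y" using y z by (simp add: t_def)
    have tt: "t y * (b - a \<bullet> z) = b - a \<bullet> y" using z by (simp add: t_def)
    have "a \<bullet> (y - t y *\<^sub>R z) = (1 - t y) * b"
      using tt by (simp add: inner_diff_right algebra_simps)
    then have "a \<bullet> s y = b" using * by (simp add: s_def)
    then have "s y \<in> C" using * e(2) C(2) by blast
    moreover have "y = (1 - t y) *\<^sub>R s y + t y *\<^sub>R z" using * by (simp add: s_def)
    ultimately show ?thesis using convexD[OF C(1) _ z(1), of "s y" "1 - t y" "t y"] t0 * by simp
  qed (use xS C in auto)
  then show ?thesis using r(1) by blast
qed

lemma mesh_element:
  fixes T :: "'a::euclidean_space set"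
  assumes "simplicial_mesh \<Omega> \<T>" "T \<in> \<T>"
  shows "convex T" "compact T" "polytope T" "aff_dim T = int DIM('a)" "interior T \<noteq> {}"
    "closed T" "bounded T"
proof -
  have T: "int DIM('a) simplex T" using assms by (simp add: simplicial_mesh_def)
  show p: "polytope T" by (rule simplex_imp_polytope[OF T])
  show "convex T" "compact T" "closed T" "bounded T"
    using p by (auto simp: polytope_imp_convex polytope_imp_compact polytope_imp_closed polytope_imp_bounded)
  show d: "aff_dim T = int DIM('a)" by (rule aff_dim_simplex[OF T])
  show "interior T \<noteq> {}"
  proof -
    have "T \<noteq> {}" using d by auto
    then show ?thesis
      using interior_rel_interior_gen[of T] rel_interior_eq_empty[OF \<open>convex T\<close>] d by simp
  qed
qed

lemma finite_mesh: "simplicial_mesh \<Omega> \<T> \<Longrightarrow> finite \<T>"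
  by (simp add: simplicial_mesh_def triangulation_def)

lemma mesh_Union: "simplicial_mesh \<Omega> \<T> \<Longrightarrow> \<Union>\<T> = closure \<Omega>"
  by (simp add: simplicial_mesh_def)

lemma mesh_Int_face: "simplicial_mesh \<Omega> \<T> \<Longrightarrow> T \<in> \<T> \<Longrightarrow> T' \<in> \<T> \<Longrightarrow> T \<inter> T' face_of T"
  by (simp add: simplicial_mesh_def triangulation_def)

text \<open>The intersection of two elements is a face of both, and a proper face misses the interior.\<close>

lemma mesh_elements_eqI:
  assumes M: "simplicial_mesh \<Omega> \<T>" and T: "T \<in> \<T>" "T' \<in> \<T>" and ne: "interior (T \<inter> T') \<noteq> {}"
  shows "T = T'"
proof -
  have *: "U \<inter> U' = U" if "U \<in> \<T>" "U' \<in> \<T>" "interior (U \<inter> U') \<noteq> {}" for U U'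
    using face_of_disjoint_interior[OF mesh_Int_face[OF M that(1,2)]] that(3) interior_subset
      interior_mono[of "U \<inter> U'" U] by blast
  from *[OF T ne] *[OF T(2,1)] ne show ?thesis by (metis Int_commute)
qed

lemma mesh_interiors_disjoint:
  assumes "simplicial_mesh \<Omega> \<T>" "T \<in> \<T>" "T' \<in> \<T>" "x \<in> interior T" "x \<in> interior T'"
  shows "T = T'"
  using mesh_elements_eqI[OF assms(1-3)] assms(4,5) by auto

lemma mesh_interior_subset_domain:
  assumes "lipschitz_domain \<Omega>" "simplicial_mesh \<Omega> \<T>" "T \<in> \<T>"
  shows "interior T \<subseteq> \<Omega>"
  using interior_mono[of T "closure \<Omega>"] mesh_Union[OF assms(2)] assms(3)
    interior_closure_lipschitz_domain[OF assms(1)] by auto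

text \<open>Uniqueness: if two unit vectors \<open>m\<close> and \<open>n\<close> define the same half ball, a small multiple of \<open>m - n\<close>
  lies on the inner side for \<open>n\<close> but not for \<open>m\<close> unless \<open>m = n\<close>.\<close>

lemma outer_normal_eqI:
  assumes n: "norm n = 1" and r: "r > 0" "\<Omega> \<inter> ball x r = {y \<in> ball x r. (y - x) \<bullet> n < 0}"
  shows "outer_normal \<Omega> x = n"
  unfolding outer_normal_def
proof (rule the_equality)
  show "norm n = 1 \<and> (\<exists>r>0. \<Omega> \<inter> ball x r = {y \<in> ball x r. (y - x) \<bullet> n < 0})" using n r by blast
  fix m assume "norm m = 1 \<and> (\<exists>r>0. \<Omega> \<inter> ball x r = {y \<in> ball x r. (y - x) \<bullet> m < 0})"
  then obtain s where m: "norm m = 1" and s: "s > 0" "\<Omega> \<inter> ball x s = {y \<in> ball x s. (y - x) \<bullet> m < 0}"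
    by blast
  show "m = n"
  proof (rule ccontr)
    assume "m \<noteq> n"
    define w where "w = m - n"
    have w: "w \<noteq> 0" using \<open>m \<noteq> n\<close> by (simp add: w_def)
    define t where "t = min r s / 2 / norm w"
    have t: "t > 0" using r s w by (simp add: t_def)
    define y where "y = x + t *\<^sub>R w"
    have "norm (t *\<^sub>R w) = min r s / 2" using t w r s by (simp add: t_def)
    then have "dist x y = min r s / 2" by (simp add: y_def dist_norm)
    then have y: "y \<in> ball x r" "y \<in> ball x s" using r(1) s(1) by auto
    have "norm w ^ 2 = 2 - 2 * (m \<bullet> n)"
    proof -
      have "(norm w)\<^sup>2 = (norm m)\<^sup>2 + (norm n)\<^sup>2 - 2 * (m \<bullet> n)"
        unfolding w_def power2_norm_eq_inner inner_diff_left inner_diff_right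
        using inner_commute[of n m] by simp
      then show ?thesis using n m by simp
    qed
    then have mn: "m \<bullet> n < 1" using w by (smt (verit) zero_less_power zero_less_norm_iff)
    have "(y - x) \<bullet> n < 0 \<longleftrightarrow> (y - x) \<bullet> m < 0" using r(2) s(2) y by blast
    moreover have "(y - x) \<bullet> n < 0"
      using mn t n by (simp add: y_def w_def inner_diff_left dot_square_norm mult_less_0_iff)
    moreover have "\<not> (y - x) \<bullet> m < 0"
      using mn t m inner_commute[of m n]
      by (simp add: y_def w_def inner_diff_left dot_square_norm mult_less_0_iff)
    ultimately show False by blast
  qed
qed

text \<open>The facet \<open>S\<close> of \<open>T\<close> spans the hyperplane \<open>n \<bullet> y = b\<close>, and near every point of its relative
  interior \<open>T\<close> is the only element and the domain is the open half ball on which \<open>n \<bullet> y < b\<close>.\<close>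

definition boundary_chart ::
    "'a::euclidean_space set \<Rightarrow> 'a set set \<Rightarrow> 'a set \<Rightarrow> 'a set \<Rightarrow> 'a \<Rightarrow> real \<Rightarrow> bool" where
  "boundary_chart \<Omega> \<T> S T n b \<longleftrightarrow>
     T \<in> \<T> \<and> S face_of T \<and> norm n = 1 \<and> affine hull S = {y. n \<bullet> y = b} \<and>
     (\<forall>x\<in>rel_interior S. (\<forall>T'\<in>\<T>. x \<in> T' \<longrightarrow> T' = T) \<and>
        (\<exists>r>0. \<Omega> \<inter> ball x r = {y \<in> ball x r. n \<bullet> y < b} \<and> \<Omega> \<inter> ball x r \<subseteq> interior T))"

lemma boundary_chartD:
  assumes "boundary_chart \<Omega> \<T> S T n b"
  shows "T \<in> \<T>" "S face_of T" "norm n = 1" "affine hull S = {y. n \<bullet> y = b}"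
    "x \<in> rel_interior S \<Longrightarrow> T' \<in> \<T> \<Longrightarrow> x \<in> T' \<Longrightarrow> T' = T"
    "x \<in> rel_interior S \<Longrightarrow>
       \<exists>r>0. \<Omega> \<inter> ball x r = {y \<in> ball x r. n \<bullet> y < b} \<and> \<Omega> \<inter> ball x r \<subseteq> interior T"
  using assms unfolding boundary_chart_def by simp_all

text \<open>Let \<open>x\<close> be in the relative interior of \<open>S\<close>. Any element \<open>T'\<close> through \<open>x\<close> contains \<open>S\<close>, since it
  meets \<open>T\<close> in a face, and by full dimension it contains a half ball at \<open>x\<close> on one of the two sides.
  On the side of \<open>T\<close> this makes the interiors meet, so \<open>T' = T\<close>. On the other side a full ball around
  \<open>x\<close> would be contained in the closure of \<open>\<Omega>\<close>, whose interior is \<open>\<Omega>\<close>, whereas \<open>x\<close> is a boundary point.\<close>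

lemma boundary_chart_exists:
  fixes \<Omega> :: "'a::euclidean_space set"
  assumes \<Omega>: "lipschitz_domain \<Omega>" and M: "simplicial_mesh \<Omega> \<T>" and S: "S \<in> boundary_facets \<Omega> \<T>"
  obtains T n b where "boundary_chart \<Omega> \<T> S T n b"
proof -
  obtain T where T: "T \<in> \<T>" "S facet_of T" and SF: "S \<subseteq> frontier \<Omega>"
    using S by (auto simp: boundary_facets_def facets_def)
  note TT = mesh_element[OF M T(1)]
  have face: "S face_of T" and Sne: "S \<noteq> {}" and dS: "aff_dim S = int DIM('a) - 1"
    using T(2) TT(4) by (auto simp: facet_of_def)
  have ST: "S \<noteq> T" using dS TT(4) by auto
  have op: "open \<Omega>" using \<Omega> by (simp add: lipschitz_domain_def)
  have reg: "interior (closure \<Omega>) = \<Omega>" by (rule interior_closure_lipschitz_domain[OF \<Omega>])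
  have "S exposed_face_of T"
    using exposed_face_of_polyhedron[OF polytope_imp_polyhedron[OF TT(3)]] face by blast
  then obtain a c where a: "T \<subseteq> {x. a \<bullet> x \<le> c}" "S = T \<inter> {x. a \<bullet> x = c}"
    by (auto simp: exposed_face_of_def)
  have a0: "a \<noteq> 0" using a(2) Sne ST by auto
  define n where "n = (1 / norm a) *\<^sub>R a"
  define b where "b = c / norm a"
  have n1: "norm n = 1" using a0 by (simp add: n_def)
  then have n0: "n \<noteq> 0" by auto
  have le: "a \<bullet> x \<le> c \<longleftrightarrow> n \<bullet> x \<le> b" and eq: "a \<bullet> x = c \<longleftrightarrow> n \<bullet> x = b" for x
    using a0 by (auto simp: n_def b_def field_simps)
  have Tn: "T \<subseteq> {x. n \<bullet> x \<le> b}" "S = T \<inter> {x. n \<bullet> x = b}" using a by (auto simp: le eq)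
  obtain z where z: "z \<in> T" "n \<bullet> z < b" using Tn ST by force
  have aff: "affine hull S = {y. n \<bullet> y = b}"
  proof (rule affine_dim_equal)
    show "affine {y. n \<bullet> y = b}" by (rule affine_hyperplane)
    show "affine hull S \<subseteq> {y. n \<bullet> y = b}" by (rule hull_minimal) (use Tn affine_hyperplane in auto)
    show "aff_dim (affine hull S) = aff_dim {y. n \<bullet> y = b}" using n0 dS by simp
  qed (use Sne in auto)
  have int_half: "interior {x. n \<bullet> x \<le> b} = {x. n \<bullet> x < b}" using n0 by simp
  have half_T: "\<exists>r>0. \<forall>y\<in>ball x r. n \<bullet> y \<le> b \<longrightarrow> y \<in> T" if "x \<in> rel_interior S" for x
    by (rule half_ball_subset_convex[OF TT(1) face_of_imp_subset[OF face] aff that z])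
  have unique: "T' = T" if x: "x \<in> rel_interior S" and T': "T' \<in> \<T>" "x \<in> T'" for x T'
  proof -
    note TT' = mesh_element[OF M T'(1)]
    have xS: "x \<in> S" using x rel_interior_subset by blast
    have ST': "S \<subseteq> T'"
      using subset_of_face_of[OF mesh_Int_face[OF M T(1) T'(1)] face_of_imp_subset[OF face]]
        x xS T' face_of_imp_subset[OF face] by blast
    obtain r1 where r1: "r1 > 0" "\<And>y. y \<in> ball x r1 \<Longrightarrow> n \<bullet> y \<le> b \<Longrightarrow> y \<in> T"
      using half_T[OF x] by blast
    have "\<not> T' \<subseteq> {y. n \<bullet> y = b}"
      using aff_dim_subset[of T' "{y. n \<bullet> y = b}"] TT'(4) n0 by auto
    then obtain z' where z': "z' \<in> T'" "n \<bullet> z' \<noteq> b" by blast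
    have nx: "n \<bullet> x = b" using xS Tn by blast
    show ?thesis
    proof (cases "n \<bullet> z' < b")
      case True
      obtain r2 where r2: "r2 > 0" "\<And>y. y \<in> ball x r2 \<Longrightarrow> n \<bullet> y \<le> b \<Longrightarrow> y \<in> T'"
        using half_ball_subset_convex[OF TT'(1) ST' aff x z'(1) True] by blast
      define r where "r = min r1 r2"
      have r: "r > 0" using r1 r2 by (simp add: r_def)
      have "open (ball x r \<inter> {y. n \<bullet> y < b})" by (intro open_Int open_ball open_halfspace_lt)
      moreover have "ball x r \<inter> {y. n \<bullet> y < b} \<subseteq> T \<inter> T'"
        using r1(2) r2(2) by (auto simp: r_def)
      moreover have "x - (r / 2) *\<^sub>R n \<in> ball x r \<inter> {y. n \<bullet> y < b}"
        using r n1 nx by (auto simp: dist_norm inner_diff_right dot_square_norm)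
      ultimately have "interior (T \<inter> T') \<noteq> {}"
        using interior_maximal by blast
      then show ?thesis using mesh_elements_eqI[OF M T(1) T'(1)] by simp
    next
      case False
      then have z'b: "- n \<bullet> z' < - b" using z' by simp
      have aff': "affine hull S = {y. - n \<bullet> y = - b}" using aff by auto
      obtain r2 where r2: "r2 > 0" "\<And>y. y \<in> ball x r2 \<Longrightarrow> - n \<bullet> y \<le> - b \<Longrightarrow> y \<in> T'"
        using half_ball_subset_convex[OF TT'(1) ST' aff' x z'(1) z'b] by blast
      have "ball x (min r1 r2) \<subseteq> T \<union> T'"
      proof
        fix y assume "y \<in> ball x (min r1 r2)"
        then show "y \<in> T \<union> T'" using r1(2)[of y] r2(2)[of y] by (cases "n \<bullet> y \<le> b") auto
      qed
      also have "\<dots> \<subseteq> closure \<Omega>" using mesh_Union[OF M] T(1) T'(1) by blast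
      finally have "x \<in> interior (closure \<Omega>)" using r1(1) r2(1) by (auto simp: mem_interior intro!: exI[of _ "min r1 r2"])
      then have False using reg SF xS op by (auto simp: frontier_def interior_open)
      then show ?thesis ..
    qed
  qed
  have loc: "\<exists>r>0. \<Omega> \<inter> ball x r = {y \<in> ball x r. n \<bullet> y < b} \<and> \<Omega> \<inter> ball x r \<subseteq> interior T"
    if x: "x \<in> rel_interior S" for x
  proof -
    obtain r1 where r1: "r1 > 0" "\<And>y. y \<in> ball x r1 \<Longrightarrow> n \<bullet> y \<le> b \<Longrightarrow> y \<in> T"
      using half_T[OF x] by blast
    have "closed (\<Union>(\<T> - {T}))"
      using finite_mesh[OF M] mesh_element(6)[OF M] by (intro closed_Union) auto
    moreover have "x \<notin> \<Union>(\<T> - {T})" using unique[OF x] by blast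
    ultimately obtain r2 where r2: "r2 > 0" "ball x r2 \<subseteq> - \<Union>(\<T> - {T})"
      by (metis ComplI open_Compl open_contains_ball)
    define r where "r = min r1 r2"
    have r: "r > 0" using r1 r2 by (simp add: r_def)
    have inT: "\<Omega> \<inter> ball x r \<subseteq> interior T"
    proof (rule interior_maximal)
      show "\<Omega> \<inter> ball x r \<subseteq> T"
      proof
        fix y assume y: "y \<in> \<Omega> \<inter> ball x r"
        then obtain T' where "T' \<in> \<T>" "y \<in> T'" using mesh_Union[OF M] closure_subset[of \<Omega>] by blast
        moreover have "y \<notin> \<Union>(\<T> - {T})" using r2(2) y by (auto simp: r_def)
        ultimately show "y \<in> T" by blast
      qed
      show "open (\<Omega> \<inter> ball x r)" using op by blast
    qed
    have "{y \<in> ball x r. n \<bullet> y < b} \<subseteq> interior T"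
    proof (rule interior_maximal)
      show "{y \<in> ball x r. n \<bullet> y < b} \<subseteq> T" using r1(2) by (auto simp: r_def)
      have "open (ball x r \<inter> {y. n \<bullet> y < b})" by (intro open_Int open_ball open_halfspace_lt)
      then show "open {y \<in> ball x r. n \<bullet> y < b}" by (simp add: Int_def)
    qed
    moreover have "interior T \<subseteq> {y. n \<bullet> y < b}" using interior_mono[OF Tn(1)] int_half by simp
    moreover have "interior T \<subseteq> \<Omega>" by (rule mesh_interior_subset_domain[OF \<Omega> M T(1)])
    ultimately have "\<Omega> \<inter> ball x r = {y \<in> ball x r. n \<bullet> y < b}" using inT by blast
    then show ?thesis using r inT by blast
  qed
  show ?thesis
    by (rule that[of T n b]) (use T(1) face n1 aff unique loc in \<open>simp add: boundary_chart_def\<close>)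
qed

lemma boundary_facets_eqI:
  assumes \<Omega>: "lipschitz_domain \<Omega>" and M: "simplicial_mesh \<Omega> \<T>"
    and S: "S \<in> boundary_facets \<Omega> \<T>" "S' \<in> boundary_facets \<Omega> \<T>"
    and x: "x \<in> rel_interior S" "x \<in> rel_interior S'"
  shows "S = S'"
proof -
  obtain T n b where "boundary_chart \<Omega> \<T> S T n b" by (rule boundary_chart_exists[OF \<Omega> M S(1)])
  note T = boundary_chartD[OF this]
  obtain T' n' b' where "boundary_chart \<Omega> \<T> S' T' n' b'" by (rule boundary_chart_exists[OF \<Omega> M S(2)])
  note T' = boundary_chartD[OF this]
  have "T' = T" using T(5)[OF x(1) T'(1)] face_of_imp_subset[OF T'(2)] x(2) rel_interior_subset by blast
  then show ?thesis using face_of_eq[OF T(2), of S'] T'(2) x by blast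
qed

text \<open>On the hyperplane \<open>n \<bullet> y = b\<close> the normal component of \<open>a + c y\<close> is the constant \<open>a \<bullet> n + c b\<close>.\<close>

lemma normal_trace_boundary_facet:
  fixes \<Omega> :: "'a::euclidean_space set"
  assumes \<Omega>: "lipschitz_domain \<Omega>" and M: "simplicial_mesh \<Omega> \<T>" and S: "S \<in> boundary_facets \<Omega> \<T>"
  obtains T n b where "T \<in> \<T>"
    "\<And>v a c x. affine_on (interior T) v a c \<Longrightarrow> x \<in> rel_interior S \<Longrightarrow>
       normal_trace \<Omega> v x = a \<bullet> n + c * b"
proof -
  obtain T n b where "boundary_chart \<Omega> \<T> S T n b" by (rule boundary_chart_exists[OF \<Omega> M S])
  note T = boundary_chartD[OF this]
  have "normal_trace \<Omega> v x = a \<bullet> n + c * b"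
    if v: "affine_on (interior T) v a c" and x: "x \<in> rel_interior S" for v a c x
  proof -
    obtain r where r: "r > 0" "\<Omega> \<inter> ball x r = {y \<in> ball x r. n \<bullet> y < b}" "\<Omega> \<inter> ball x r \<subseteq> interior T"
      using T(6)[OF x] by blast
    have xS: "x \<in> S" using x rel_interior_subset by blast
    then have nx: "n \<bullet> x = b" using hull_inc[of x S affine] T(4) by blast
    have normal: "outer_normal \<Omega> x = n"
    proof (rule outer_normal_eqI[OF T(3) r(1)])
      show "\<Omega> \<inter> ball x r = {y \<in> ball x r. (y - x) \<bullet> n < 0}"
        unfolding r(2) using nx by (simp add: inner_diff_right inner_commute[of _ n])
    qed
    have "x \<in> frontier \<Omega>" using xS S by (auto simp: boundary_facets_def)
    then have "x islimpt \<Omega>"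
      using \<Omega> by (auto simp: lipschitz_domain_def frontier_def interior_open closure_def)
    then have nb: "at x within \<Omega> \<noteq> bot" by (simp add: trivial_limit_within)
    have "eventually (\<lambda>y. y \<in> ball x r) (at x within \<Omega>)"
      using r(1) by (auto simp: eventually_at dist_commute)
    moreover have "eventually (\<lambda>y. y \<in> \<Omega>) (at x within \<Omega>)" by (simp add: eventually_at_filter)
    ultimately have ev: "eventually (\<lambda>y. v y = a + c *\<^sub>R y) (at x within \<Omega>)"
      by eventually_elim (use v r(3) in \<open>unfold affine_on_def, blast\<close>)
    have "((\<lambda>y. a + c *\<^sub>R y) \<longlongrightarrow> a + c *\<^sub>R x) (at x within \<Omega>)"
      by (intro tendsto_intros)
    then have "(v \<longlongrightarrow> a + c *\<^sub>R x) (at x within \<Omega>)" using ev by (subst tendsto_cong) 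
    then have "boundary_value \<Omega> v x = a + c *\<^sub>R x"
      unfolding boundary_value_def by (rule tendsto_Lim[OF nb])
    then show ?thesis
      using normal nx by (simp add: normal_trace_def inner_add_left inner_commute[of x n])
  qed
  then show ?thesis using that[OF T(1)] by blast
qed

lemma finite_boundary_facets:
  assumes "simplicial_mesh \<Omega> \<T>"
  shows "finite (boundary_facets \<Omega> \<T>)"
proof (rule finite_subset)
  show "boundary_facets \<Omega> \<T> \<subseteq> (\<Union>T\<in>\<T>. {S. S facet_of T})"
    by (auto simp: boundary_facets_def facets_def)
  show "finite (\<Union>T\<in>\<T>. {S. S facet_of T})"
    using finite_mesh[OF assms] mesh_element(3)[OF assms] finite_polytope_facets by blast
qed

section \<open>Means and piecewise constant functions\<close>

text \<open>In a complete measure space every subset of the null set where \<open>f\<close> and \<open>g\<close> differ is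
  measurable.\<close>

lemma measurable_completion_cong_AE:
  assumes eq: "AE x in completion M. f x = g x" and f: "f \<in> borel_measurable (completion M)"
  shows "g \<in> borel_measurable (completion M)"
proof (rule borel_measurableI)
  fix S :: "'b set" assume S: "open S"
  have N: "{x \<in> space M. f x \<noteq> g x} \<in> null_sets (completion M)"
    using eq unfolding completion.AE_iff_null_sets by simp
  have sub: "A \<in> sets (completion M)" if "A \<subseteq> {x \<in> space M. f x \<noteq> g x}" for A
    using completion.complete2[OF that N] by blast
  have "g -` S \<inter> space (completion M) =
      (f -` S \<inter> space (completion M) - {x \<in> space M. f x \<noteq> g x}) \<union> (g -` S \<inter> {x \<in> space M. f x \<noteq> g x})"
    by auto
  moreover have "f -` S \<inter> space (completion M) \<in> sets (completion M)"
    using measurable_sets[OF f borel_open[OF S]] .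
  ultimately show "g -` S \<inter> space (completion M) \<in> sets (completion M)"
    using sub[OF subset_refl] sub[OF Int_lower2] by auto
qed

text \<open>Over a complete measure two functions that agree almost everywhere are both measurable or both
  not, and in the second case both integrals are zero by convention. The rule thus rewrites surface
  integrals against arbitrary boundary data.\<close>

lemma integral_cong_AE_completion:
  fixes f g :: "'a \<Rightarrow> 'b::{banach, second_countable_topology}"
  assumes eq: "AE x in completion M. x \<in> A \<longrightarrow> f x = g x" and A: "A \<inter> space M \<in> sets (completion M)"
  shows "(LINT x|restrict_space (completion M) A. f x) = (LINT x|restrict_space (completion M) A. g x)"
proof -
  define f' where "f' = (\<lambda>x. indicator A x *\<^sub>R f x)"
  define g' where "g' = (\<lambda>x. indicator A x *\<^sub>R g x)"
  have fg: "AE x in completion M. f' x = g' x"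
    using eq by eventually_elim (auto simp: f'_def g'_def indicator_def)
  then have gf: "AE x in completion M. g' x = f' x" by eventually_elim simp
  have "integral\<^sup>L (completion M) f' = integral\<^sup>L (completion M) g'"
  proof (cases "f' \<in> borel_measurable (completion M)")
    case True
    then show ?thesis using measurable_completion_cong_AE[OF fg True] fg by (intro integral_cong_AE)
  next
    case False
    then have "g' \<notin> borel_measurable (completion M)" using measurable_completion_cong_AE[OF gf] by blast
    then show ?thesis using False by (metis not_integrable_integral_eq borel_measurable_integrable)
  qed
  then show ?thesis using A by (simp add: integral_restrict_space f'_def g'_def)
qed

lemma integrable_cong_AE_completion:
  fixes f g :: "'a \<Rightarrow> 'b::{banach, second_countable_topology}"
  assumes eq: "AE x in completion M. x \<in> A \<longrightarrow> f x = g x" and A: "A \<inter> space M \<in> sets (completion M)"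
    and f: "integrable (restrict_space (completion M) A) f"
  shows "integrable (restrict_space (completion M) A) g"
proof -
  define f' where "f' = (\<lambda>x. indicator A x *\<^sub>R f x)"
  define g' where "g' = (\<lambda>x. indicator A x *\<^sub>R g x)"
  have f': "integrable (completion M) f'" using f A by (simp add: integrable_restrict_space f'_def)
  have fg: "AE x in completion M. f' x = g' x"
    using eq by eventually_elim (auto simp: f'_def g'_def indicator_def)
  have "integrable (completion M) g'"
    using f' fg measurable_completion_cong_AE[OF fg borel_measurable_integrable[OF f']]
    by (subst integrable_cong_AE[of _ _ f']) (auto intro: AE_symmetric)
  then show ?thesis using A by (simp add: integrable_restrict_space g'_def)
qed

lemma L2_proj_const_eq_mean:
  fixes g :: "'a \<Rightarrow> 'b::euclidean_space"
  assumes M: "finite_measure M" and pos: "0 < measure M (space M)" and g: "integrable M g"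
  shows "L2_proj_const M g = (1 / measure M (space M)) *\<^sub>R (LINT x|M. g x)"
proof -
  interpret finite_measure M by (rule M)
  have *: "(LINT x|M. (g x - c) \<bullet> a) = ((LINT x|M. g x) - measure M (space M) *\<^sub>R c) \<bullet> a" for c a
    using g by (simp add: integral_inner_left)
  show ?thesis
    unfolding L2_proj_const_def
  proof (rule the_equality)
    show "\<forall>a. (LINT x|M. (g x - (1 / measure M (space M)) *\<^sub>R (LINT x|M. g x)) \<bullet> a) = 0"
      unfolding * using pos by simp
    fix c assume "\<forall>a. (LINT x|M. (g x - c) \<bullet> a) = 0"
    then have "\<forall>a. ((LINT x|M. g x) - measure M (space M) *\<^sub>R c) \<bullet> a = 0" unfolding * .
    then have "(LINT x|M. g x) - measure M (space M) *\<^sub>R c = 0"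
      using inner_eq_zero_iff by blast
    then have "(LINT x|M. g x) = measure M (space M) *\<^sub>R c" by simp
    then show "c = (1 / measure M (space M)) *\<^sub>R (LINT x|M. g x)" using pos by simp
  qed
qed

lemma integral_piecewise_constant:
  fixes g :: "'a::euclidean_space \<Rightarrow> real"
  assumes fin: "finite \<T>" and A: "A \<in> sets lebesgue"
    and int: "\<And>T. T \<in> \<T> \<Longrightarrow> bounded T" "\<And>T. T \<in> \<T> \<Longrightarrow> interior T \<subseteq> A"
    and disj: "\<And>T T' x. T \<in> \<T> \<Longrightarrow> T' \<in> \<T> \<Longrightarrow> x \<in> interior T \<Longrightarrow> x \<in> interior T' \<Longrightarrow> T = T'"
    and cover: "AE x in lebesgue. x \<in> A \<longrightarrow> (\<exists>T\<in>\<T>. x \<in> interior T)"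
    and g: "\<And>T. T \<in> \<T> \<Longrightarrow> AE x in lebesgue. x \<in> interior T \<longrightarrow> g x = c T"
  shows "(LINT x|lebesgue_on A. g x) = (\<Sum>T\<in>\<T>. measure lebesgue (interior T) * c T)"
proof -
  define s where "s = (\<lambda>x. \<Sum>T\<in>\<T>. indicator (interior T) x * c T)"
  have "AE x in lebesgue. \<forall>T\<in>\<T>. x \<in> interior T \<longrightarrow> g x = c T"
    using g by (intro AE_finite_allI[OF fin]) auto
  then have eq: "AE x in lebesgue. x \<in> A \<longrightarrow> s x = g x"
    using cover
  proof eventually_elim
    case (elim x)
    show ?case
    proof
      assume "x \<in> A"
      then obtain T where T: "T \<in> \<T>" "x \<in> interior T" using elim by blast
      have "s x = (\<Sum>U\<in>{T}. indicator (interior U) x * c U)"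
        unfolding s_def using fin T disj by (intro sum.mono_neutral_right) (auto simp: indicator_def)
      then show "s x = g x" using T elim by simp
    qed
  qed
  have int1: "integrable lebesgue (\<lambda>x. indicator (interior T) x * c T)" if "T \<in> \<T>" for T
  proof -
    have "interior T \<in> lmeasurable"
      using int(1)[OF that] by (intro lmeasurable_open bounded_interior) auto
    then show ?thesis by (intro integrable_mult_left) (auto simp: fmeasurable_def)
  qed
  have sA: "indicator A x *\<^sub>R s x = s x" for x
    using int(2)[THEN subsetD] by (auto simp: s_def indicator_def intro!: sum.neutral)
  have A': "A \<inter> space lebesgue \<in> sets lebesgue" using A by simp
  have "(LINT x|lebesgue_on A. g x) = (LINT x|lebesgue_on A. s x)"
    using integral_cong_AE_completion[OF eq] A by simp
  also have "\<dots> = (LINT x|lebesgue. s x)" by (simp only: integral_restrict_space[OF A'] sA)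
  also have "\<dots> = (\<Sum>T\<in>\<T>. LINT x|lebesgue. indicator (interior T) x * c T)"
    unfolding s_def using int1 by (intro Bochner_Integration.integral_sum) auto
  also have "\<dots> = (\<Sum>T\<in>\<T>. measure lebesgue (interior T) * c T)" by simp
  finally show "(LINT x|lebesgue_on A. g x) = (\<Sum>T\<in>\<T>. measure lebesgue (interior T) * c T)" .
qed

lemma AE_interior_convex:
  fixes T :: "'a::euclidean_space set"
  assumes "convex T"
  shows "AE x in lebesgue. x \<in> T \<longrightarrow> x \<in> interior T"
proof -
  have "frontier T \<in> null_sets lebesgue"
    using negligible_convex_frontier[OF assms] negligible_iff_null_sets by blast
  then have "AE x in lebesgue. x \<notin> frontier T" by (rule AE_not_in)
  then show ?thesis by eventually_elim (use closure_subset in \<open>auto simp: frontier_def\<close>)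
qed

section \<open>Surface measure of a flat facet\<close>

text \<open>The prism and the projection in the definition of the surface measure, by which that measure is
  traced back to Lebesgue measure of a convex body.\<close>

definition facet_prism :: "'a::euclidean_space set \<Rightarrow> 'a set" where
  "facet_prism S = {x + t *\<^sub>R hyperplane_normal S | x t. x \<in> S \<and> 0 \<le> t \<and> t \<le> 1}"

definition facet_projection :: "'a::euclidean_space set \<Rightarrow> 'a \<Rightarrow> 'a" where
  "facet_projection S y = y - ((y - (SOME p. p \<in> S)) \<bullet> hyperplane_normal S) *\<^sub>R hyperplane_normal S"

lemma facet_measure_eq:
  "facet_measure S =
     completion (distr (restrict_space lborel (facet_prism S)) borel (facet_projection S))"
  by (simp add: facet_measure_def Let_def facet_prism_def facet_projection_def[abs_def])

text \<open>The facet spans a hyperplane. The vector \<open>n\<close> need not be the normal \<open>\<nu>\<close> that the surface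
  measure selects; it only guarantees that a normal exists.\<close>

locale flat_facet =
  fixes S :: "'a::euclidean_space set" and n :: 'a and b :: real
  assumes cvx: "convex S" and cpt: "compact S" and ne: "S \<noteq> {}"
    and n0: "n \<noteq> 0" and hull: "affine hull S = {y. n \<bullet> y = b}"
begin

abbreviation \<nu> where "\<nu> \<equiv> hyperplane_normal S"
abbreviation p where "p \<equiv> (SOME p. p \<in> S)"

lemma normal: "norm \<nu> = 1" "\<And>x y. x \<in> S \<Longrightarrow> y \<in> S \<Longrightarrow> (x - y) \<bullet> \<nu> = 0"
proof -
  have "(x - y) \<bullet> ((1 / norm n) *\<^sub>R n) = 0" if "x \<in> S" "y \<in> S" for x y
  proof -
    have "n \<bullet> x = b" "n \<bullet> y = b" using that hull hull_inc[of _ S affine] by blast+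
    then show ?thesis by (simp add: inner_diff_left inner_diff_right inner_commute[of _ n])
  qed
  then have "\<exists>\<nu>. norm \<nu> = 1 \<and> (\<forall>x\<in>S. \<forall>y\<in>S. (x - y) \<bullet> \<nu> = 0)"
    using n0 by (intro exI[of _ "(1 / norm n) *\<^sub>R n"]) auto
  from someI_ex[OF this] show "norm \<nu> = 1" "\<And>x y. x \<in> S \<Longrightarrow> y \<in> S \<Longrightarrow> (x - y) \<bullet> \<nu> = 0"
    by (auto simp: hyperplane_normal_def)
qed

lemma normal_unit: "\<nu> \<bullet> \<nu> = 1" using normal(1) by (simp add: dot_square_norm)

lemma base_point: "p \<in> S" using ne by (simp add: some_in_eq)

lemma hull_normal: "affine hull S = {w. \<nu> \<bullet> w = \<nu> \<bullet> p}"
proof (rule affine_dim_equal)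
  have "S \<subseteq> {w. \<nu> \<bullet> w = \<nu> \<bullet> p}"
    using normal(2)[OF _ base_point] by (auto simp: inner_diff_left inner_diff_right inner_commute[of _ \<nu>])
  then show "affine hull S \<subseteq> {w. \<nu> \<bullet> w = \<nu> \<bullet> p}" by (intro hull_minimal affine_hyperplane)
  have "aff_dim (affine hull S) = aff_dim {y. n \<bullet> y = b}" using hull by metis
  moreover have "\<nu> \<noteq> 0" using normal(1) by auto
  ultimately show "aff_dim (affine hull S) = aff_dim {w. \<nu> \<bullet> w = \<nu> \<bullet> p}" using n0 by simp
qed (use ne affine_hyperplane in auto)

lemma projection_prism: "x \<in> S \<Longrightarrow> facet_projection S (x + t *\<^sub>R \<nu>) = x"
  using normal(2)[OF _ base_point, of x] normal_unit
  by (simp add: facet_projection_def algebra_simps inner_diff_left inner_add_left)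

lemma prism_image: "facet_prism S = (\<lambda>(x, t). x + t *\<^sub>R \<nu>) ` (S \<times> {0..1})"
  by (force simp: facet_prism_def)

lemma prism_compact: "compact (facet_prism S)"
  unfolding prism_image
  by (intro compact_continuous_image compact_Times cpt) (auto intro!: continuous_intros simp: case_prod_beta)

lemma prism_convex: "convex (facet_prism S)"
  unfolding prism_image
proof (rule convex_linear_image)
  show "linear (\<lambda>(x, t). x + t *\<^sub>R \<nu>)"
    by (rule linearI) (auto simp: algebra_simps)
qed (intro convex_Times cvx convex_real_interval)

lemma prism_borel: "facet_prism S \<in> sets borel"
  using prism_compact by (simp add: borel_compact)

lemma projection_continuous: "continuous_on UNIV (facet_projection S)"
  unfolding facet_projection_def[abs_def] by (intro continuous_intros)

lemma projection_measurable:
  "facet_projection S \<in> measurable (restrict_space lborel (facet_prism S)) borel"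
  using borel_measurable_continuous_onI[OF projection_continuous]
  by (intro measurable_restrict_space1) simp

lemma emeasure_facet:
  assumes "G \<in> sets borel"
  shows "emeasure (facet_measure S) G = emeasure lborel (facet_projection S -` G \<inter> facet_prism S)"
proof -
  have v: "facet_projection S -` G \<in> sets borel"
    using measurable_sets[OF borel_measurable_continuous_onI[OF projection_continuous] assms] by simp
  show ?thesis
    unfolding facet_measure_eq
    using assms prism_borel v
    by (simp add: emeasure_distr[OF projection_measurable] emeasure_restrict_space)
qed

lemma finite_facet_measure: "finite_measure (facet_measure S)"
proof (rule finite_measureI)
  have "space (facet_measure S) = UNIV" by (simp add: facet_measure_eq)
  moreover have "emeasure lborel (facet_prism S) < \<infinity>"
    using emeasure_bounded_finite[OF compact_imp_bounded[OF prism_compact]] .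
  ultimately show "emeasure (facet_measure S) (space (facet_measure S)) \<noteq> \<infinity>"
    using emeasure_facet[of UNIV] by simp
qed

lemma rel_interior_borel: "rel_interior S \<in> sets borel"
proof -
  obtain U where "open U" "rel_interior S = affine hull S \<inter> U"
    using openin_rel_interior[of S] by (auto simp: openin_open)
  then show ?thesis by auto
qed

text \<open>An interior point of the prism projects into the relative interior of \<open>S\<close>, because moving it
  parallel to the hyperplane stays in the prism for a while. The frontier of the prism is null, since
  the prism is convex.\<close>

lemma AE_rel_interior: "AE x in facet_measure S. x \<in> rel_interior S"
proof -
  have int: "facet_projection S y \<in> rel_interior S" if y: "y \<in> interior (facet_prism S)" for y
  proof -
    obtain r where r: "r > 0" "ball y r \<subseteq> facet_prism S" using y by (auto simp: mem_interior)
    have proj_in: "facet_projection S z \<in> S" if "z \<in> facet_prism S" for z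
      using that projection_prism by (auto simp: facet_prism_def)
    have "ball (facet_projection S y) r \<inter> affine hull S \<subseteq> S"
    proof
      fix z assume z: "z \<in> ball (facet_projection S y) r \<inter> affine hull S"
      define z' where "z' = y + (z - facet_projection S y)"
      have yS: "facet_projection S y \<in> S" using y interior_subset proj_in by blast
      then have "facet_projection S y \<in> affine hull S" by (rule hull_inc)
      then have "(z - facet_projection S y) \<bullet> \<nu> = 0"
        using z by (simp add: hull_normal inner_diff_left inner_diff_right inner_commute[of _ \<nu>])
      then have "(z' - p) \<bullet> \<nu> = (y - p) \<bullet> \<nu>"
        by (simp add: z'_def inner_diff_left inner_add_left)
      then have "facet_projection S z' = z' - ((y - p) \<bullet> \<nu>) *\<^sub>R \<nu>"
        by (simp add: facet_projection_def)
      also have "\<dots> = z" by (simp add: z'_def facet_projection_def[of S y])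
      finally have "facet_projection S z' = z" .
      moreover have "z' \<in> ball y r" using z by (simp add: z'_def dist_norm norm_minus_commute)
      ultimately show "z \<in> S" using r(2) proj_in by force
    qed
    moreover have "facet_projection S y \<in> S" using y interior_subset proj_in by blast
    ultimately show ?thesis using r(1) by (auto simp: mem_rel_interior_ball)
  qed
  have "AE y in lborel. y \<in> facet_prism S \<longrightarrow> y \<in> interior (facet_prism S)"
    using AE_interior_convex[OF prism_convex] AE_completion_iff by blast
  then have "AE y in restrict_space lborel (facet_prism S). facet_projection S y \<in> rel_interior S"
    using prism_borel int by (subst AE_restrict_space_iff) (auto elim!: eventually_mono)
  then have "AE x in distr (restrict_space lborel (facet_prism S)) borel (facet_projection S). x \<in> rel_interior S"
    using rel_interior_borel by (subst AE_distr_iff[OF projection_measurable]) auto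
  then show ?thesis unfolding facet_measure_eq by (rule AE_completion)
qed

text \<open>The part of the prism above a relatively open piece of \<open>S\<close> contains a nonempty open set.\<close>

lemma measure_facet_pos:
  assumes G: "G \<in> sets borel" and x: "x \<in> rel_interior S" and r: "r > 0" "ball x r \<inter> S \<subseteq> G"
  shows "0 < measure (facet_measure S) G"
proof -
  interpret finite_measure "facet_measure S" by (rule finite_facet_measure)
  obtain e where e: "e > 0" "ball x e \<inter> affine hull S \<subseteq> S" and xS: "x \<in> S"
    using x by (auto simp: mem_rel_interior_ball)
  define U where "U = {y. dist (facet_projection S y) x < min r e} \<inter> {y. 0 < (y - p) \<bullet> \<nu>} \<inter> {y. (y - p) \<bullet> \<nu> < 1}"
  have "open U" unfolding U_def
    using projection_continuous by (intro open_Int open_Collect_less continuous_intros) auto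
  moreover have "x + (1/2) *\<^sub>R \<nu> \<in> U"
    using projection_prism[OF xS, of "1/2"] normal(2)[OF xS base_point] normal_unit r(1) e(1)
    by (simp add: U_def inner_add_left inner_diff_left)
  ultimately have "\<not> negligible U" using open_not_negligible by blast
  then have nn: "U \<notin> null_sets lborel"
    using null_sets_completionI negligible_iff_null_sets by blast
  have sub: "U \<subseteq> facet_projection S -` G \<inter> facet_prism S"
  proof
    fix y assume y: "y \<in> U"
    define z where "z = facet_projection S y"
    have "\<nu> \<bullet> z = \<nu> \<bullet> p"
      using normal_unit inner_commute[of "y - p" \<nu>]
      by (simp add: z_def facet_projection_def inner_diff_right)
    then have "z \<in> affine hull S" by (simp add: hull_normal)
    moreover have "z \<in> ball x (min r e)" using y by (simp add: U_def z_def dist_commute)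
    ultimately have zS: "z \<in> S" using e(2) by auto
    then have "z \<in> G" using r(2) \<open>z \<in> ball x (min r e)\<close> by auto
    moreover have "y = z + ((y - p) \<bullet> \<nu>) *\<^sub>R \<nu>" by (simp add: z_def facet_projection_def)
    then have "y \<in> facet_prism S"
      unfolding facet_prism_def using zS y by (auto simp: U_def intro!: exI[of _ z] exI[of _ "(y - p) \<bullet> \<nu>"])
    ultimately show "y \<in> facet_projection S -` G \<inter> facet_prism S" by (simp add: z_def)
  qed
  have "facet_projection S -` G \<in> sets borel"
    using measurable_sets[OF borel_measurable_continuous_onI[OF projection_continuous] G] by simp
  then have "emeasure lborel U \<le> emeasure (facet_measure S) G"
    unfolding emeasure_facet[OF G] using prism_borel by (intro emeasure_mono[OF sub]) auto
  moreover have "emeasure lborel U \<noteq> 0" using nn \<open>open U\<close> by (auto simp: null_sets_def)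
  ultimately have "emeasure (facet_measure S) G \<noteq> 0" by (metis le_zero_eq)
  then show ?thesis
    by (simp add: emeasure_eq_measure zero_less_measure_iff)
qed

end

section \<open>Raviart--Thomas functions on a meshed domain\<close>

lemma square_integrable_lin_comb:
  fixes u v :: "'a \<Rightarrow> 'b::euclidean_space"
  assumes u: "square_integrable M u" and v: "square_integrable M v"
  shows "square_integrable M (lin_comb s u t v)"
  unfolding square_integrable_def lin_comb_def
proof
  have um: "u \<in> borel_measurable M" and vm: "v \<in> borel_measurable M"
    using u v by (auto simp: square_integrable_def)
  then show m: "(\<lambda>x. s *\<^sub>R u x + t *\<^sub>R v x) \<in> borel_measurable M" by auto
  show "integrable M (\<lambda>x. (norm (s *\<^sub>R u x + t *\<^sub>R v x))\<^sup>2)"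
  proof (rule Bochner_Integration.integrable_bound)
    show "integrable M (\<lambda>x. 2 * s\<^sup>2 * (norm (u x))\<^sup>2 + 2 * t\<^sup>2 * (norm (v x))\<^sup>2)"
      using u v by (auto simp: square_integrable_def)
    show "(\<lambda>x. (norm (s *\<^sub>R u x + t *\<^sub>R v x))\<^sup>2) \<in> borel_measurable M" using m by measurable
    have "norm ((norm (s *\<^sub>R u x + t *\<^sub>R v x))\<^sup>2)
        \<le> norm (2 * s\<^sup>2 * (norm (u x))\<^sup>2 + 2 * t\<^sup>2 * (norm (v x))\<^sup>2)" for x
    proof -
      have "(norm (s *\<^sub>R u x + t *\<^sub>R v x))\<^sup>2 \<le> (\<bar>s\<bar> * norm (u x) + \<bar>t\<bar> * norm (v x))\<^sup>2"
        using norm_triangle_ineq[of "s *\<^sub>R u x" "t *\<^sub>R v x"] by (intro power_mono) auto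
      also have "\<dots> \<le> 2 * s\<^sup>2 * (norm (u x))\<^sup>2 + 2 * t\<^sup>2 * (norm (v x))\<^sup>2"
      proof -
        have *: "(p + q)\<^sup>2 \<le> 2 * p\<^sup>2 + 2 * q\<^sup>2" for p q :: real
          using zero_le_power2[of "p - q"] by (simp add: power2_sum power2_diff)
        show ?thesis using *[of "\<bar>s\<bar> * norm (u x)" "\<bar>t\<bar> * norm (v x)"]
          by (simp add: power_mult_distrib)
      qed
      finally show ?thesis by simp
    qed
    then show "AE x in M. norm ((norm (s *\<^sub>R u x + t *\<^sub>R v x))\<^sup>2)
        \<le> norm (2 * s\<^sup>2 * (norm (u x))\<^sup>2 + 2 * t\<^sup>2 * (norm (v x))\<^sup>2)" by simp
  qed
qed

lemma square_integrable_imp_integrable: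
  fixes u :: "'a \<Rightarrow> 'b::euclidean_space"
  assumes M: "finite_measure M" and u: "square_integrable M u"
  shows "integrable M u"
proof (rule Bochner_Integration.integrable_bound)
  interpret finite_measure M by (rule M)
  show "integrable M (\<lambda>x. 1 + (norm (u x))\<^sup>2)" using u by (auto simp: square_integrable_def)
  have *: "r \<le> 1 + r\<^sup>2" if "0 \<le> r" for r :: real
  proof -
    have "2 * r \<le> 1 + r\<^sup>2" using zero_le_power2[of "r - 1"] by (simp add: power2_diff)
    then show ?thesis using that by linarith
  qed
  have "norm (u x) \<le> norm (1 + (norm (u x))\<^sup>2)" for x
    using *[OF norm_ge_zero[of "u x"]] by simp
  then show "AE x in M. norm (u x) \<le> norm (1 + (norm (u x))\<^sup>2)" by simp
qed (use u in \<open>auto simp: square_integrable_def\<close>)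

lemma test_functionD:
  assumes "test_function \<Omega> \<phi> D"
  shows "C1_with_gradient \<phi> D" "\<exists>R. \<forall>x. R < norm x \<longrightarrow> \<phi> x = 0"
    "\<And>x. x \<notin> \<Omega> \<Longrightarrow> \<phi> x = 0" "\<And>x. x \<notin> \<Omega> \<Longrightarrow> D x = 0"
    "\<exists>B. \<forall>x. \<bar>\<phi> x\<bar> \<le> B \<and> norm (D x) \<le> B"
proof -
  define K where "K = closure {x. \<phi> x \<noteq> 0}"
  have K: "compact K" "K \<subseteq> \<Omega>" and C1: "C1_with_gradient \<phi> D"
    using assms by (auto simp: test_function_def K_def)
  show "C1_with_gradient \<phi> D" by (rule C1)
  have \<phi>0: "\<phi> x = 0" if "x \<notin> K" for x using that closure_subset[of "{x. \<phi> x \<noteq> 0}"] unfolding K_def by blast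
  have D0: "D x = 0" if "x \<notin> K" for x
    by (rule gradient_vanishes[OF C1_with_gradientD(1)[OF C1], of "- K"])
      (use K that \<phi>0 in \<open>auto simp: compact_imp_closed open_Compl\<close>)
  show "\<And>x. x \<notin> \<Omega> \<Longrightarrow> \<phi> x = 0" "\<And>x. x \<notin> \<Omega> \<Longrightarrow> D x = 0" using \<phi>0 D0 K(2) by auto
  obtain R where "\<And>x. x \<in> K \<Longrightarrow> norm x \<le> R"
    using compact_imp_bounded[OF K(1)] by (auto simp: bounded_iff)
  then have "\<forall>x. R < norm x \<longrightarrow> \<phi> x = 0" using \<phi>0 by (meson not_less)
  then show "\<exists>R. \<forall>x. R < norm x \<longrightarrow> \<phi> x = 0" by blast
  have "bounded (\<phi> ` K)" "bounded (D ` K)"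
    using K(1) C1_with_gradientD(3,4)[OF C1]
    by (auto intro!: compact_imp_bounded compact_continuous_image intro: continuous_on_subset)
  then obtain B1 B2 where "\<And>x. x \<in> K \<Longrightarrow> \<bar>\<phi> x\<bar> \<le> B1" "\<And>x. x \<in> K \<Longrightarrow> norm (D x) \<le> B2"
    by (auto simp: bounded_iff)
  then have "\<bar>\<phi> x\<bar> \<le> max 0 (max B1 B2) \<and> norm (D x) \<le> max 0 (max B1 B2)" for x
    using \<phi>0[of x] D0[of x] by (cases "x \<in> K") (auto simp: le_max_iff_disj)
  then show "\<exists>B. \<forall>x. \<bar>\<phi> x\<bar> \<le> B \<and> norm (D x) \<le> B" by blast
qed

lemma test_function_mono: "test_function U \<phi> D \<Longrightarrow> U \<subseteq> V \<Longrightarrow> test_function V \<phi> D"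
  by (auto simp: test_function_def)

lemma test_function_measurable:
  assumes "test_function \<Omega> \<phi> D"
  shows "\<phi> \<in> borel_measurable (lebesgue_on A)" "D \<in> borel_measurable (lebesgue_on A)"
proof -
  have "\<phi> \<in> borel_measurable borel" "D \<in> borel_measurable borel"
    using C1_with_gradientD(3,4)[OF test_functionD(1)[OF assms]] borel_measurable_continuous_onI by blast+
  then show "\<phi> \<in> borel_measurable (lebesgue_on A)" "D \<in> borel_measurable (lebesgue_on A)"
    by (auto intro!: measurable_restrict_space1 measurable_completion)
qed

lemma integrable_test_function:
  fixes v :: "'a::euclidean_space \<Rightarrow> 'a"
  assumes \<phi>: "test_function \<Omega> \<phi> D"
  shows "integrable (lebesgue_on A) v \<Longrightarrow> integrable (lebesgue_on A) (\<lambda>x. v x \<bullet> D x)"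
    and "integrable (lebesgue_on A) g \<Longrightarrow> integrable (lebesgue_on A) (\<lambda>x. g x * \<phi> x)"
proof -
  obtain B where B: "\<And>x. \<bar>\<phi> x\<bar> \<le> B" "\<And>x. norm (D x) \<le> B" using test_functionD(5)[OF \<phi>] by blast
  have B0: "0 \<le> B" using B(2) norm_ge_zero order_trans by blast
  note m = test_function_measurable[OF \<phi>, of A]
  show "integrable (lebesgue_on A) (\<lambda>x. v x \<bullet> D x)" if v: "integrable (lebesgue_on A) v"
  proof (rule Bochner_Integration.integrable_bound)
    show "integrable (lebesgue_on A) (\<lambda>x. norm (v x) * B)" using v by simp
    show "(\<lambda>x. v x \<bullet> D x) \<in> borel_measurable (lebesgue_on A)" using v m by auto
    have "norm (v x \<bullet> D x) \<le> norm (norm (v x) * B)" for x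
      using Cauchy_Schwarz_ineq2[of "v x" "D x"] mult_left_mono[OF B(2)[of x] norm_ge_zero[of "v x"]] B0
      by (simp add: abs_mult)
    then show "AE x in lebesgue_on A. norm (v x \<bullet> D x) \<le> norm (norm (v x) * B)" by simp
  qed
  show "integrable (lebesgue_on A) (\<lambda>x. g x * \<phi> x)" if g: "integrable (lebesgue_on A) g"
  proof (rule Bochner_Integration.integrable_bound)
    show "integrable (lebesgue_on A) (\<lambda>x. \<bar>g x\<bar> * B)" using g by simp
    show "(\<lambda>x. g x * \<phi> x) \<in> borel_measurable (lebesgue_on A)" using g m by auto
    have "norm (g x * \<phi> x) \<le> norm (\<bar>g x\<bar> * B)" for x
      using mult_left_mono[OF B(1)[of x] abs_ge_zero[of "g x"]] B0 by (simp add: abs_mult)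
    then show "AE x in lebesgue_on A. norm (g x * \<phi> x) \<le> norm (\<bar>g x\<bar> * B)" by simp
  qed
qed

locale meshed_domain =
  fixes \<Omega> :: "'a::euclidean_space set" and \<T> :: "'a set set"
  assumes lipschitz: "lipschitz_domain \<Omega>" and bounded_domain: "bounded \<Omega>"
    and mesh: "simplicial_mesh \<Omega> \<T>"
begin

lemma open_domain: "open \<Omega>" using lipschitz by (simp add: lipschitz_domain_def)

lemma domain_lebesgue [simp]: "\<Omega> \<in> sets lebesgue" using open_domain by auto

lemma finite_measure_domain: "finite_measure (lebesgue_on \<Omega>)"
  by (intro finite_measure_lebesgue_on lmeasurable_open bounded_domain open_domain)

lemma interior_subset_domain: "T \<in> \<T> \<Longrightarrow> interior T \<subseteq> \<Omega>"
  by (rule mesh_interior_subset_domain[OF lipschitz mesh])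

lemmas element = mesh_element[OF mesh]
lemmas finite_elements = finite_mesh[OF mesh]
lemmas interiors_disjoint = mesh_interiors_disjoint[OF mesh]

lemma AE_mesh_interior: "AE x in lebesgue. x \<in> \<Omega> \<longrightarrow> (\<exists>T\<in>\<T>. x \<in> interior T)"
proof -
  have "AE x in lebesgue. \<forall>T\<in>\<T>. x \<in> T \<longrightarrow> x \<in> interior T"
    using AE_interior_convex[OF element(1)] by (intro AE_finite_allI[OF finite_elements])
  then show ?thesis
    by eventually_elim (use mesh_Union[OF mesh] closure_subset[of \<Omega>] in blast)
qed

lemma element_lmeasurable: "T \<in> \<T> \<Longrightarrow> T \<in> lmeasurable"
  using element(2) lmeasurable_compact by blast

lemma finite_measure_element: "T \<in> \<T> \<Longrightarrow> finite_measure (lebesgue_on T)"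
  by (intro finite_measure_lebesgue_on element_lmeasurable)

definition volume :: "'a set \<Rightarrow> real" where "volume T = measure lebesgue (interior T)"

lemma volume_pos:
  assumes "T \<in> \<T>"
  shows "0 < volume T"
proof -
  have "\<not> negligible (interior T)" by (rule open_not_negligible) (use element(5)[OF assms] in auto)
  moreover have m: "interior T \<in> lmeasurable"
    using element(7)[OF assms] by (intro lmeasurable_open bounded_interior) auto
  ultimately show ?thesis
    unfolding volume_def using negligible_iff_measure[of "interior T"] by (simp add: zero_less_measure_iff)
qed

lemma measure_element_pos:
  assumes "T \<in> \<T>"
  shows "0 < measure (lebesgue_on T) (space (lebesgue_on T))"
proof -
  have "volume T \<le> measure lebesgue T"
    unfolding volume_def using element_lmeasurable[OF assms]
    by (intro measure_mono_fmeasurable interior_subset) auto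
  then show ?thesis
    using volume_pos[OF assms] element_lmeasurable[OF assms] by (simp add: measure_restrict_space fmeasurableD)
qed

lemma integral_elementwise:
  assumes "\<And>T. T \<in> \<T> \<Longrightarrow> AE x in lebesgue. x \<in> interior T \<longrightarrow> g x = c T"
  shows "(LINT x|lebesgue_on \<Omega>. g x) = (\<Sum>T\<in>\<T>. volume T * c T)"
  unfolding volume_def
  by (rule integral_piecewise_constant[OF finite_elements domain_lebesgue element(7)
        interior_subset_domain interiors_disjoint AE_mesh_interior assms])

lemma elem_proj_eq:
  assumes "T \<in> \<T>" "x \<in> interior T"
  shows "elem_proj \<T> g x = L2_proj_const (lebesgue_on T) g"
proof -
  have "(THE T. T \<in> \<T> \<and> x \<in> interior T) = T"
    by (rule the_equality) (use assms interiors_disjoint in blast)+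
  then show ?thesis by (simp add: elem_proj_def)
qed

lemma AE_on_element:
  assumes "T \<in> \<T>" "AE x in lebesgue. x \<in> interior T \<longrightarrow> P x"
  shows "AE x in lebesgue. x \<in> T \<longrightarrow> P x"
  using AE_interior_convex[OF element(1)[OF assms(1)]] assms(2) by eventually_elim blast

text \<open>The function \<open>h\<close> represents \<open>g\<close> up to a null set of \<open>T\<close>; discrete functions are only known in
  the interior of an element.\<close>

lemma proj_cong:
  fixes g h :: "'a \<Rightarrow> 'b::euclidean_space"
  assumes T: "T \<in> \<T>" and eq: "AE x in lebesgue. x \<in> interior T \<longrightarrow> g x = h x"
    and h: "integrable (lebesgue_on T) h"
  shows "L2_proj_const (lebesgue_on T) g
      = (1 / measure (lebesgue_on T) (space (lebesgue_on T))) *\<^sub>R (LINT x|lebesgue_on T. h x)"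
proof -
  note pr = L2_proj_const_eq_mean[OF finite_measure_element[OF T] measure_element_pos[OF T]]
  have Tm: "T \<inter> space lborel \<in> sets lebesgue" using element_lmeasurable[OF T] by (simp add: fmeasurableD)
  have eq': "AE x in lebesgue. x \<in> T \<longrightarrow> h x = g x"
    using AE_on_element[OF T eq] by eventually_elim simp
  have g: "integrable (lebesgue_on T) g" by (rule integrable_cong_AE_completion[OF eq' Tm h])
  show "L2_proj_const (lebesgue_on T) g
      = (1 / measure (lebesgue_on T) (space (lebesgue_on T))) *\<^sub>R (LINT x|lebesgue_on T. h x)"
    using pr[OF g] integral_cong_AE_completion[OF eq' Tm] by simp
qed

lemma proj_const:
  fixes g :: "'a \<Rightarrow> 'b::euclidean_space"
  assumes T: "T \<in> \<T>" and eq: "AE x in lebesgue. x \<in> interior T \<longrightarrow> g x = k"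
  shows "L2_proj_const (lebesgue_on T) g = k"
proof -
  interpret finite_measure "lebesgue_on T" by (rule finite_measure_element[OF T])
  show ?thesis
    using proj_cong[OF T eq] measure_element_pos[OF T] by (simp del: space_lebesgue_on)
qed

definition centroid :: "'a set \<Rightarrow> 'a" where
  "centroid T = L2_proj_const (lebesgue_on T) (\<lambda>x. x)"

lemma proj_affine:
  assumes T: "T \<in> \<T>" and v: "affine_on (interior T) v a c"
  shows "L2_proj_const (lebesgue_on T) v = a + c *\<^sub>R centroid T"
proof -
  interpret finite_measure "lebesgue_on T" by (rule finite_measure_element[OF T])
  let ?m = "measure (lebesgue_on T) (space (lebesgue_on T))"
  have id: "integrable (lebesgue_on T) (\<lambda>x. x)"
  proof -
    obtain B where "\<And>x. x \<in> T \<Longrightarrow> norm x \<le> B" using element(7)[OF T] by (auto simp: bounded_iff)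
    then show ?thesis
      by (intro integrable_const_bound[where B = B])
        (auto intro!: AE_I2 measurable_restrict_space1 measurable_completion)
  qed
  have "L2_proj_const (lebesgue_on T) v = (1 / ?m) *\<^sub>R (LINT x|lebesgue_on T. a + c *\<^sub>R x)"
    by (rule proj_cong[OF T]) (use v id in \<open>auto simp: affine_on_def\<close>)
  also have "\<dots> = a + c *\<^sub>R ((1 / ?m) *\<^sub>R (LINT x|lebesgue_on T. x))"
    using id measure_element_pos[OF T] by (simp add: scaleR_add_right del: space_lebesgue_on)
  also have "(1 / ?m) *\<^sub>R (LINT x|lebesgue_on T. x) = centroid T"
    unfolding centroid_def by (rule proj_cong[symmetric, OF T]) (use id in auto)
  finally show ?thesis .
qed

lemma RT0_affine:
  assumes "v \<in> RT0 \<Omega> \<T>" "T \<in> \<T>"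
  obtains a c where "affine_on (interior T) v a c"
  using assms unfolding RT0_def affine_on_def by blast

text \<open>Testing with functions supported in the element, the weak divergence and the constant have the
  same integrals, by the divergence theorem for \<open>a + c x\<close>; the fundamental lemma concludes.\<close>

lemma weak_div_RT0:
  assumes v: "v \<in> RT0 \<Omega> \<T>" and T: "T \<in> \<T>" and aff: "affine_on (interior T) v a c"
  shows "AE x in lebesgue. x \<in> interior T \<longrightarrow> weak_div \<Omega> v x = real DIM('a) * c"
proof -
  define g where "g = weak_div \<Omega> v"
  let ?U = "interior T"
  have U: "?U \<subseteq> \<Omega>" by (rule interior_subset_domain[OF T])
  have Um: "?U \<inter> space lebesgue \<in> sets lebesgue" by auto
  have "\<exists>g. has_weak_div \<Omega> v g" using v by (auto simp: RT0_def Hdiv_def)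
  then have wd: "has_weak_div \<Omega> v g" unfolding g_def weak_div_def by (rule someI_ex)
  then have "integrable (lebesgue_on \<Omega>) g"
    by (intro square_integrable_imp_integrable finite_measure_domain) (simp add: has_weak_div_def)
  then have "integrable lebesgue (\<lambda>x. indicator \<Omega> x *\<^sub>R g x)" by (simp add: integrable_restrict_space)
  then have "integrable lebesgue (\<lambda>x. indicator ?U x *\<^sub>R (indicator \<Omega> x *\<^sub>R g x))"
    by (rule integrable_mult_indicator[rotated]) auto
  also have "(\<lambda>x. indicator ?U x *\<^sub>R (indicator \<Omega> x *\<^sub>R g x)) = (\<lambda>x. indicator ?U x *\<^sub>R g x)"
    using U by (force simp: indicator_def)
  finally have gU: "integrable (lebesgue_on ?U) g" using Um by (simp add: integrable_restrict_space)
  interpret fU: finite_measure "lebesgue_on ?U"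
    using element(7)[OF T] by (intro finite_measure_lebesgue_on lmeasurable_open bounded_interior) auto
  have "AE x in lebesgue_on ?U. g x - real DIM('a) * c = 0"
  proof (rule fundamental_lemma_calculus_of_variations)
    show "integrable (lebesgue_on ?U) (\<lambda>x. g x - real DIM('a) * c)" using gU by simp
    fix \<phi> D assume t: "test_function ?U \<phi> D"
    note tD = test_functionD[OF t]
    obtain R where R: "\<And>x. R < norm x \<Longrightarrow> \<phi> x = 0" using tD(2) by blast
    have \<phi>m: "\<phi> \<in> borel_measurable borel" and Dm: "D \<in> borel_measurable borel"
      using C1_with_gradientD(3,4)[OF tD(1)] borel_measurable_continuous_onI by blast+
    have "(LINT x|lebesgue_on \<Omega>. v x \<bullet> D x) = (LINT x|lebesgue. indicator \<Omega> x *\<^sub>R (v x \<bullet> D x))"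
      by (simp add: integral_restrict_space)
    also have "\<dots> = (LINT x|lebesgue. (a + c *\<^sub>R x) \<bullet> D x)"
    proof (rule Bochner_Integration.integral_cong)
      show "indicator \<Omega> x *\<^sub>R (v x \<bullet> D x) = (a + c *\<^sub>R x) \<bullet> D x" for x
        using U tD(4)[of x] aff by (cases "x \<in> ?U") (auto simp: affine_on_def)
    qed simp
    also have "\<dots> = (LINT x|lborel. (a + c *\<^sub>R x) \<bullet> D x)"
      using Dm by (intro integral_completion) simp
    also have "\<dots> = - (real DIM('a) * c) * (LINT x|lborel. \<phi> x)"
      by (rule integral_affine_field_dot_gradient[OF tD(1) R])
    also have "(LINT x|lborel. \<phi> x) = (LINT x|lebesgue. \<phi> x)"
      using \<phi>m by (intro integral_completion[symmetric]) simp
    also have "\<dots> = (LINT x|lebesgue. indicator ?U x *\<^sub>R \<phi> x)"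
      using tD(3) by (intro Bochner_Integration.integral_cong) (auto simp: indicator_def)
    also have "\<dots> = (LINT x|lebesgue_on ?U. \<phi> x)" using Um by (simp add: integral_restrict_space)
    finally have 1: "(LINT x|lebesgue_on \<Omega>. v x \<bullet> D x) = - (real DIM('a) * c) * (LINT x|lebesgue_on ?U. \<phi> x)" .
    have "(LINT x|lebesgue_on \<Omega>. g x * \<phi> x) = (LINT x|lebesgue. indicator \<Omega> x *\<^sub>R (g x * \<phi> x))"
      by (simp add: integral_restrict_space)
    also have "\<dots> = (LINT x|lebesgue. indicator ?U x *\<^sub>R (g x * \<phi> x))"
      using U tD(3) by (intro Bochner_Integration.integral_cong) (auto simp: indicator_def)
    also have "\<dots> = (LINT x|lebesgue_on ?U. g x * \<phi> x)" using Um by (simp add: integral_restrict_space)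
    finally have 2: "(LINT x|lebesgue_on \<Omega>. g x * \<phi> x) = (LINT x|lebesgue_on ?U. g x * \<phi> x)" .
    have "test_function \<Omega> \<phi> D" by (rule test_function_mono[OF t U])
    then have 3: "(LINT x|lebesgue_on \<Omega>. v x \<bullet> D x) = - (LINT x|lebesgue_on \<Omega>. g x * \<phi> x)"
      using wd by (simp add: has_weak_div_def)
    have int: "integrable (lebesgue_on ?U) (\<lambda>x. g x * \<phi> x)" by (rule integrable_test_function(2)[OF t gU])
    have "integrable (lebesgue_on ?U) (\<lambda>x. 1 * \<phi> x)" by (rule integrable_test_function(2)[OF t]) simp
    then have "integrable (lebesgue_on ?U) \<phi>" by simp
    then have "(LINT x|lebesgue_on ?U. g x * \<phi> x - real DIM('a) * c * \<phi> x) = 0"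
      using int 1 2 3 by simp
    then show "(LINT x|lebesgue_on ?U. \<phi> x * (g x - real DIM('a) * c)) = 0"
      by (simp add: algebra_simps)
  qed auto
  then show ?thesis using Um by (simp add: AE_restrict_space_iff g_def)
qed

lemma has_weak_div_lin_comb:
  assumes u: "square_integrable (lebesgue_on \<Omega>) u" "has_weak_div \<Omega> u g"
    and v: "square_integrable (lebesgue_on \<Omega>) v" "has_weak_div \<Omega> v h"
  shows "has_weak_div \<Omega> (lin_comb s u t v) (lin_comb s g t h)"
  unfolding has_weak_div_def
proof (intro conjI allI impI)
  show "square_integrable (lebesgue_on \<Omega>) (lin_comb s g t h)"
    using u v by (intro square_integrable_lin_comb) (auto simp: has_weak_div_def)
  fix \<phi> D assume \<phi>: "test_function \<Omega> \<phi> D"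
  note si = square_integrable_imp_integrable[OF finite_measure_domain]
  have i: "integrable (lebesgue_on \<Omega>) (\<lambda>x. u x \<bullet> D x)" "integrable (lebesgue_on \<Omega>) (\<lambda>x. v x \<bullet> D x)"
    using si[OF u(1)] si[OF v(1)] by (auto intro: integrable_test_function(1)[OF \<phi>])
  have j: "integrable (lebesgue_on \<Omega>) (\<lambda>x. g x * \<phi> x)" "integrable (lebesgue_on \<Omega>) (\<lambda>x. h x * \<phi> x)"
    using si[of g] si[of h] u(2) v(2)
    by (auto simp: has_weak_div_def intro: integrable_test_function(2)[OF \<phi>])
  have "(LINT x|lebesgue_on \<Omega>. lin_comb s u t v x \<bullet> D x)
      = (LINT x|lebesgue_on \<Omega>. s * (u x \<bullet> D x) + t * (v x \<bullet> D x))"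
    by (simp add: lin_comb_def inner_add_left)
  also have "\<dots> = s * (LINT x|lebesgue_on \<Omega>. u x \<bullet> D x) + t * (LINT x|lebesgue_on \<Omega>. v x \<bullet> D x)"
    using i by simp
  also have "\<dots> = - (s * (LINT x|lebesgue_on \<Omega>. g x * \<phi> x) + t * (LINT x|lebesgue_on \<Omega>. h x * \<phi> x))"
    using u(2) v(2) \<phi> by (simp add: has_weak_div_def)
  also have "\<dots> = - (LINT x|lebesgue_on \<Omega>. s * (g x * \<phi> x) + t * (h x * \<phi> x))" using j by simp
  finally show "(LINT x|lebesgue_on \<Omega>. lin_comb s u t v x \<bullet> D x)
      = - (LINT x|lebesgue_on \<Omega>. lin_comb s g t h x * \<phi> x)"
    by (simp add: lin_comb_def algebra_simps)
qed

lemma lin_comb_affine: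
  "affine_on U u a c \<Longrightarrow> affine_on U v a' c' \<Longrightarrow>
     affine_on U (lin_comb s u t v) (s *\<^sub>R a + t *\<^sub>R a') (s * c + t * c')"
  by (simp add: affine_on_def lin_comb_def algebra_simps)

lemma RT0_subspace: "fun_subspace (RT0 \<Omega> \<T>)"
  unfolding fun_subspace_def
proof (intro conjI ballI allI)
  have "(\<lambda>x. 0) \<in> RT0 \<Omega> \<T>"
    by (auto simp: RT0_def Hdiv_def square_integrable_def has_weak_div_def
        intro!: exI[of _ "\<lambda>_. 0"] exI[of _ 0])
  then show "RT0 \<Omega> \<T> \<noteq> {}" by blast
  fix u v s t assume u: "u \<in> RT0 \<Omega> \<T>" and v: "v \<in> RT0 \<Omega> \<T>"
  have "lin_comb s u t v \<in> Hdiv \<Omega>"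
    using u v has_weak_div_lin_comb square_integrable_lin_comb unfolding RT0_def Hdiv_def by blast
  moreover have "\<exists>a c. \<forall>x\<in>interior T. lin_comb s u t v x = a + c *\<^sub>R x" if T: "T \<in> \<T>" for T
  proof -
    obtain a c where 1: "affine_on (interior T) u a c" by (rule RT0_affine[OF u T])
    obtain a' c' where 2: "affine_on (interior T) v a' c'" by (rule RT0_affine[OF v T])
    show ?thesis using lin_comb_affine[OF 1 2] unfolding affine_on_def by blast
  qed
  ultimately show "lin_comb s u t v \<in> RT0 \<Omega> \<T>" by (simp add: RT0_def)
qed

definition elem_mean :: "'a set \<Rightarrow> ('a \<Rightarrow> 'a) \<Rightarrow> 'a" where
  "elem_mean T v = L2_proj_const (lebesgue_on T) v"

definition elem_div :: "'a set \<Rightarrow> ('a \<Rightarrow> 'a) \<Rightarrow> real" where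
  "elem_div T v = L2_proj_const (lebesgue_on T) (weak_div \<Omega> v)"

text \<open>The normal trace is constant on the relative interior of a boundary facet, so any point of it
  can be used.\<close>

definition facet_flux :: "'a set \<Rightarrow> ('a \<Rightarrow> 'a) \<Rightarrow> real" where
  "facet_flux S v = normal_trace \<Omega> v (SOME x. x \<in> rel_interior S)"

lemma elem_div_eq:
  assumes "v \<in> RT0 \<Omega> \<T>" "T \<in> \<T>" "affine_on (interior T) v a c"
  shows "elem_div T v = real DIM('a) * c"
  unfolding elem_div_def by (rule proj_const[OF assms(2) weak_div_RT0[OF assms]])

lemma AE_weak_div:
  assumes "v \<in> RT0 \<Omega> \<T>" "T \<in> \<T>"
  shows "AE x in lebesgue. x \<in> interior T \<longrightarrow> weak_div \<Omega> v x = elem_div T v"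
proof -
  obtain a c where "affine_on (interior T) v a c" by (rule RT0_affine[OF assms])
  then show ?thesis using weak_div_RT0[OF assms] elem_div_eq[OF assms] by simp
qed

lemma elem_mean_lin_comb:
  assumes u: "u \<in> RT0 \<Omega> \<T>" and v: "v \<in> RT0 \<Omega> \<T>" and T: "T \<in> \<T>"
  shows "elem_mean T (lin_comb s u t v) = s *\<^sub>R elem_mean T u + t *\<^sub>R elem_mean T v"
proof -
  obtain a c where 1: "affine_on (interior T) u a c" by (rule RT0_affine[OF u T])
  obtain a' c' where 2: "affine_on (interior T) v a' c'" by (rule RT0_affine[OF v T])
  show ?thesis
    unfolding elem_mean_def proj_affine[OF T 1] proj_affine[OF T 2] proj_affine[OF T lin_comb_affine[OF 1 2]]
    by (simp add: algebra_simps)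
qed

lemma elem_div_linear: "T \<in> \<T> \<Longrightarrow> linear_form (RT0 \<Omega> \<T>) (elem_div T)"
  unfolding linear_form_def
proof (intro ballI allI)
  fix u v s t assume T: "T \<in> \<T>" and u: "u \<in> RT0 \<Omega> \<T>" and v: "v \<in> RT0 \<Omega> \<T>"
  obtain a c where 1: "affine_on (interior T) u a c" by (rule RT0_affine[OF u T])
  obtain a' c' where 2: "affine_on (interior T) v a' c'" by (rule RT0_affine[OF v T])
  have uv: "lin_comb s u t v \<in> RT0 \<Omega> \<T>" by (rule fun_subspaceD[OF RT0_subspace u v])
  show "elem_div T (lin_comb s u t v) = s * elem_div T u + t * elem_div T v"
    unfolding elem_div_eq[OF u T 1] elem_div_eq[OF v T 2] elem_div_eq[OF uv T lin_comb_affine[OF 1 2]]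
    by (simp add: algebra_simps)
qed

lemma rel_interior_boundary_facet_nonempty:
  assumes "S \<in> boundary_facets \<Omega> \<T>"
  shows "rel_interior S \<noteq> {}"
proof -
  obtain T where T: "T \<in> \<T>" "S facet_of T" using assms by (auto simp: boundary_facets_def facets_def)
  then have "convex S" "S \<noteq> {}" using face_of_imp_convex by (auto simp: facet_of_def)
  then show ?thesis using rel_interior_eq_empty by blast
qed

lemma normal_trace_eq_flux:
  assumes S: "S \<in> boundary_facets \<Omega> \<T>" and v: "v \<in> RT0 \<Omega> \<T>" and x: "x \<in> rel_interior S"
  shows "normal_trace \<Omega> v x = facet_flux S v"
proof -
  obtain T n b where T: "T \<in> \<T>" "\<And>v a c x. affine_on (interior T) v a c \<Longrightarrow> x \<in> rel_interior S \<Longrightarrow>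
       normal_trace \<Omega> v x = a \<bullet> n + c * b"
    using normal_trace_boundary_facet[OF lipschitz mesh S] by blast
  obtain a c where "affine_on (interior T) v a c" by (rule RT0_affine[OF v T(1)])
  note * = T(2)[OF this]
  have "(SOME x. x \<in> rel_interior S) \<in> rel_interior S" using x by (metis someI)
  from *[OF x] *[OF this] show ?thesis by (simp add: facet_flux_def)
qed

lemma facet_flux_linear:
  assumes S: "S \<in> boundary_facets \<Omega> \<T>"
  shows "linear_form (RT0 \<Omega> \<T>) (facet_flux S)"
  unfolding linear_form_def
proof (intro ballI allI)
  fix u v s t assume u: "u \<in> RT0 \<Omega> \<T>" and v: "v \<in> RT0 \<Omega> \<T>"
  obtain T n b where T: "T \<in> \<T>" "\<And>v a c x. affine_on (interior T) v a c \<Longrightarrow> x \<in> rel_interior S \<Longrightarrow>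
       normal_trace \<Omega> v x = a \<bullet> n + c * b"
    using normal_trace_boundary_facet[OF lipschitz mesh S] by blast
  obtain a c where 1: "affine_on (interior T) u a c" by (rule RT0_affine[OF u T(1)])
  obtain a' c' where 2: "affine_on (interior T) v a' c'" by (rule RT0_affine[OF v T(1)])
  have x: "(SOME x. x \<in> rel_interior S) \<in> rel_interior S"
    using rel_interior_boundary_facet_nonempty[OF S] by (simp add: some_in_eq)
  show "facet_flux S (lin_comb s u t v) = s * facet_flux S u + t * facet_flux S v"
    unfolding facet_flux_def T(2)[OF 1 x] T(2)[OF 2 x] T(2)[OF lin_comb_affine[OF 1 2] x]
    by (simp add: algebra_simps)
qed

text \<open>On an element \<open>a + c x\<close> has divergence \<open>d c\<close> and mean \<open>a + c x\<^sub>T\<close>, where \<open>x\<^sub>T\<close> is the centroid, so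
  mean and divergence determine \<open>a\<close> and \<open>c\<close>. This yields definiteness of the quadratic form.\<close>

lemma RT0_vanishes:
  assumes v: "v \<in> RT0 \<Omega> \<T>" and 0: "\<And>T. T \<in> \<T> \<Longrightarrow> elem_mean T v = 0" "\<And>T. T \<in> \<T> \<Longrightarrow> elem_div T v = 0"
  shows "\<And>T x. T \<in> \<T> \<Longrightarrow> x \<in> interior T \<Longrightarrow> v x = 0"
    and "\<And>S. S \<in> boundary_facets \<Omega> \<T> \<Longrightarrow> facet_flux S v = 0"
proof -
  show z: "v x = 0" if T: "T \<in> \<T>" "x \<in> interior T" for T x
  proof -
    obtain a c where aff: "affine_on (interior T) v a c" by (rule RT0_affine[OF v T(1)])
    have "c = 0" using elem_div_eq[OF v T(1) aff] 0(2)[OF T(1)] by simp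
    moreover have "a + c *\<^sub>R centroid T = 0"
      using proj_affine[OF T(1) aff] 0(1)[OF T(1)] by (simp add: elem_mean_def)
    ultimately show ?thesis using aff T(2) by (simp add: affine_on_def)
  qed
  fix S assume S: "S \<in> boundary_facets \<Omega> \<T>"
  obtain T n b where T: "T \<in> \<T>" "\<And>v a c x. affine_on (interior T) v a c \<Longrightarrow> x \<in> rel_interior S \<Longrightarrow>
       normal_trace \<Omega> v x = a \<bullet> n + c * b"
    using normal_trace_boundary_facet[OF lipschitz mesh S] by blast
  have x: "(SOME x. x \<in> rel_interior S) \<in> rel_interior S"
    using rel_interior_boundary_facet_nonempty[OF S] by (simp add: some_in_eq)
  show "facet_flux S v = 0"
    unfolding facet_flux_def using T(2)[of v 0 0, OF _ x] z[OF T(1)] by (simp add: affine_on_def)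
qed

end

section \<open>Boundary functionals and mean coefficients\<close>

context meshed_domain begin

lemma flat_boundary_facet:
  assumes S: "S \<in> boundary_facets \<Omega> \<T>"
  obtains n b where "flat_facet S n b"
proof -
  obtain T n b where "boundary_chart \<Omega> \<T> S T n b" by (rule boundary_chart_exists[OF lipschitz mesh S])
  note T = boundary_chartD[OF this]
  have "flat_facet S n b"
  proof
    show "convex S" using T(2) by (rule face_of_imp_convex)
    show "compact S" by (rule face_of_imp_compact[OF element(1,2)[OF T(1)] T(2)])
    show "S \<noteq> {}" using rel_interior_boundary_facet_nonempty[OF S] by auto
  qed (use T in auto)
  then show ?thesis by (rule that)
qed

text \<open>The relative boundary of the facet, where discrete functions have no prescribed values, is null
  for the surface measure.\<close>

lemma integral_facet_cong:
  fixes f g :: "'a \<Rightarrow> real"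
  assumes S: "S \<in> boundary_facets \<Omega> \<T>" and \<Gamma>: "\<Gamma> \<in> sets borel"
    and eq: "\<And>x. x \<in> \<Gamma> \<Longrightarrow> x \<in> rel_interior S \<Longrightarrow> f x = g x"
  shows "(LINT x|restrict_space (facet_measure S) \<Gamma>. f x) = (LINT x|restrict_space (facet_measure S) \<Gamma>. g x)"
proof -
  obtain n b where "flat_facet S n b" by (rule flat_boundary_facet[OF S])
  then interpret flat_facet S n b .
  have "AE x in facet_measure S. x \<in> \<Gamma> \<longrightarrow> f x = g x"
    using AE_rel_interior by eventually_elim (use eq in blast)
  then show ?thesis
    unfolding facet_measure_eq by (rule integral_cong_AE_completion) (use \<Gamma> in auto)
qed

lemma surface_inner_normal_trace:
  assumes \<Gamma>: "\<Gamma> \<in> sets borel" and v: "v \<in> RT0 \<Omega> \<T>"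
  shows "surface_inner (boundary_facets \<Omega> \<T>) \<Gamma> p (normal_trace \<Omega> v)
    = (\<Sum>S\<in>boundary_facets \<Omega> \<T>. (LINT x|restrict_space (facet_measure S) \<Gamma>. p x) * facet_flux S v)"
  unfolding surface_inner_def surface_integral_def
proof (rule sum.cong[OF refl])
  fix S assume S: "S \<in> boundary_facets \<Omega> \<T>"
  have "(LINT x|restrict_space (facet_measure S) \<Gamma>. p x * normal_trace \<Omega> v x)
      = (LINT x|restrict_space (facet_measure S) \<Gamma>. p x * facet_flux S v)"
    by (rule integral_facet_cong[OF S \<Gamma>]) (simp add: normal_trace_eq_flux[OF S v])
  then show "(LINT x|restrict_space (facet_measure S) \<Gamma>. p x * normal_trace \<Omega> v x)
      = (LINT x|restrict_space (facet_measure S) \<Gamma>. p x) * facet_flux S v" by simp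
qed

lemma integral_facet_const:
  assumes S: "S \<in> boundary_facets \<Omega> \<T>" and \<Gamma>: "\<Gamma> \<in> sets borel"
    and p: "\<And>x. x \<in> rel_interior S \<Longrightarrow> p x = (k :: real)"
  shows "(LINT x|restrict_space (facet_measure S) \<Gamma>. p x) = measure (facet_measure S) \<Gamma> * k"
proof -
  have sp: "space (facet_measure S) = UNIV" "\<Gamma> \<in> sets (facet_measure S)"
    using \<Gamma> by (auto simp: facet_measure_eq)
  have "(LINT x|restrict_space (facet_measure S) \<Gamma>. p x) = (LINT x|restrict_space (facet_measure S) \<Gamma>. k)"
    by (rule integral_facet_cong[OF S \<Gamma>]) (rule p)
  also have "\<dots> = measure (facet_measure S) \<Gamma> * k"
    using sp by (simp add: measure_restrict_space space_restrict_space)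
  finally show ?thesis .
qed

lemma surface_inner_facetwise_constant:
  assumes \<Gamma>: "\<Gamma> \<in> sets borel" and v: "v \<in> RT0 \<Omega> \<T>"
    and off: "\<And>S. S \<in> boundary_facets \<Omega> \<T> \<Longrightarrow> S \<notin> facets_on \<Omega> \<T> \<Gamma> \<Longrightarrow> \<Gamma> \<inter> S = {}"
    and p: "\<And>S x. S \<in> facets_on \<Omega> \<T> \<Gamma> \<Longrightarrow> x \<in> rel_interior S \<Longrightarrow> p x = k S"
  shows "surface_inner (boundary_facets \<Omega> \<T>) \<Gamma> p (normal_trace \<Omega> v)
    = (\<Sum>S\<in>facets_on \<Omega> \<T> \<Gamma>. measure (facet_measure S) \<Gamma> * k S * facet_flux S v)"
proof -
  have sub: "facets_on \<Omega> \<T> \<Gamma> \<subseteq> boundary_facets \<Omega> \<T>" by (auto simp: facets_on_def)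
  have "(LINT x|restrict_space (facet_measure S) \<Gamma>. p x) = 0"
    if S: "S \<in> boundary_facets \<Omega> \<T> - facets_on \<Omega> \<T> \<Gamma>" for S
  proof -
    have "(LINT x|restrict_space (facet_measure S) \<Gamma>. p x) = (LINT x|restrict_space (facet_measure S) \<Gamma>. 0)"
      using S off[of S] rel_interior_subset[of S] by (intro integral_facet_cong \<Gamma>) auto
    then show ?thesis by simp
  qed
  then have "surface_inner (boundary_facets \<Omega> \<T>) \<Gamma> p (normal_trace \<Omega> v)
    = (\<Sum>S\<in>facets_on \<Omega> \<T> \<Gamma>. (LINT x|restrict_space (facet_measure S) \<Gamma>. p x) * facet_flux S v)"
    unfolding surface_inner_normal_trace[OF \<Gamma> v]
    using finite_boundary_facets[OF mesh] sub by (intro sum.mono_neutral_right) auto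
  also have "\<dots> = (\<Sum>S\<in>facets_on \<Omega> \<T> \<Gamma>. measure (facet_measure S) \<Gamma> * k S * facet_flux S v)"
  proof (rule sum.cong[OF refl])
    fix S assume S: "S \<in> facets_on \<Omega> \<T> \<Gamma>"
    show "(LINT x|restrict_space (facet_measure S) \<Gamma>. p x) * facet_flux S v
        = measure (facet_measure S) \<Gamma> * k S * facet_flux S v"
      using integral_facet_const[OF _ \<Gamma> p[OF S]] S sub by auto
  qed
  finally show ?thesis .
qed

text \<open>The facet \<open>S\<close> lies in the closure of \<open>\<Gamma>\<close>, but \<open>\<Gamma>\<close> could a priori approach it from outside only. Near a
  relative interior point of \<open>S\<close> the boundary of the domain is contained in \<open>S\<close>, however, so \<open>\<Gamma>\<close>
  contains a point of the relative interior of \<open>S\<close>, and with it a relatively open piece of \<open>S\<close>.\<close>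

lemma measure_facet_part_pos:
  assumes op: "openin (top_of_set (frontier \<Omega>)) \<Gamma>" and S: "S \<in> facets_on \<Omega> \<T> \<Gamma>"
  shows "0 < measure (facet_measure S) \<Gamma>"
proof -
  have bS: "S \<in> boundary_facets \<Omega> \<T>" and SF: "S \<subseteq> frontier \<Omega>" and Scl: "S \<subseteq> closure \<Gamma>"
    using S by (auto simp: facets_on_def boundary_facets_def)
  obtain n b where "flat_facet S n b" by (rule flat_boundary_facet[OF bS])
  then interpret flat_facet S n b .
  obtain U where U: "open U" "\<Gamma> = frontier \<Omega> \<inter> U" using op by (auto simp: openin_open)
  have \<Gamma>: "\<Gamma> \<in> sets borel" unfolding U(2) using U(1) by auto
  obtain T m c where "boundary_chart \<Omega> \<T> S T m c" by (rule boundary_chart_exists[OF lipschitz mesh bS])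
  note chart = boundary_chartD[OF this]
  obtain x where x: "x \<in> rel_interior S" using rel_interior_boundary_facet_nonempty[OF bS] by blast
  then obtain e where e: "e > 0" "ball x e \<inter> affine hull S \<subseteq> S" and xS: "x \<in> S"
    by (auto simp: mem_rel_interior_ball)
  obtain r where r: "r > 0" "\<Omega> \<inter> ball x r = {y \<in> ball x r. m \<bullet> y < c}" using chart(6)[OF x] by blast
  obtain y where y: "y \<in> \<Gamma>" "dist y x < min r e"
    using Scl xS r(1) e(1) by (metis closure_approachable min_less_iff_conj subsetD)
  have yb: "y \<in> ball x r" "y \<in> ball x e" using y(2) by (auto simp: dist_commute)
  have yF: "y \<in> frontier \<Omega>" using y(1) U(2) by blast
  have "y \<notin> \<Omega>" using yF open_domain by (auto simp: frontier_def interior_open)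
  then have ge: "c \<le> m \<bullet> y" using r(2) yb(1) by force
  have le: "m \<bullet> y \<le> c"
  proof (rule ccontr)
    assume "\<not> m \<bullet> y \<le> c"
    then have "y \<in> ball x r \<inter> {z. c < m \<bullet> z}" using yb by auto
    moreover have "open (ball x r \<inter> {z. c < m \<bullet> z})" by (intro open_Int open_ball open_halfspace_gt)
    moreover have "y \<in> closure \<Omega>" using yF by (auto simp: frontier_def)
    ultimately have "\<Omega> \<inter> (ball x r \<inter> {z. c < m \<bullet> z}) \<noteq> {}"
      using open_Int_closure_eq_empty by blast
    then show False using r(2) by force
  qed
  have "y \<in> affine hull S" using ge le chart(4) by auto
  then have yS: "y \<in> S" using e(2) yb(2) by blast
  obtain d where d: "d > 0" "ball y d \<subseteq> ball x e" using yb(2) open_ball openE by blast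
  have "y \<in> rel_interior S" using yS d e(2) by (auto simp: mem_rel_interior_ball)
  moreover obtain d' where "d' > 0" "ball y d' \<subseteq> U" using U y(1) openE by blast
  then have "ball y d' \<inter> S \<subseteq> \<Gamma>" using SF U(2) by blast
  ultimately show ?thesis using measure_facet_pos[OF \<Gamma> _ \<open>d' > 0\<close>] by blast
qed

lemma facet_proj_eq:
  assumes S: "S \<in> facets_on \<Omega> \<T> \<Gamma>" and x: "x \<in> rel_interior S"
  shows "facet_proj (facets_on \<Omega> \<T> \<Gamma>) \<Gamma> g x = L2_proj_const (restrict_space (facet_measure S) \<Gamma>) g"
proof -
  have "(THE S. S \<in> facets_on \<Omega> \<T> \<Gamma> \<and> x \<in> rel_interior S) = S"
    by (rule the_equality)
      (use S x boundary_facets_eqI[OF lipschitz mesh] in \<open>auto simp: facets_on_def\<close>)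
  then show ?thesis by (simp add: facet_proj_def)
qed

lemma dual_feasible_iff:
  assumes v: "v \<in> RT0 \<Omega> \<T>"
    and f: "\<And>T x. T \<in> \<T> \<Longrightarrow> x \<in> interior T \<Longrightarrow> f x = g T"
    and \<alpha>: "\<And>S x. S \<in> facets_on \<Omega> \<T> \<Gamma> \<Longrightarrow> x \<in> rel_interior S \<Longrightarrow> \<alpha> x = lo S"
    and \<beta>: "\<And>S x. S \<in> facets_on \<Omega> \<T> \<Gamma> \<Longrightarrow> x \<in> rel_interior S \<Longrightarrow> \<beta> x = hi S"
  shows "v \<in> dual_feasible \<Omega> \<T> \<Gamma> f \<alpha> \<beta> \<longleftrightarrow>
    (\<forall>T\<in>\<T>. elem_div T v = g T) \<and> (\<forall>S\<in>facets_on \<Omega> \<T> \<Gamma>. lo S \<le> facet_flux S v \<and> facet_flux S v \<le> hi S)"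
proof -
  have div: "(AE x in lebesgue_on \<Omega>. weak_div \<Omega> v x = f x) \<longleftrightarrow> (\<forall>T\<in>\<T>. elem_div T v = g T)"
  proof
    assume "AE x in lebesgue_on \<Omega>. weak_div \<Omega> v x = f x"
    then have ae: "AE x in lebesgue. x \<in> \<Omega> \<longrightarrow> weak_div \<Omega> v x = f x"
      by (simp add: AE_restrict_space_iff)
    show "\<forall>T\<in>\<T>. elem_div T v = g T"
    proof
      fix T assume T: "T \<in> \<T>"
      have "AE x in lebesgue. x \<in> interior T \<longrightarrow> weak_div \<Omega> v x = g T"
        using ae by eventually_elim (use f[OF T] interior_subset_domain[OF T] in auto)
      then show "elem_div T v = g T" unfolding elem_div_def by (rule proj_const[OF T])
    qed
  next
    assume *: "\<forall>T\<in>\<T>. elem_div T v = g T"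
    have "AE x in lebesgue. \<forall>T\<in>\<T>. x \<in> interior T \<longrightarrow> weak_div \<Omega> v x = elem_div T v"
      by (intro AE_finite_allI[OF finite_elements] AE_weak_div[OF v])
    with AE_mesh_interior have "AE x in lebesgue. x \<in> \<Omega> \<longrightarrow> weak_div \<Omega> v x = f x"
      by eventually_elim (use f * in force)
    then show "AE x in lebesgue_on \<Omega>. weak_div \<Omega> v x = f x" by (simp add: AE_restrict_space_iff)
  qed
  have flux: "(\<forall>x\<in>rel_interior S. \<alpha> x \<le> normal_trace \<Omega> v x \<and> normal_trace \<Omega> v x \<le> \<beta> x)
      \<longleftrightarrow> lo S \<le> facet_flux S v \<and> facet_flux S v \<le> hi S" if S: "S \<in> facets_on \<Omega> \<T> \<Gamma>" for S
  proof -
    have bS: "S \<in> boundary_facets \<Omega> \<T>" using S by (simp add: facets_on_def)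
    show ?thesis
      using rel_interior_boundary_facet_nonempty[OF bS] \<alpha>[OF S] \<beta>[OF S] normal_trace_eq_flux[OF bS v]
      by auto
  qed
  show ?thesis unfolding dual_feasible_def using v div flux by simp
qed

end

text \<open>Ellipticity and symmetry bound the entries of \<open>K\<close>, so \<open>K\<close> is integrable over the element, and both
  properties are preserved by averaging because they are expressed by linear functions of \<open>K\<close>.\<close>

lemma mean_matrix_elliptic:
  fixes K :: "real^'n \<Rightarrow> real^'n^'n"
  assumes M: "meshed_domain \<Omega> \<T>" and T: "T \<in> \<T>"
    and K: "K \<in> borel_measurable (lebesgue_on \<Omega>)"
    and sym: "\<And>x. x \<in> \<Omega> \<Longrightarrow> transpose (K x) = K x"
    and k: "0 < k\<^sub>0"
    and ell: "\<And>x \<xi>. x \<in> \<Omega> \<Longrightarrow>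
        k\<^sub>0 * (norm \<xi>)\<^sup>2 \<le> \<xi> \<bullet> (K x *v \<xi>) \<and> \<xi> \<bullet> (K x *v \<xi>) \<le> k\<^sub>1 * (norm \<xi>)\<^sup>2"
  defines "A \<equiv> L2_proj_const (lebesgue_on T) K"
  shows "transpose A = A" and "k\<^sub>0 * (norm \<xi>)\<^sup>2 \<le> \<xi> \<bullet> (A *v \<xi>)"
proof -
  interpret meshed_domain \<Omega> \<T> by (rule M)
  interpret fT: finite_measure "lebesgue_on T" by (rule finite_measure_element[OF T])
  let ?m = "measure (lebesgue_on T) (space (lebesgue_on T))"
  have m: "0 < ?m" by (rule measure_element_pos[OF T])
  note sub = interior_subset_domain[OF T]
  have Tm: "T \<inter> space lebesgue \<in> sets lebesgue" using element_lmeasurable[OF T] by (simp add: fmeasurableD)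
  define K' where "K' = (\<lambda>x. indicator (interior T) x *\<^sub>R K x)"
  have bound: "norm (K x) \<le> real CARD('n) * (real CARD('n) * \<bar>k\<^sub>1\<bar>)" if x: "x \<in> \<Omega>" for x
  proof -
    have op: "norm (K x *v \<xi>) \<le> \<bar>k\<^sub>1\<bar> * norm \<xi>" for \<xi>
    proof (rule psd_bounded_operator_norm[OF matrix_vector_mul_bounded_linear])
      show "y \<bullet> (K x *v z) = (K x *v y) \<bullet> z" for y z by (rule symmetric_matrix_inner[OF sym[OF x]])
      show "0 \<le> y \<bullet> (K x *v y)" for y
        using ell[OF x, of y] k by (meson mult_nonneg_nonneg less_imp_le order_trans zero_le_power2)
      show "y \<bullet> (K x *v y) \<le> \<bar>k\<^sub>1\<bar> * (norm y)\<^sup>2" for y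
        using ell[OF x, of y] mult_right_mono[OF abs_ge_self[of k\<^sub>1] zero_le_power2[of "norm y"]] by linarith
    qed simp
    have entry: "\<bar>K x $ i $ j\<bar> \<le> \<bar>k\<^sub>1\<bar>" for i j
    proof -
      have "K x $ i $ j = (K x *v axis j 1) $ i" by (simp add: matrix_vector_mul_component inner_axis)
      then have "\<bar>K x $ i $ j\<bar> \<le> norm (K x *v axis j 1)" by (metis component_le_norm_cart)
      also have "\<dots> \<le> \<bar>k\<^sub>1\<bar>" using op[of "axis j 1"] by simp
      finally show ?thesis .
    qed
    have row: "norm (K x $ i) \<le> real CARD('n) * \<bar>k\<^sub>1\<bar>" for i
    proof -
      have "norm (K x $ i) \<le> (\<Sum>j\<in>UNIV. \<bar>K x $ i $ j\<bar>)" by (rule norm_le_l1_cart)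
      also have "\<dots> \<le> (\<Sum>j\<in>(UNIV :: 'n set). \<bar>k\<^sub>1\<bar>)" by (intro sum_mono entry)
      finally show ?thesis by simp
    qed
    have "norm (K x) \<le> (\<Sum>i\<in>UNIV. norm (K x $ i))"
      unfolding norm_vec_def[of "K x"] by (rule L2_set_le_sum) simp
    also have "\<dots> \<le> (\<Sum>i\<in>(UNIV :: 'n set). real CARD('n) * \<bar>k\<^sub>1\<bar>)" by (intro sum_mono row)
    finally show ?thesis by simp
  qed
  have "(\<lambda>x. indicator \<Omega> x *\<^sub>R K x) \<in> borel_measurable lebesgue"
    using K by (subst (asm) borel_measurable_restrict_space_iff) auto
  then have "(\<lambda>x. indicator (interior T) x *\<^sub>R (indicator \<Omega> x *\<^sub>R K x)) \<in> borel_measurable lebesgue"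
    by (rule borel_measurable_scaleR[rotated]) (auto intro: borel_measurable_indicator)
  also have "(\<lambda>x. indicator (interior T) x *\<^sub>R (indicator \<Omega> x *\<^sub>R K x)) = K'"
    using sub by (force simp: K'_def indicator_def)
  finally have K'm: "K' \<in> borel_measurable (lebesgue_on T)" by (rule measurable_restrict_space1)
  have K'i: "integrable (lebesgue_on T) K'"
  proof (rule fT.integrable_const_bound[OF _ K'm])
    have "norm (K' x) \<le> real CARD('n) * (real CARD('n) * \<bar>k\<^sub>1\<bar>)" for x
      using bound[of x] sub by (cases "x \<in> interior T") (auto simp: K'_def)
    then show "AE x in lebesgue_on T. norm (K' x) \<le> real CARD('n) * (real CARD('n) * \<bar>k\<^sub>1\<bar>)" by simp
  qed
  have A: "A = (1 / ?m) *\<^sub>R (LINT x|lebesgue_on T. K' x)"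
    unfolding A_def by (rule proj_cong[OF T]) (use K'i in \<open>auto simp: K'_def\<close>)
  have lin: "L A = (1 / ?m) *\<^sub>R (LINT x|lebesgue_on T. L (K' x))" if L: "linear L"
    for L :: "real^'n^'n \<Rightarrow> 'c::euclidean_space"
  proof -
    have bl: "bounded_linear L" using L by (rule linear_conv_bounded_linear[THEN iffD1])
    have "L A = (1 / ?m) *\<^sub>R L (LINT x|lebesgue_on T. K' x)"
      unfolding A using L by (rule linear_scale)
    then show ?thesis using integral_bounded_linear[OF bl K'i] by simp
  qed
  have "linear (transpose :: real^'n^'n \<Rightarrow> real^'n^'n)"
    by (rule linearI) (auto simp: transpose_def vec_eq_iff)
  from lin[OF this] have "transpose A = (1 / ?m) *\<^sub>R (LINT x|lebesgue_on T. transpose (K' x))" .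
  also have "(\<lambda>x. transpose (K' x)) = K'"
    using sym sub by (auto simp: K'_def indicator_def transpose_def vec_eq_iff fun_eq_iff)
  finally show "transpose A = A" using A by simp
  have "linear (\<lambda>B :: real^'n^'n. \<xi> \<bullet> (B *v \<xi>))"
    by (rule linearI)
      (simp_all add: matrix_vector_mult_add_rdistrib inner_add_right scaleR_matrix_vector_assoc[symmetric])
  from lin[OF this] have A\<xi>: "\<xi> \<bullet> (A *v \<xi>) = (1 / ?m) * (LINT x|lebesgue_on T. \<xi> \<bullet> (K' x *v \<xi>))" by simp
  have L: "bounded_linear (\<lambda>B :: real^'n^'n. \<xi> \<bullet> (B *v \<xi>))"
    using \<open>linear (\<lambda>B :: real^'n^'n. \<xi> \<bullet> (B *v \<xi>))\<close> linear_conv_bounded_linear by blast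
  have "AE x in lebesgue_on T. x \<in> interior T"
    using AE_interior_convex[OF element(1)[OF T]] Tm by (simp add: AE_restrict_space_iff)
  then have "AE x in lebesgue_on T. k\<^sub>0 * (norm \<xi>)\<^sup>2 \<le> \<xi> \<bullet> (K' x *v \<xi>)"
    by eventually_elim (use ell sub in \<open>auto simp: K'_def\<close>)
  then have "(LINT x|lebesgue_on T. k\<^sub>0 * (norm \<xi>)\<^sup>2) \<le> (LINT x|lebesgue_on T. \<xi> \<bullet> (K' x *v \<xi>))"
    using integrable_bounded_linear[OF L K'i] by (intro integral_mono_AE) auto
  then have "?m * (k\<^sub>0 * (norm \<xi>)\<^sup>2) \<le> ?m * (\<xi> \<bullet> (A *v \<xi>))"
    using m A\<xi> by (simp del: space_lebesgue_on)
  then show "k\<^sub>0 * (norm \<xi>)\<^sup>2 \<le> \<xi> \<bullet> (A *v \<xi>)" using m by (rule mult_left_le_imp_le)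
qed

section \<open>The discrete dual problem\<close>

theorem theorem7p1:
  fixes \<Omega> \<Gamma>\<^sub>D \<Gamma>\<^sub>C :: "(real^'n) set"
    and \<T> :: "(real^'n) set set"
    and f p\<^sub>D p_hat \<alpha> \<beta> :: "real^'n \<Rightarrow> real"
    and K :: "real^'n \<Rightarrow> real^'n^'n"
    and k\<^sub>0 k\<^sub>1 :: real
  defines "\<S> \<equiv> boundary_facets \<Omega> \<T>"
    and "\<S>\<^sub>C \<equiv> facets_on \<Omega> \<T> \<Gamma>\<^sub>C"
    and "K\<^sub>h \<equiv> elem_proj \<T> K"
    and "f\<^sub>h \<equiv> elem_proj \<T> f"
    and "\<alpha>\<^sub>h \<equiv> facet_proj (facets_on \<Omega> \<T> \<Gamma>\<^sub>C) \<Gamma>\<^sub>C \<alpha>"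
    and "\<beta>\<^sub>h \<equiv> facet_proj (facets_on \<Omega> \<T> \<Gamma>\<^sub>C) \<Gamma>\<^sub>C \<beta>"
    and "p\<^sub>h \<equiv> CR_interpolant \<Omega> \<T> p_hat"
  assumes dim: "CARD('n) = 2 \<or> CARD('n) = 3"
    and domain: "polyhedral_lipschitz_domain \<Omega>"
    and relatively_open: "openin (top_of_set (frontier \<Omega>)) \<Gamma>\<^sub>D"
      "openin (top_of_set (frontier \<Omega>)) \<Gamma>\<^sub>C"
    and disjoint: "\<Gamma>\<^sub>D \<inter> \<Gamma>\<^sub>C = {}"
    and cover: "frontier \<Omega> = closure \<Gamma>\<^sub>D \<union> closure \<Gamma>\<^sub>C"
    and mesh: "simplicial_mesh \<Omega> \<T>"
    and facets_matched: "\<And>S. S \<in> \<S> \<Longrightarrow> (S \<subseteq> closure \<Gamma>\<^sub>D) \<noteq> (S \<subseteq> closure \<Gamma>\<^sub>C)"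
    and f: "square_integrable (lebesgue_on \<Omega>) f"
    and p\<^sub>D: "p\<^sub>D \<in> H_half \<Omega> \<S> \<Gamma>\<^sub>D"
    and p_hat: "p_hat \<in> H1 \<Omega>" "has_surface_trace \<Omega> \<S> \<Gamma>\<^sub>D p_hat p\<^sub>D"
    and K_measurable: "K \<in> borel_measurable (lebesgue_on \<Omega>)"
    and K_symmetric: "\<And>x. x \<in> \<Omega> \<Longrightarrow> transpose (K x) = K x"
    and k: "0 < k\<^sub>0" "k\<^sub>0 < k\<^sub>1"
    and K_elliptic: "\<And>x \<xi>. x \<in> \<Omega> \<Longrightarrow>
        k\<^sub>0 * (norm \<xi>)\<^sup>2 \<le> \<xi> \<bullet> (K x *v \<xi>) \<and> \<xi> \<bullet> (K x *v \<xi>) \<le> k\<^sub>1 * (norm \<xi>)\<^sup>2"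
    and \<alpha>\<beta>: "surface_L2 \<S> \<Gamma>\<^sub>C \<alpha>" "surface_L2 \<S> \<Gamma>\<^sub>C \<beta>"
      "surface_AE \<S> \<Gamma>\<^sub>C (\<lambda>x. \<alpha> x \<le> \<beta> x)"
    and compatible: "\<Gamma>\<^sub>D = {} \<Longrightarrow>
        surface_integral \<S> \<Gamma>\<^sub>C \<alpha> \<le> (LINT x|lebesgue_on \<Omega>. f x) \<and>
        (LINT x|lebesgue_on \<Omega>. f x) \<le> surface_integral \<S> \<Gamma>\<^sub>C \<beta>"
    and feasible: "dual_feasible \<Omega> \<T> \<Gamma>\<^sub>C f\<^sub>h \<alpha>\<^sub>h \<beta>\<^sub>h \<noteq> {}"
  shows "\<exists>u \<in> RT0 \<Omega> \<T>. \<exists>p \<in> L0_elements \<T>. \<exists>l\<^sub>a \<in> L0_facets \<S>\<^sub>C. \<exists>l\<^sub>b \<in> L0_facets \<S>\<^sub>C.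
      (\<forall>v \<in> RT0 \<Omega> \<T>. \<forall>q \<in> L0_elements \<T>.
         L2_inner \<Omega> (\<lambda>x. matrix_inv (K\<^sub>h x) *v elem_proj \<T> u x) (elem_proj \<T> v)
           - L2_inner \<Omega> p (weak_div \<Omega> v)
           + surface_inner \<S> \<Gamma>\<^sub>C (\<lambda>x. l\<^sub>a x - l\<^sub>b x) (normal_trace \<Omega> v)
           = - surface_inner \<S> \<Gamma>\<^sub>D (boundary_value \<Omega> p\<^sub>h) (normal_trace \<Omega> v) \<and>
         L2_inner \<Omega> (weak_div \<Omega> u) q = L2_inner \<Omega> f\<^sub>h q) \<and>
      (\<forall>S\<in>\<S>\<^sub>C. \<forall>x\<in>rel_interior S.
         \<alpha>\<^sub>h x \<le> normal_trace \<Omega> u x \<and> normal_trace \<Omega> u x \<le> \<beta>\<^sub>h x \<and>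
         l\<^sub>a x \<le> 0 \<and> l\<^sub>b x \<le> 0 \<and>
         l\<^sub>a x * (normal_trace \<Omega> u x - \<alpha>\<^sub>h x) = 0 \<and>
         l\<^sub>b x * (\<beta>\<^sub>h x - normal_trace \<Omega> u x) = 0) \<and>
      u \<in> dual_feasible \<Omega> \<T> \<Gamma>\<^sub>C f\<^sub>h \<alpha>\<^sub>h \<beta>\<^sub>h \<and>
      bdd_above (dual_energy \<Omega> \<T> \<Gamma>\<^sub>D K\<^sub>h p\<^sub>h ` dual_feasible \<Omega> \<T> \<Gamma>\<^sub>C f\<^sub>h \<alpha>\<^sub>h \<beta>\<^sub>h) \<and>
      dual_energy \<Omega> \<T> \<Gamma>\<^sub>D K\<^sub>h p\<^sub>h u
        = (SUP v \<in> dual_feasible \<Omega> \<T> \<Gamma>\<^sub>C f\<^sub>h \<alpha>\<^sub>h \<beta>\<^sub>h. dual_energy \<Omega> \<T> \<Gamma>\<^sub>D K\<^sub>h p\<^sub>h v) \<and>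
      (\<forall>w \<in> dual_feasible \<Omega> \<T> \<Gamma>\<^sub>C f\<^sub>h \<alpha>\<^sub>h \<beta>\<^sub>h.
         dual_energy \<Omega> \<T> \<Gamma>\<^sub>D K\<^sub>h p\<^sub>h w
           = (SUP v \<in> dual_feasible \<Omega> \<T> \<Gamma>\<^sub>C f\<^sub>h \<alpha>\<^sub>h \<beta>\<^sub>h. dual_energy \<Omega> \<T> \<Gamma>\<^sub>D K\<^sub>h p\<^sub>h v)
         \<longrightarrow> (AE x in lebesgue_on \<Omega>. w x = u x))"
proof -
  have lip: "lipschitz_domain \<Omega>" and bdd: "bounded \<Omega>"
    using domain by (auto simp: polyhedral_lipschitz_domain_def)
  have MD: "meshed_domain \<Omega> \<T>" by standard (use lip bdd mesh in auto)
  interpret meshed_domain \<Omega> \<T> by (rule MD)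
  define V where "V = RT0 \<Omega> \<T>"
  have V: "fun_subspace V" unfolding V_def by (rule RT0_subspace)
  have finC: "finite \<S>\<^sub>C" and CS: "\<S>\<^sub>C \<subseteq> \<S>"
    unfolding \<S>\<^sub>C_def \<S>_def facets_on_def using finite_boundary_facets[OF mesh] by auto
  have \<Gamma>_borel: "\<Gamma>\<^sub>C \<in> sets borel" "\<Gamma>\<^sub>D \<in> sets borel"
  proof -
    obtain U W where "open U" "\<Gamma>\<^sub>C = frontier \<Omega> \<inter> U" "open W" "\<Gamma>\<^sub>D = frontier \<Omega> \<inter> W"
      using relatively_open by (auto simp: openin_open)
    then show "\<Gamma>\<^sub>C \<in> sets borel" "\<Gamma>\<^sub>D \<in> sets borel" by auto
  qed
  have off: "\<Gamma>\<^sub>C \<inter> S = {}" if S: "S \<in> \<S>" "S \<notin> \<S>\<^sub>C" for S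
  proof -
    have "\<not> S \<subseteq> closure \<Gamma>\<^sub>C" using S by (auto simp: \<S>\<^sub>C_def \<S>_def facets_on_def)
    then have SD: "S \<subseteq> closure \<Gamma>\<^sub>D" using facets_matched[OF S(1)] by blast
    obtain U where U: "open U" "\<Gamma>\<^sub>C = frontier \<Omega> \<inter> U" using relatively_open(2) by (auto simp: openin_open)
    have "\<Gamma>\<^sub>D \<subseteq> frontier \<Omega>" using relatively_open(1) by (rule openin_imp_subset)
    \<comment> \<open>an open set that is disjoint from \<open>\<Gamma>\<^sub>D\<close> is disjoint from its closure\<close>
    then have "U \<inter> \<Gamma>\<^sub>D = {}" using U(2) disjoint by blast
    then have "U \<inter> closure \<Gamma>\<^sub>D = {}" using open_Int_closure_eq_empty[OF U(1)] by blast
    then show ?thesis using SD U(2) by blast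
  qed
  define m where "m = (\<lambda>S. measure (facet_measure S) \<Gamma>\<^sub>C)"
  have m: "0 < m S" if "S \<in> \<S>\<^sub>C" for S
    unfolding m_def using measure_facet_part_pos[OF relatively_open(2)] that by (simp add: \<S>\<^sub>C_def)

  define A where "A = (\<lambda>T. matrix_inv (L2_proj_const (lebesgue_on T) K))"
  have A_sym: "transpose (A T) = A T" and A_pos: "\<exists>c>0. \<forall>\<xi>. c * (norm \<xi>)\<^sup>2 \<le> \<xi> \<bullet> (A T *v \<xi>)"
    if T: "T \<in> \<T>" for T
  proof -
    note KT = mean_matrix_elliptic[OF MD T K_measurable K_symmetric k(1) K_elliptic]
    show "transpose (A T) = A T" "\<exists>c>0. \<forall>\<xi>. c * (norm \<xi>)\<^sup>2 \<le> \<xi> \<bullet> (A T *v \<xi>)"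
      unfolding A_def using inverse_symmetric_positive_definite[OF k(1) KT(2) KT(1)] by auto
  qed
  have A_nonneg: "0 \<le> \<xi> \<bullet> (A T *v \<xi>)" if T: "T \<in> \<T>" for T \<xi>
    using A_pos[OF T] by (metis less_imp_le mult_nonneg_nonneg order_trans zero_le_power2)
  have A_def0: "\<xi> = 0" if T: "T \<in> \<T>" and z: "\<xi> \<bullet> (A T *v \<xi>) = 0" for T \<xi>
  proof -
    obtain c where "0 < c" "c * (norm \<xi>)\<^sup>2 \<le> 0" using A_pos[OF T] z by metis
    then show ?thesis by (simp add: mult_le_0_iff)
  qed
  define aK where "aK = (\<lambda>u v. \<Sum>T\<in>\<T>. volume T * ((A T *v elem_mean T u) \<bullet> elem_mean T v))"
  \<comment> \<open>the divergence term makes the form definite\<close>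
  define a where "a = (\<lambda>u v. aK u v + (\<Sum>T\<in>\<T>. volume T * (elem_div T u * elem_div T v)))"
  have linear_mean: "elem_mean T (lin_comb s u t v) = s *\<^sub>R elem_mean T u + t *\<^sub>R elem_mean T v"
    if "u \<in> V" "v \<in> V" "T \<in> \<T>" for u v T s t
    using that elem_mean_lin_comb unfolding V_def by blast
  have linear_div: "linear_form V (elem_div T)" if "T \<in> \<T>" for T
    unfolding V_def by (rule elem_div_linear[OF that])
  have linear_flux: "linear_form V (facet_flux S)" if "S \<in> \<S>" for S
    unfolding V_def by (rule facet_flux_linear) (use that in \<open>simp add: \<S>_def\<close>)
  have a_terms: "a u v = (\<Sum>T\<in>\<T>. volume T *
      ((A T *v elem_mean T u) \<bullet> elem_mean T v + elem_div T u * elem_div T v))" for u v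
    by (simp add: a_def aK_def sum.distrib distrib_left)
  have a_semi: "semi_inner_product V a"
    unfolding semi_inner_product_def
  proof (intro conjI ballI)
    fix w assume w: "w \<in> V"
    show "linear_form V (a w)"
      unfolding linear_form_def
    proof (intro ballI allI)
      fix u v s t assume u: "u \<in> V" and v: "v \<in> V"
      show "a w (lin_comb s u t v) = s * a w u + t * a w v"
        unfolding a_terms sum_distrib_left sum.distrib[symmetric]
        by (rule sum.cong[OF refl])
          (simp add: linear_mean[OF u v] linear_formD[OF linear_div u v] inner_add_right algebra_simps)
    qed
  next
    fix u v assume "u \<in> V" "v \<in> V"
    show "a u v = a v u"
      unfolding a_terms
    proof (rule sum.cong[OF refl])
      fix T assume T: "T \<in> \<T>"
      have "(A T *v elem_mean T u) \<bullet> elem_mean T v = (A T *v elem_mean T v) \<bullet> elem_mean T u"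
        using symmetric_matrix_inner[OF A_sym[OF T]] inner_commute by metis
      then show "volume T * ((A T *v elem_mean T u) \<bullet> elem_mean T v + elem_div T u * elem_div T v)
          = volume T * ((A T *v elem_mean T v) \<bullet> elem_mean T u + elem_div T v * elem_div T u)"
        by (simp add: mult.commute)
    qed
  next
    fix v assume "v \<in> V"
    show "0 \<le> a v v"
      unfolding a_terms
    proof (rule sum_nonneg)
      fix T assume T: "T \<in> \<T>"
      show "0 \<le> volume T * ((A T *v elem_mean T v) \<bullet> elem_mean T v + elem_div T v * elem_div T v)"
        using A_nonneg[OF T, of "elem_mean T v"] volume_pos[OF T] by (simp add: inner_commute)
    qed
  qed
  have a_null: "elem_mean T v = 0" "elem_div T v = 0" if v: "a v v = 0" and T: "T \<in> \<T>" for v T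
  proof -
    have "volume T * ((A T *v elem_mean T v) \<bullet> elem_mean T v + elem_div T v * elem_div T v) = 0"
      using v unfolding a_terms
    proof (subst (asm) sum_nonneg_eq_0_iff)
      fix T assume T: "T \<in> \<T>"
      show "0 \<le> volume T * ((A T *v elem_mean T v) \<bullet> elem_mean T v + elem_div T v * elem_div T v)"
        using A_nonneg[OF T, of "elem_mean T v"] volume_pos[OF T] by (simp add: inner_commute)
    qed (use finite_elements T in auto)
    then have "(A T *v elem_mean T v) \<bullet> elem_mean T v + elem_div T v * elem_div T v = 0"
      using volume_pos[OF T] by simp
    moreover have "0 \<le> (A T *v elem_mean T v) \<bullet> elem_mean T v"
      using A_nonneg[OF T] by (simp add: inner_commute)
    moreover have "0 \<le> elem_div T v * elem_div T v" by simp
    ultimately have "(A T *v elem_mean T v) \<bullet> elem_mean T v = 0" "elem_div T v * elem_div T v = 0"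
      by linarith+
    then show "elem_mean T v = 0" "elem_div T v = 0" using A_def0[OF T] by (auto simp: inner_commute)
  qed

  define lD where "lD = (\<lambda>v. \<Sum>S\<in>\<S>. (LINT x|restrict_space (facet_measure S) \<Gamma>\<^sub>D. boundary_value \<Omega> p\<^sub>h x) * facet_flux S v)"
  have lD: "surface_inner \<S> \<Gamma>\<^sub>D (boundary_value \<Omega> p\<^sub>h) (normal_trace \<Omega> v) = lD v" if "v \<in> V" for v
    unfolding lD_def \<S>_def using surface_inner_normal_trace[OF \<Gamma>_borel(2)] that by (simp add: V_def)
  have linear_lD: "linear_form V (\<lambda>v. - lD v)"
  proof -
    have "linear_form V lD" unfolding lD_def by (intro linear_form_sum linear_flux)
    then show ?thesis by (simp add: linear_form_def algebra_simps)
  qed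
  have lD_null: "- lD v = 0" if v: "v \<in> V" "a v v = 0" for v
  proof -
    have "facet_flux S v = 0" if "S \<in> \<S>" for S
      using RT0_vanishes(2)[of v S] a_null[OF v(2)] v(1) that by (simp add: V_def \<S>_def)
    then show ?thesis by (simp add: lD_def)
  qed

  define g where "g = (\<lambda>T. L2_proj_const (lebesgue_on T) f)"
  define lo where "lo = (\<lambda>S. L2_proj_const (restrict_space (facet_measure S) \<Gamma>\<^sub>C) \<alpha>)"
  define hi where "hi = (\<lambda>S. L2_proj_const (restrict_space (facet_measure S) \<Gamma>\<^sub>C) \<beta>)"
  have fh: "f\<^sub>h x = g T" if "T \<in> \<T>" "x \<in> interior T" for T x
    unfolding f\<^sub>h_def g_def by (rule elem_proj_eq[OF that])
  have \<alpha>h: "\<alpha>\<^sub>h x = lo S" and \<beta>h: "\<beta>\<^sub>h x = hi S" if "S \<in> \<S>\<^sub>C" "x \<in> rel_interior S" for S x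
    using that facet_proj_eq unfolding \<alpha>\<^sub>h_def \<beta>\<^sub>h_def lo_def hi_def \<S>\<^sub>C_def by blast+
  define F where "F = dual_feasible \<Omega> \<T> \<Gamma>\<^sub>C f\<^sub>h \<alpha>\<^sub>h \<beta>\<^sub>h"
  have FV: "F \<subseteq> V" by (auto simp: F_def V_def dual_feasible_def)
  have F_iff: "v \<in> F \<longleftrightarrow> (\<forall>T\<in>\<T>. elem_div T v = g T) \<and> (\<forall>S\<in>\<S>\<^sub>C. lo S \<le> facet_flux S v \<and> facet_flux S v \<le> hi S)"
    if "v \<in> V" for v
    unfolding F_def \<S>\<^sub>C_def
    by (rule dual_feasible_iff) (use that fh \<alpha>h \<beta>h in \<open>auto simp: V_def \<S>\<^sub>C_def\<close>)
  obtain y where yF: "y \<in> F" using feasible unfolding F_def by blast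
  have y: "y \<in> V" "\<And>T. T \<in> \<T> \<Longrightarrow> elem_div T y = g T"
      "\<And>S. S \<in> \<S>\<^sub>C \<Longrightarrow> lo S \<le> facet_flux S y \<and> facet_flux S y \<le> hi S"
    using yF FV F_iff by blast+

  define J where "J = \<T> \<times> insert None (Some ` (Basis :: (real^'n) set))"
  define c where "c = (\<lambda>(T, i) v. case i of None \<Rightarrow> elem_div T v | Some e \<Rightarrow> elem_mean T v \<bullet> e)"
  have finJ: "finite J" using finite_elements by (simp add: J_def)
  have linear_c: "linear_form V (c j)" if "j \<in> J" for j
    using that linear_div linear_mean
    by (auto simp: J_def c_def linear_form_def inner_add_left split: option.splits)
  have c_null: "a v v = 0" if v: "v \<in> V" "\<And>j. j \<in> J \<Longrightarrow> c j v = 0" for v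
  proof -
    have "elem_div T v = 0" "elem_mean T v = 0" if T: "T \<in> \<T>" for T
    proof -
      show "elem_div T v = 0" using v(2)[of "(T, None)"] T by (simp add: J_def c_def)
      show "elem_mean T v = 0"
      proof (rule euclidean_eqI)
        fix e :: "real^'n" assume "e \<in> Basis"
        then show "elem_mean T v \<bullet> e = 0 \<bullet> e" using v(2)[of "(T, Some e)"] T by (simp add: J_def c_def)
      qed
    qed
    then show ?thesis by (simp add: a_terms)
  qed
  have linear_flux_C: "linear_form V (facet_flux S)" if "S \<in> \<S>\<^sub>C" for S
    using linear_flux that CS by blast
  obtain u p \<mu> \<nu> where u: "u \<in> V"
    and grad': "\<forall>v\<in>V. a u v - - lD v
        = (\<Sum>T\<in>\<T>. p T * elem_div T v) + (\<Sum>S\<in>\<S>\<^sub>C. (\<mu> S - \<nu> S) * facet_flux S v)"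
    and u_div': "\<forall>T\<in>\<T>. elem_div T u = g T"
    and u_flux': "\<forall>S\<in>\<S>\<^sub>C. lo S \<le> facet_flux S u \<and> facet_flux S u \<le> hi S"
    and \<mu>': "\<forall>S\<in>\<S>\<^sub>C. 0 \<le> \<mu> S \<and> \<mu> S * (facet_flux S u - lo S) = 0"
    and \<nu>': "\<forall>S\<in>\<S>\<^sub>C. 0 \<le> \<nu> S \<and> \<nu> S * (hi S - facet_flux S u) = 0"
    by (rule kkt_mixed[where V = V and a = a and c = c and l = "\<lambda>v. - lD v" and e = elem_div
          and n = facet_flux and y = y and E = \<T> and I = \<S>\<^sub>C and J = J and g = g and lo = lo and hi = hi,
          OF finite_elements finC finJ V a_semi linear_c c_null linear_lD lD_null linear_div linear_flux_C y])
  note grad = bspec[OF grad'] and u_div = bspec[OF u_div'] and u_flux = bspec[OF u_flux']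
    and \<mu> = bspec[OF \<mu>'] and \<nu> = bspec[OF \<nu>']

  have uF: "u \<in> F" using F_iff[OF u] u_div u_flux by blast
  have L2K: "L2_inner \<Omega> (\<lambda>x. matrix_inv (K\<^sub>h x) *v elem_proj \<T> w x) (elem_proj \<T> v) = aK w v" for w v
    unfolding L2_inner_def aK_def
    by (rule integral_elementwise, rule always_eventually)
      (simp add: K\<^sub>h_def A_def elem_mean_def elem_proj_eq)
  have energy: "dual_energy \<Omega> \<T> \<Gamma>\<^sub>D K\<^sub>h p\<^sub>h v = - (1/2) * aK v v - lD v" if v: "v \<in> V" for v
  proof -
    have "(LINT x|lebesgue_on \<Omega>. (norm (matrix_sqrt (matrix_inv (K\<^sub>h x)) *v elem_proj \<T> v x))\<^sup>2)
        = (\<Sum>T\<in>\<T>. volume T * ((A T *v elem_mean T v) \<bullet> elem_mean T v))"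
    proof (rule integral_elementwise, intro always_eventually allI impI)
      fix T x assume T: "T \<in> \<T>" "x \<in> interior T"
      obtain c where c: "0 < c" "\<And>\<xi>. c * (norm \<xi>)\<^sup>2 \<le> \<xi> \<bullet> (A T *v \<xi>)" using A_pos[OF T(1)] by blast
      have "matrix_inv (K\<^sub>h x) = A T" "elem_proj \<T> v x = elem_mean T v"
        by (simp_all add: K\<^sub>h_def A_def elem_mean_def elem_proj_eq[OF T])
      then show "(norm (matrix_sqrt (matrix_inv (K\<^sub>h x)) *v elem_proj \<T> v x))\<^sup>2
          = (A T *v elem_mean T v) \<bullet> elem_mean T v"
        using norm_matrix_sqrt[OF c A_sym[OF T(1)]] by (simp add: inner_commute)
    qed
    then show ?thesis unfolding dual_energy_def aK_def using lD[OF v] by (simp add: \<S>_def)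
  qed
  \<comment> \<open>half of the divergence term of \<open>a v v\<close> at any feasible \<open>v\<close>\<close>
  define C where "C = (\<Sum>T\<in>\<T>. volume T * (g T * g T)) / 2"
  have energy_F: "dual_energy \<Omega> \<T> \<Gamma>\<^sub>D K\<^sub>h p\<^sub>h v = C - (a v v / 2 - - lD v)" if v: "v \<in> F" for v
  proof -
    have vV: "v \<in> V" using v FV by blast
    have "(\<Sum>T\<in>\<T>. volume T * (elem_div T v * elem_div T v)) = (\<Sum>T\<in>\<T>. volume T * (g T * g T))"
      using v F_iff[OF vV] by (intro sum.cong) auto
    then show ?thesis by (simp add: energy[OF vV] C_def a_def add_divide_distrib)
  qed
  have optimal: "dual_energy \<Omega> \<T> \<Gamma>\<^sub>D K\<^sub>h p\<^sub>h w + a (lin_comb 1 w (-1) u) (lin_comb 1 w (-1) u) / 2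
      \<le> dual_energy \<Omega> \<T> \<Gamma>\<^sub>D K\<^sub>h p\<^sub>h u" if w: "w \<in> F" for w
  proof -
    have wV: "w \<in> V" using w FV by blast
    have "a u u / 2 - - lD u + a (lin_comb 1 w (-1) u) (lin_comb 1 w (-1) u) / 2 \<le> a w w / 2 - - lD w"
      by (rule kkt_sufficient[where E = \<T> and I = \<S>\<^sub>C and e = elem_div and n = facet_flux and g = g
            and p = p and \<mu> = \<mu> and \<nu> = \<nu> and lo = lo and hi = hi, OF V a_semi linear_lD linear_div linear_flux_C u u_div grad \<mu> \<nu> wV])
        (use w F_iff[OF wV] in auto)
    then show ?thesis unfolding energy_F[OF w] energy_F[OF uF] by linarith
  qed
  have diff_V: "lin_comb 1 w (-1) u \<in> V" if "w \<in> F" for w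
    using fun_subspaceD[OF V _ u] that FV by blast
  have max: "dual_energy \<Omega> \<T> \<Gamma>\<^sub>D K\<^sub>h p\<^sub>h w \<le> dual_energy \<Omega> \<T> \<Gamma>\<^sub>D K\<^sub>h p\<^sub>h u" if w: "w \<in> F" for w
    using optimal[OF w] semi_inner_productD(3)[OF a_semi diff_V[OF w] diff_V[OF w] diff_V[OF w]] by linarith
  have bdd_F: "bdd_above (dual_energy \<Omega> \<T> \<Gamma>\<^sub>D K\<^sub>h p\<^sub>h ` F)" using max by (intro bdd_aboveI2)
  have sup_F: "dual_energy \<Omega> \<T> \<Gamma>\<^sub>D K\<^sub>h p\<^sub>h u = (SUP v\<in>F. dual_energy \<Omega> \<T> \<Gamma>\<^sub>D K\<^sub>h p\<^sub>h v)"
    by (rule cSup_eq_maximum[symmetric]) (use uF max in auto)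
  have unique: "AE x in lebesgue_on \<Omega>. w x = u x"
    if w: "w \<in> F" and eq: "dual_energy \<Omega> \<T> \<Gamma>\<^sub>D K\<^sub>h p\<^sub>h w = (SUP v\<in>F. dual_energy \<Omega> \<T> \<Gamma>\<^sub>D K\<^sub>h p\<^sub>h v)" for w
  proof -
    define d where "d = lin_comb 1 w (-1) u"
    have d: "d \<in> V" unfolding d_def by (rule diff_V[OF w])
    have "a d d = 0"
      using optimal[OF w] eq sup_F semi_inner_productD(3)[OF a_semi d d d] unfolding d_def[symmetric] by linarith
    then have "d x = 0" if "T \<in> \<T>" "x \<in> interior T" for T x
      using RT0_vanishes(1)[of d T x] a_null[of d] d that by (simp add: V_def)
    then have "AE x in lebesgue. x \<in> \<Omega> \<longrightarrow> w x = u x"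
      using AE_mesh_interior by (auto simp: d_def lin_comb_def elim!: eventually_mono)
    then show ?thesis by (simp add: AE_restrict_space_iff)
  qed

  \<comment> \<open>the multiplier \<open>p T\<close> belongs to the form \<open>a\<close>; subtracting \<open>volume T * g T\<close> removes the
    divergence term, and dividing by the volume turns the coefficient into a density\<close>
  define ph where "ph = (\<lambda>x. (\<lambda>T. (p T - volume T * g T) / volume T) (THE T. T \<in> \<T> \<and> x \<in> interior T))"
  have ph: "ph x = (p T - volume T * g T) / volume T" if "T \<in> \<T>" "x \<in> interior T" for T x
  proof -
    have "(THE T. T \<in> \<T> \<and> x \<in> interior T) = T"
      by (rule the_equality) (use that interiors_disjoint in blast)+
    then show ?thesis by (simp add: ph_def)
  qed
  define facet where "facet = (\<lambda>x. THE S. S \<in> \<S>\<^sub>C \<and> x \<in> rel_interior S)"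
  have facet: "facet x = S" if "S \<in> \<S>\<^sub>C" "x \<in> rel_interior S" for S x
    unfolding facet_def
  proof (rule the_equality)
    show "S' = S" if S': "S' \<in> \<S>\<^sub>C \<and> x \<in> rel_interior S'" for S'
      by (rule boundary_facets_eqI[OF lipschitz mesh])
        (use S' \<open>S \<in> \<S>\<^sub>C\<close> \<open>x \<in> rel_interior S\<close> CS in \<open>auto simp: \<S>_def\<close>)
  qed (use that in blast)
  \<comment> \<open>densities over the part of \<open>\<Gamma>\<^sub>C\<close> in the facet; the sign convention is that of the mixed problem\<close>
  define la where "la = (\<lambda>x. - \<mu> (facet x) / m (facet x))"
  define lb where "lb = (\<lambda>x. - \<nu> (facet x) / m (facet x))"
  have lab: "la x = - \<mu> S / m S" "lb x = - \<nu> S / m S" if "S \<in> \<S>\<^sub>C" "x \<in> rel_interior S" for S x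
    by (simp_all add: la_def lb_def facet[OF that])
  have integral_weak_div: "L2_inner \<Omega> (weak_div \<Omega> v) q = (\<Sum>T\<in>\<T>. volume T * (elem_div T v * k T))"
    if v: "v \<in> V" and q: "\<And>T x. T \<in> \<T> \<Longrightarrow> x \<in> interior T \<Longrightarrow> q x = k T" for v q k
    unfolding L2_inner_def
  proof (rule integral_elementwise)
    fix T assume T: "T \<in> \<T>"
    show "AE x in lebesgue. x \<in> interior T \<longrightarrow> weak_div \<Omega> v x \<bullet> q x = elem_div T v * k T"
      using AE_weak_div[OF v[unfolded V_def] T] by eventually_elim (simp add: q[OF T])
  qed
  have stationarity: "L2_inner \<Omega> (\<lambda>x. matrix_inv (K\<^sub>h x) *v elem_proj \<T> u x) (elem_proj \<T> v)
       - L2_inner \<Omega> ph (weak_div \<Omega> v)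
       + surface_inner \<S> \<Gamma>\<^sub>C (\<lambda>x. la x - lb x) (normal_trace \<Omega> v)
       = - surface_inner \<S> \<Gamma>\<^sub>D (boundary_value \<Omega> p\<^sub>h) (normal_trace \<Omega> v)" if v: "v \<in> V" for v
  proof -
    have "L2_inner \<Omega> ph (weak_div \<Omega> v) = L2_inner \<Omega> (weak_div \<Omega> v) ph"
      by (simp add: L2_inner_def mult.commute)
    also have "\<dots> = (\<Sum>T\<in>\<T>. volume T * (elem_div T v * ((p T - volume T * g T) / volume T)))"
      by (rule integral_weak_div[OF v ph])
    also have "\<dots> = (\<Sum>T\<in>\<T>. p T * elem_div T v - volume T * (elem_div T u * elem_div T v))"
    proof (rule sum.cong[OF refl])
      fix T assume T: "T \<in> \<T>"
      show "volume T * (elem_div T v * ((p T - volume T * g T) / volume T))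
          = p T * elem_div T v - volume T * (elem_div T u * elem_div T v)"
        using volume_pos[OF T] u_div[OF T] by (simp add: field_simps)
    qed
    finally have 1: "L2_inner \<Omega> ph (weak_div \<Omega> v)
        = (\<Sum>T\<in>\<T>. p T * elem_div T v) - (\<Sum>T\<in>\<T>. volume T * (elem_div T u * elem_div T v))"
      by (simp add: sum_subtractf)
    have "surface_inner \<S> \<Gamma>\<^sub>C (\<lambda>x. la x - lb x) (normal_trace \<Omega> v)
        = (\<Sum>S\<in>\<S>\<^sub>C. m S * ((\<nu> S - \<mu> S) / m S) * facet_flux S v)"
      unfolding \<S>_def \<S>\<^sub>C_def m_def
    proof (rule surface_inner_facetwise_constant[OF \<Gamma>_borel(1)])
      show "v \<in> RT0 \<Omega> \<T>" using v by (simp add: V_def)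
      show "\<Gamma>\<^sub>C \<inter> S = {}" if "S \<in> boundary_facets \<Omega> \<T>" "S \<notin> facets_on \<Omega> \<T> \<Gamma>\<^sub>C" for S
        using off that by (simp add: \<S>_def \<S>\<^sub>C_def)
      show "la x - lb x = (\<nu> S - \<mu> S) / measure (facet_measure S) \<Gamma>\<^sub>C"
        if "S \<in> facets_on \<Omega> \<T> \<Gamma>\<^sub>C" "x \<in> rel_interior S" for S x
        using lab[of S x] that by (simp add: \<S>\<^sub>C_def m_def diff_divide_distrib)
    qed
    also have "\<dots> = - (\<Sum>S\<in>\<S>\<^sub>C. (\<mu> S - \<nu> S) * facet_flux S v)"
      unfolding sum_negf[symmetric]
    proof (rule sum.cong[OF refl])
      fix S assume S: "S \<in> \<S>\<^sub>C"
      show "m S * ((\<nu> S - \<mu> S) / m S) * facet_flux S v = - ((\<mu> S - \<nu> S) * facet_flux S v)"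
        using m[OF S] by (simp add: field_simps)
    qed
    finally have 2: "surface_inner \<S> \<Gamma>\<^sub>C (\<lambda>x. la x - lb x) (normal_trace \<Omega> v)
        = - (\<Sum>S\<in>\<S>\<^sub>C. (\<mu> S - \<nu> S) * facet_flux S v)" .
    show ?thesis unfolding L2K 1 2 lD[OF v] using grad[OF v] by (simp add: a_def)
  qed
  have divergence: "L2_inner \<Omega> (weak_div \<Omega> u) q = L2_inner \<Omega> f\<^sub>h q" if q: "q \<in> L0_elements \<T>" for q
  proof -
    have "\<forall>T\<in>\<T>. \<exists>c. \<forall>x\<in>interior T. q x = c" using q by (simp add: L0_elements_def)
    then obtain k where k: "\<And>T x. T \<in> \<T> \<Longrightarrow> x \<in> interior T \<Longrightarrow> q x = k T" by metis
    have "L2_inner \<Omega> f\<^sub>h q = (\<Sum>T\<in>\<T>. volume T * (g T * k T))"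
      unfolding L2_inner_def
      by (rule integral_elementwise, rule always_eventually) (simp add: fh k)
    also have "\<dots> = (\<Sum>T\<in>\<T>. volume T * (elem_div T u * k T))"
      by (rule sum.cong[OF refl]) (simp add: u_div)
    also have "\<dots> = L2_inner \<Omega> (weak_div \<Omega> u) q"
      by (rule integral_weak_div[OF u k, symmetric])
    finally show ?thesis by simp
  qed
  have facet_conditions: "\<alpha>\<^sub>h x \<le> normal_trace \<Omega> u x \<and> normal_trace \<Omega> u x \<le> \<beta>\<^sub>h x \<and>
       la x \<le> 0 \<and> lb x \<le> 0 \<and>
       la x * (normal_trace \<Omega> u x - \<alpha>\<^sub>h x) = 0 \<and>
       lb x * (\<beta>\<^sub>h x - normal_trace \<Omega> u x) = 0" if S: "S \<in> \<S>\<^sub>C" "x \<in> rel_interior S" for S x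
  proof -
    have n: "normal_trace \<Omega> u x = facet_flux S u"
      using normal_trace_eq_flux[of S u x] S CS u by (auto simp: V_def \<S>_def)
    show ?thesis
      unfolding n \<alpha>h[OF S] \<beta>h[OF S] lab[OF S]
      using u_flux[OF S(1)] \<mu>[OF S(1)] \<nu>[OF S(1)] m[OF S(1)] by (auto simp: divide_le_0_iff)
  qed
  have "ph \<in> L0_elements \<T>" using ph by (auto simp: L0_elements_def)
  moreover have "la \<in> L0_facets \<S>\<^sub>C" "lb \<in> L0_facets \<S>\<^sub>C" using lab by (auto simp: L0_facets_def)
  ultimately show ?thesis
    using u stationarity divergence facet_conditions uF bdd_F sup_F unique
    unfolding V_def F_def
    by (intro bexI[of _ u] bexI[of _ ph] bexI[of _ la] bexI[of _ lb] conjI ballI impI) auto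
qed

end
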